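(* Let $r, n$ be fixed integers with $2\leq r\leq n$. Let $\Delta$ be an $n$-dimensional convex body in $\mathbb{R}^n$ such that $$V(K_1,\dots,K_r,\Delta[n-r])\,V_n(\Delta)^{r-1}\leq \prod_{i=1}^r V(K_i,\Delta[n-1])$$ holds for all convex bodies $K_1,\dots,K_r$ in $\mathbb{R}^n$. Then $\Delta$ does not contain any strict points.
   Context: A convex body is a non-empty convex compact subset of $\mathbb{R}^n$ (not necessarily with non-empty interior). A boundary point $x\in\partial K$ of a convex body $K$ is called a strict point of $K$ if $x$ does not belong to any (non-degenerate) line segment contained in the boundary $\partial K$. $V_n(K)$ denotes the $n$-dimensional Euclidean volume of $K$, and $V(K_1,\dots,K_n)$ denotes the $n$-dimensional mixed volume of convex bodies $K_1,\dots,K_n$ in $\mathbb{R}^n$, normalized so that $V(K,\dots,K)=V_n(K)$. The notation $K[m]$ inside a mixed volume means that the body $K$ is repeated $m$ times (and is absent if $m=0$). *)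

theory Defs
  imports "HOL-Analysis.Analysis" "HOL-Library.Set_Algebras"
begin

definition convex_body :: "'a::euclidean_space set \<Rightarrow> bool" where
  "convex_body K \<longleftrightarrow> K \<noteq> {} \<and> convex K \<and> compact K"

definition strict_point :: "'a::euclidean_space set \<Rightarrow> 'a \<Rightarrow> bool" where
  "strict_point K x \<longleftrightarrow>
     x \<in> frontier K \<and>
     (\<nexists>a b. a \<noteq> b \<and> x \<in> closed_segment a b \<and> closed_segment a b \<subseteq> frontier K)"

text \<open>Sums of sets are Minkowski sums (from \<^theory>\<open>HOL-Library.Set_Algebras\<close>).\<close>

definition minkowski_combination :: "(nat \<Rightarrow> real) \<Rightarrow> 'a::real_vector set list \<Rightarrow> 'a set" where
  "minkowski_combination t Ks = (\<Sum>i<length Ks. (\<lambda>x. t i *\<^sub>R x) ` (Ks ! i))"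

text \<open>Exponent vectors of the monomials of degree \<open>d\<close> in \<open>t 0, \<dots>, t (k - 1)\<close>;
  they vanish outside \<open>{..<k}\<close>, so that there are finitely many of them.\<close>

definition exponents :: "nat \<Rightarrow> nat \<Rightarrow> (nat \<Rightarrow> nat) set" where
  "exponents k d = {\<alpha>. (\<forall>i\<ge>k. \<alpha> i = 0) \<and> (\<Sum>i<k. \<alpha> i) = d}"

text \<open>By Minkowski's theorem, for convex bodies \<open>K\<^sub>1, \<dots>, K\<^sub>k\<close> in \<open>\<real>\<^sup>n\<close> the volume
  of \<open>t\<^sub>1 K\<^sub>1 + \<dots> + t\<^sub>k K\<^sub>k\<close> is a homogeneous polynomial of degree \<open>n\<close> in
  \<open>t\<^sub>1, \<dots>, t\<^sub>k \<ge> 0\<close>; \<open>c\<close> below is the family of its coefficients.\<close>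

definition volume_coeffs :: "(real ^ 'n::finite) set list \<Rightarrow> ((nat \<Rightarrow> nat) \<Rightarrow> real) \<Rightarrow> bool" where
  "volume_coeffs Ks c \<longleftrightarrow>
     (\<forall>t. (\<forall>i<length Ks. 0 \<le> t i) \<longrightarrow>
        measure lebesgue (minkowski_combination t Ks) =
        (\<Sum>\<alpha>\<in>exponents (length Ks) CARD('n). c \<alpha> * (\<Prod>i<length Ks. t i ^ \<alpha> i)))"

text \<open>The mixed volume of \<open>n\<close> convex bodies in \<open>\<real>\<^sup>n\<close> is the coefficient of
  \<open>t\<^sub>1 \<cdots> t\<^sub>n\<close> divided by \<open>n!\<close>, so that \<open>V(K,\<dots>,K)\<close> is the volume of \<open>K\<close>.
  It is meaningful only for lists of \<open>n\<close> convex bodies.\<close>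

definition mixed_volume :: "(real ^ 'n::finite) set list \<Rightarrow> real" where
  "mixed_volume Ks =
     (THE v. \<exists>c. volume_coeffs Ks c \<and>
                 v = c (\<lambda>i. if i < length Ks then 1 else 0) / fact (length Ks))"

end

theory Submission imports Defs
begin

text \<open>Let \<open>x\<close> be a strict point of \<open>\<Delta>\<close>, \<open>x + u\<close> an interior point, \<open>I = [0, u]\<close> and \<open>K\<close> the
  convex hull of \<open>\<Delta>\<close> without a small ball around \<open>x\<close>. Then \<open>K\<close> and \<open>\<Delta>\<close> have the same projection
  along \<open>u\<close>, so \<open>V(I, K, \<Delta>[n-2]) = V(I, \<Delta>[n-1]) > 0\<close>. On the other hand
  \<open>V(K, \<Delta>[n-1]) < V(\<Delta>)\<close>: as \<open>x\<close> is strict, the support function of \<open>K\<close> is smaller by a constant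
  than that of \<open>\<Delta>\<close> in all normal directions near \<open>x\<close>, so \<open>(1 - t) \<Delta> + t K\<close> misses a boundary
  layer of \<open>\<Delta>\<close> whose volume is at least linear in \<open>t\<close>. The inequality for \<open>I, K, \<Delta>, \<dots>, \<Delta>\<close>
  is therefore violated.

  Mixed volumes only make sense by Minkowski's theorem. For polytopes \<open>P\<^sub>i = conv S\<^sub>i\<close>, the gradient
  of \<open>\<Sum> t\<^sub>i ln (\<Sum>y\<in>S\<^sub>i. exp (x \<bullet> y))\<close> maps the whole space injectively onto \<open>\<Sum> t\<^sub>i P\<^sub>i\<close> up to its
  boundary, so the volume is the integral of \<open>det (\<Sum> t\<^sub>i A\<^sub>i(x))\<close>, where \<open>A\<^sub>i\<close> are the Hessians,
  and this is a polynomial in \<open>t\<close>. Its coefficients are fixed linear combinations of finitely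
  many of its values, which lets the theorem pass to limits of polytopes.\<close>

subsection \<open>Coefficients of homogeneous polynomials\<close>

text \<open>\<open>mixed_volume\<close> merely selects a coefficient, so every property of it has to
  be read off volumes. Two readings suffice; neither monotonicity nor multilinearity nor surface
  area measures occur. The volume at \<open>t\<close> minus the volume at \<open>t(0 := 0)\<close>
  determines the coefficient, so exchanging \<open>K\<close> for \<Delta> next to a segment only
  requires that both gain the same volume when swept along it. And n V(K, \<Delta>[n-1]) is the
  coefficient of a b^(n-1) in vol(a K + b \<Delta>), so the strict inequality is one about
  difference quotients. Inclusion alone would give V(K, \<Delta>[n-1]) \<le> V(\<Delta>); a loss of
  first order needs a whole piece of boundary whose supporting hyperplanes move inwards by a fixed
  amount. Strictness provides it: no supporting hyperplane at the point touches \<Delta> elsewhere.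
  The gradients in Minkowski's theorem are the moment maps of toric geometry. They are chosen
  because they add when the polytopes are added: for every \<open>t\<close> the domain is the whole
  space and the Jacobian is linear in \<open>t\<close>.\<close>

lemma dual_basis_of_powers:
  "\<exists>w :: nat \<Rightarrow> nat \<Rightarrow> real. \<forall>a\<le>d. \<forall>b\<le>d.
     (\<Sum>m\<le>d. w a m * real m ^ b) = (if a = b then 1 else 0)"
proof -
  \<comment> \<open>The Lagrange polynomials at the nodes 0, ..., d. Interpolating X^b there
    reproduces it for b \<le> d, and comparing coefficients shows that
    \<open>w a m = coeff (L m) a\<close> works.\<close>
  define L :: "nat \<Rightarrow> real poly" where
    "L m = (\<Prod>j\<in>{..d} - {m}. smult (1 / (real m - real j)) [:- real j, 1:])" for m
  have deg: "degree (L m) \<le> d" if "m \<le> d" for m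
  proof -
    have "degree (L m) \<le> sum (degree \<circ> (\<lambda>j. smult (1 / (real m - real j)) [:- real j, 1:])) ({..d} - {m})"
      unfolding L_def by (rule degree_prod_sum_le) simp
    also have "\<dots> \<le> (\<Sum>j\<in>{..d} - {m}. 1)"
      by (rule sum_mono) auto
    also have "\<dots> = d" using that by simp
    finally show ?thesis .
  qed
  have val: "poly (L m) (real j) = (if j = m then 1 else 0)" if "m \<le> d" "j \<le> d" for m j
  proof (cases "j = m")
    case True
    have "poly (smult (1 / (real m - real i)) [:- real i, 1:]) (real m) = 1" if "i \<noteq> m" for i
      using that by (simp add: diff_divide_distrib[symmetric])
    then show ?thesis using True by (auto simp: L_def poly_prod simp del: poly_smult poly_pCons intro!: prod.neutral)
  next
    case False
    then show ?thesis using that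
      by (auto simp: L_def poly_prod intro!: prod_zero)
  qed
  have "(\<Sum>m\<le>d. smult (real m ^ b) (L m)) = monom 1 b" if "b \<le> d" for b
  proof (rule poly_eqI_degree)
    fix x assume x: "x \<in> real ` {..d}"
    then obtain j where j: "x = real j" "j \<le> d" by auto
    have "poly (\<Sum>m\<le>d. smult (real m ^ b) (L m)) x = (\<Sum>m\<le>d. real m ^ b * (if j = m then 1 else 0))"
      unfolding poly_sum using j val by (intro sum.cong) (auto simp: poly_monom)
    also have "\<dots> = (\<Sum>m\<le>d. if j = m then real m ^ b else 0)"
      by (intro sum.cong) auto
    finally show "poly (\<Sum>m\<le>d. smult (real m ^ b) (L m)) x = poly (monom 1 b) x"
      using j by (simp add: poly_monom)
  next
    have "degree (\<Sum>m\<le>d. smult (real m ^ b) (L m)) \<le> d"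
      using deg by (intro degree_sum_le) (auto intro: order_trans[OF degree_smult_le])
    then show "degree (\<Sum>m\<le>d. smult (real m ^ b) (L m)) < card (real ` {..d})"
      by (simp add: card_image)
    show "degree (monom (1::real) b) < card (real ` {..d})"
      using that by (simp add: card_image degree_monom_eq)
  qed
  then have "(\<Sum>m\<le>d. coeff (L m) a * real m ^ b) = (if a = b then 1 else 0)" if "b \<le> d" for a b
  proof -
    have "(\<Sum>m\<le>d. coeff (L m) a * real m ^ b) = coeff (\<Sum>m\<le>d. smult (real m ^ b) (L m)) a"
      by (simp add: coeff_sum mult.commute)
    then show ?thesis using that \<open>\<And>b. b \<le> d \<Longrightarrow> _ = monom 1 b\<close>[of b] by auto
  qed
  then show ?thesis
    by (intro exI[of _ "\<lambda>a m. coeff (L m) a"]) auto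
qed

lemma exponents_le: "\<alpha> \<in> exponents k d \<Longrightarrow> \<alpha> i \<le> d"
  using member_le_sum[of i "{..<k}" \<alpha>] by (cases "i < k") (auto simp: exponents_def)

lemma finite_exponents [simp]: "finite (exponents k d)"
proof (rule finite_subset)
  show "exponents k d \<subseteq> (\<lambda>f i. if i < k then f i else 0) ` PiE {..<k} (\<lambda>_. {..d})"
  proof
    fix \<alpha> assume a: "\<alpha> \<in> exponents k d"
    have "\<alpha> = (\<lambda>i. if i < k then restrict \<alpha> {..<k} i else 0)"
      using a by (auto simp: exponents_def fun_eq_iff)
    moreover have "restrict \<alpha> {..<k} \<in> PiE {..<k} (\<lambda>_. {..d})"
      using exponents_le[OF a] by auto
    ultimately show "\<alpha> \<in> (\<lambda>f i. if i < k then f i else 0) ` PiE {..<k} (\<lambda>_. {..d})"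
      by blast
  qed
qed (auto intro!: finite_imageI finite_PiE)

lemma exponents_eqI:
  "\<alpha> \<in> exponents k d \<Longrightarrow> \<beta> \<in> exponents k d \<Longrightarrow> (\<And>i. i < k \<Longrightarrow> \<alpha> i = \<beta> i) \<Longrightarrow> \<alpha> = \<beta>"
  by (auto simp: exponents_def fun_eq_iff) (metis not_less)

text \<open>Evaluation on the grid {0, ..., d}^k, with weights that are products of the one-variable
  dual basis. What matters is that \<open>W\<close> is chosen before \<open>c\<close>: integrability
  or convergence of the values passes to the coefficients.\<close>

lemma coefficient_functional:
  obtains W :: "(nat \<Rightarrow> nat) \<Rightarrow> (nat \<Rightarrow> nat) \<Rightarrow> real" where
    "\<And>c \<alpha>. \<alpha> \<in> exponents k d \<Longrightarrow>
       c \<alpha> = (\<Sum>m\<in>PiE {..<k} (\<lambda>_. {..d}). W \<alpha> m *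
         (\<Sum>\<beta>\<in>exponents k d. c \<beta> * (\<Prod>i<k. real (m i) ^ \<beta> i)))"
proof -
  obtain w :: "nat \<Rightarrow> nat \<Rightarrow> real" where w: "\<And>a b. a \<le> d \<Longrightarrow> b \<le> d \<Longrightarrow>
     (\<Sum>m\<le>d. w a m * real m ^ b) = (if a = b then 1 else 0)"
    using dual_basis_of_powers[of d] by blast
  define W where "W \<alpha> m = (\<Prod>i<k. w (\<alpha> i) (m i))" for \<alpha> m :: "nat \<Rightarrow> nat"
  have dual: "(\<Sum>m\<in>PiE {..<k} (\<lambda>_. {..d}). W \<alpha> m * (\<Prod>i<k. real (m i) ^ \<beta> i)) =
      (if \<alpha> = \<beta> then 1 else 0)"
    if ab: "\<alpha> \<in> exponents k d" "\<beta> \<in> exponents k d" for \<alpha> \<beta>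
  proof -
    have "(\<Sum>m\<in>PiE {..<k} (\<lambda>_. {..d}). W \<alpha> m * (\<Prod>i<k. real (m i) ^ \<beta> i)) =
        (\<Prod>i<k. \<Sum>m\<le>d. w (\<alpha> i) m * real m ^ \<beta> i)"
      by (subst prod_sum_PiE) (auto simp: W_def prod.distrib)
    also have "\<dots> = (\<Prod>i<k. if \<alpha> i = \<beta> i then 1 else 0)"
      using ab by (intro prod.cong refl w exponents_le)
    also have "\<dots> = (if \<alpha> = \<beta> then 1 else 0)"
      using exponents_eqI[OF ab] by (auto intro!: prod_zero)
    finally show ?thesis .
  qed
  show ?thesis
  proof (rule that[of W])
    fix c :: "(nat \<Rightarrow> nat) \<Rightarrow> real" and \<alpha> assume a: "\<alpha> \<in> exponents k d"
    have "(\<Sum>m\<in>PiE {..<k} (\<lambda>_. {..d}). W \<alpha> m *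
         (\<Sum>\<beta>\<in>exponents k d. c \<beta> * (\<Prod>i<k. real (m i) ^ \<beta> i))) =
       (\<Sum>m\<in>PiE {..<k} (\<lambda>_. {..d}).
         (\<Sum>\<beta>\<in>exponents k d. c \<beta> * (W \<alpha> m * (\<Prod>i<k. real (m i) ^ \<beta> i))))"
      by (simp add: sum_distrib_left mult_ac)
    also have "\<dots> = (\<Sum>\<beta>\<in>exponents k d. c \<beta> *
       (\<Sum>m\<in>PiE {..<k} (\<lambda>_. {..d}). W \<alpha> m * (\<Prod>i<k. real (m i) ^ \<beta> i)))"
      by (subst sum.swap) (simp add: sum_distrib_left)
    also have "\<dots> = (\<Sum>\<beta>\<in>exponents k d. c \<beta> * (if \<alpha> = \<beta> then 1 else 0))"
      by (intro sum.cong refl) (simp add: dual[OF a])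
    also have "\<dots> = c \<alpha>"
      using a by (simp add: if_distrib cong: if_cong)
    finally show "c \<alpha> = (\<Sum>m\<in>PiE {..<k} (\<lambda>_. {..d}). W \<alpha> m *
         (\<Sum>\<beta>\<in>exponents k d. c \<beta> * (\<Prod>i<k. real (m i) ^ \<beta> i)))" ..
  qed
qed

lemma coefficients_unique:
  assumes "\<And>t. (\<And>i. i < k \<Longrightarrow> 0 \<le> t i) \<Longrightarrow>
     (\<Sum>\<alpha>\<in>exponents k d. c \<alpha> * (\<Prod>i<k. t i ^ \<alpha> i)) =
     (\<Sum>\<alpha>\<in>exponents k d. c' \<alpha> * (\<Prod>i<k. (t i :: real) ^ \<alpha> i))"
    and "\<alpha> \<in> exponents k d"
  shows "c \<alpha> = c' \<alpha>"
proof -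
  obtain W :: "(nat \<Rightarrow> nat) \<Rightarrow> (nat \<Rightarrow> nat) \<Rightarrow> real" where
    W: "\<And>c \<alpha>. \<alpha> \<in> exponents k d \<Longrightarrow>
       c \<alpha> = (\<Sum>m\<in>PiE {..<k} (\<lambda>_. {..d}). W \<alpha> m *
         (\<Sum>\<beta>\<in>exponents k d. c \<beta> * (\<Prod>i<k. real (m i) ^ \<beta> i)))"
    by (rule coefficient_functional[of k d]) blast
  have "(\<Sum>\<beta>\<in>exponents k d. c \<beta> * (\<Prod>i<k. real (m i) ^ \<beta> i)) =
      (\<Sum>\<beta>\<in>exponents k d. c' \<beta> * (\<Prod>i<k. real (m i) ^ \<beta> i))" for m
    by (rule assms(1)) simp
  then show ?thesis
    using W[OF assms(2), of c] W[OF assms(2), of c'] by simp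
qed

section \<open>Products of linear forms\<close>

text \<open>Multiplying out chooses one variable \<open>\<phi> j\<close> from each factor, and the
  resulting monomial depends only on the fibre sizes of \<phi>. Serves both for the terms of a
  determinant and for powers of sums of variables.\<close>

lemma prod_linear_forms_expansion:
  fixes t :: "nat \<Rightarrow> real"
  assumes J: "finite J"
  shows "(\<Prod>j\<in>J. \<Sum>i<k. t i * a i j) =
    (\<Sum>\<alpha>\<in>exponents k (card J).
       (\<Sum>\<phi> | \<phi> \<in> J \<rightarrow>\<^sub>E {..<k} \<and> (\<lambda>i. card {j\<in>J. \<phi> j = i}) = \<alpha>. \<Prod>j\<in>J. a (\<phi> j) j) *
       (\<Prod>i<k. t i ^ \<alpha> i))"
proof -
  have power: "(\<Prod>j\<in>J. t (\<phi> j)) = (\<Prod>i<k. t i ^ card {j\<in>J. \<phi> j = i})"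
    if "\<phi> \<in> J \<rightarrow>\<^sub>E {..<k}" for \<phi>
  proof -
    have "(\<Prod>j\<in>J. t (\<phi> j)) = (\<Prod>i<k. \<Prod>j | j \<in> J \<and> \<phi> j = i. t (\<phi> j))"
      using that J by (intro prod.group[symmetric]) auto
    also have "\<dots> = (\<Prod>i<k. t i ^ card {j\<in>J. \<phi> j = i})"
      by (intro prod.cong refl) simp
    finally show ?thesis .
  qed
  have count: "(\<lambda>i. card {j\<in>J. \<phi> j = i}) \<in> exponents k (card J)" if "\<phi> \<in> J \<rightarrow>\<^sub>E {..<k}" for \<phi>
  proof -
    have "(\<Sum>i<k. \<Sum>j | j \<in> J \<and> \<phi> j = i. 1) = (\<Sum>j\<in>J. (1::nat))"
      using that J by (intro sum.group) auto
    moreover have "{j \<in> J. \<phi> j = i} = {}" if "i \<ge> k" for i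
      using \<open>\<phi> \<in> J \<rightarrow>\<^sub>E {..<k}\<close> that by (auto simp: PiE_def Pi_def)
    ultimately show ?thesis
      using J by (auto simp: exponents_def)
  qed
  have "(\<Prod>j\<in>J. \<Sum>i<k. t i * a i j) =
      (\<Sum>\<phi>\<in>J \<rightarrow>\<^sub>E {..<k}. (\<Prod>j\<in>J. a (\<phi> j) j) * (\<Prod>i<k. t i ^ card {j\<in>J. \<phi> j = i}))"
    using J by (subst prod_sum_PiE) (auto simp: prod.distrib power mult.commute intro!: sum.cong)
  also have "\<dots> = (\<Sum>\<alpha>\<in>exponents k (card J).
       (\<Sum>\<phi> | \<phi> \<in> J \<rightarrow>\<^sub>E {..<k} \<and> (\<lambda>i. card {j\<in>J. \<phi> j = i}) = \<alpha>.
          (\<Prod>j\<in>J. a (\<phi> j) j) * (\<Prod>i<k. t i ^ card {j\<in>J. \<phi> j = i})))"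
    using J count by (intro sum.group[symmetric]) (auto intro!: finite_PiE)
  also have "\<dots> = (\<Sum>\<alpha>\<in>exponents k (card J).
       (\<Sum>\<phi> | \<phi> \<in> J \<rightarrow>\<^sub>E {..<k} \<and> (\<lambda>i. card {j\<in>J. \<phi> j = i}) = \<alpha>. \<Prod>j\<in>J. a (\<phi> j) j) *
       (\<Prod>i<k. t i ^ \<alpha> i))"
    unfolding sum_distrib_right by (intro sum.cong refl) auto
  finally show ?thesis .
qed


text \<open>Identifies the choices that contribute to the monomial t_0 ... t_(n-1) as the
  permutations.\<close>

lemma fibre_cards_one_iff_inj_on:
  assumes "\<phi> \<in> {..<n} \<rightarrow>\<^sub>E {..<n::nat}"
  shows "(\<lambda>i. card {j\<in>{..<n}. \<phi> j = i}) = (\<lambda>i. if i < n then 1 else 0) \<longleftrightarrow> inj_on \<phi> {..<n}"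
proof
  assume *: "(\<lambda>i. card {j\<in>{..<n}. \<phi> j = i}) = (\<lambda>i. if i < n then 1 else 0)"
  show "inj_on \<phi> {..<n}"
  proof (rule inj_onI)
    fix x y assume xy: "x \<in> {..<n}" "y \<in> {..<n}" "\<phi> x = \<phi> y"
    then have "\<phi> x < n" using assms by auto
    then have "card {j\<in>{..<n}. \<phi> j = \<phi> x} = 1" using fun_cong[OF *, of "\<phi> x"] by simp
    then obtain z where "{j\<in>{..<n}. \<phi> j = \<phi> x} = {z}" by (auto simp: card_1_singleton_iff)
    then have "x = z" "y = z" using xy by auto
    then show "x = y" by simp
  qed
next
  assume inj: "inj_on \<phi> {..<n}"
  have surj: "\<phi> ` {..<n} = {..<n}"
    using assms inj by (intro endo_inj_surj) auto
  show "(\<lambda>i. card {j\<in>{..<n}. \<phi> j = i}) = (\<lambda>i. if i < n then 1 else 0)"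
  proof
    fix i show "card {j\<in>{..<n}. \<phi> j = i} = (if i < n then 1 else 0)"
    proof (cases "i < n")
      case True
      then obtain j where j: "j < n" "\<phi> j = i" using surj by (metis imageE lessThan_iff)
      then have "{j\<in>{..<n}. \<phi> j = i} = {j}" using inj unfolding inj_on_def by blast
      then show ?thesis using True by simp
    next
      case False
      then have "{j\<in>{..<n}. \<phi> j = i} = {}" using surj by auto
      then show ?thesis using False by (simp only: card.empty if_False)
    qed
  qed
qed

lemma card_inj_fixing_zero:
  assumes "1 \<le> n"
  shows "card {\<phi> \<in> {..<n} \<rightarrow>\<^sub>E {..<n::nat}. inj_on \<phi> {..<n} \<and> \<phi> 0 = 0} = fact (n - 1)"
proof -
  have "bij_betw (\<lambda>\<phi>. restrict \<phi> {1..<n})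
      {\<phi> \<in> {..<n} \<rightarrow>\<^sub>E {..<n}. inj_on \<phi> {..<n} \<and> \<phi> 0 = 0}
      {\<psi> \<in> {1..<n} \<rightarrow>\<^sub>E {1..<n}. inj_on \<psi> {1..<n}}"
  proof (rule bij_betw_byWitness[where f' = "\<lambda>\<psi>. \<psi>(0 := 0)"])
    show "\<forall>\<phi>\<in>{\<phi> \<in> {..<n} \<rightarrow>\<^sub>E {..<n}. inj_on \<phi> {..<n} \<and> \<phi> 0 = 0}. (restrict \<phi> {1..<n})(0 := 0) = \<phi>"
    proof
      fix \<phi> assume "\<phi> \<in> {\<phi> \<in> {..<n} \<rightarrow>\<^sub>E {..<n}. inj_on \<phi> {..<n} \<and> \<phi> 0 = 0}"
      then have *: "\<phi> \<in> {..<n} \<rightarrow>\<^sub>E {..<n}" "\<phi> 0 = (0::nat)" by auto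
      show "(restrict \<phi> {1..<n})(0 := 0) = \<phi>"
      proof
        fix i show "((restrict \<phi> {1..<n})(0 := 0)) i = \<phi> i"
          using *(2) PiE_arb[OF *(1), of i] by (cases "i = 0") (auto simp: restrict_def Suc_le_eq)
      qed
    qed
    show "\<forall>\<psi>\<in>{\<psi> \<in> {1..<n} \<rightarrow>\<^sub>E {1..<n}. inj_on \<psi> {1..<n}}. restrict (\<psi>(0 := 0)) {1..<n} = \<psi>"
    proof
      fix \<psi> assume "\<psi> \<in> {\<psi> \<in> {1..<n} \<rightarrow>\<^sub>E {1..<n}. inj_on \<psi> {1..<n}}"
      then have *: "\<psi> \<in> {1..<n} \<rightarrow>\<^sub>E {1..<n}" by auto
      show "restrict (\<psi>(0 := 0)) {1..<n} = \<psi>"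
      proof
        fix i show "restrict (\<psi>(0 := 0)) {1..<n} i = \<psi> i"
          using PiE_arb[OF *, of i] by (auto simp: restrict_def)
      qed
    qed
    show "(\<lambda>\<phi>. restrict \<phi> {1..<n}) ` {\<phi> \<in> {..<n} \<rightarrow>\<^sub>E {..<n}. inj_on \<phi> {..<n} \<and> \<phi> 0 = 0}
        \<subseteq> {\<psi> \<in> {1..<n} \<rightarrow>\<^sub>E {1..<n}. inj_on \<psi> {1..<n}}"
    proof clarsimp
      fix \<phi> assume *: "\<phi> \<in> {..<n} \<rightarrow>\<^sub>E {..<n}" "inj_on \<phi> {..<n}" "\<phi> 0 = (0::nat)"
      have "\<phi> i \<noteq> 0" if "i \<in> {1..<n}" for i
        using inj_onD[OF *(2), of i 0] that *(3) assms by auto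
      then have "\<phi> i \<in> {1..<n}" if "i \<in> {1..<n}" for i
        using that PiE_mem[OF *(1), of i] by (auto simp: Suc_le_eq)
      moreover have "inj_on \<phi> {Suc 0..<n}"
        using *(2) by (rule inj_on_subset) auto
      ultimately show "\<phi> \<in> {Suc 0..<n} \<rightarrow> {Suc 0..<n} \<and> inj_on \<phi> {Suc 0..<n}"
        by auto
    qed
    show "(\<lambda>\<psi>. \<psi>(0 := 0)) ` {\<psi> \<in> {1..<n} \<rightarrow>\<^sub>E {1..<n}. inj_on \<psi> {1..<n}}
        \<subseteq> {\<phi> \<in> {..<n} \<rightarrow>\<^sub>E {..<n}. inj_on \<phi> {..<n} \<and> \<phi> 0 = 0}"
    proof clarsimp
      fix \<psi> assume *: "\<psi> \<in> {Suc 0..<n} \<rightarrow>\<^sub>E {Suc 0..<n}" "inj_on \<psi> {Suc 0..<n}"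
      have r: "Suc 0 \<le> \<psi> i \<and> \<psi> i < n" if "0 < i" "i < n" for i
        using that PiE_mem[OF *(1), of i] by (auto simp: Suc_le_eq)
      have "inj_on (\<psi>(0 := 0)) {..<n}"
      proof (rule inj_onI)
        fix x y assume xy: "x \<in> {..<n}" "y \<in> {..<n}" "(\<psi>(0 := 0)) x = (\<psi>(0 := 0)) y"
        show "x = y"
          using xy r[of x] r[of y] inj_onD[OF *(2), of x y]
          by (cases "x = 0"; cases "y = 0") auto
      qed
      moreover have "\<psi>(0 := 0) \<in> {..<n} \<rightarrow>\<^sub>E {..<n}"
      proof (rule PiE_I)
        show "(\<psi>(0 := 0)) i \<in> {..<n}" if "i \<in> {..<n}" for i
          using that r[of i] assms by (cases "i = 0") auto
        show "(\<psi>(0 := 0)) i = undefined" if "i \<notin> {..<n}" for i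
          using that PiE_arb[OF *(1), of i] assms by auto
      qed
      ultimately show "\<psi>(0 := 0) \<in> {..<n} \<rightarrow>\<^sub>E {..<n} \<and> inj_on (\<psi>(0 := 0)) {..<n}"
        by blast
    qed
  qed
  then have "card {\<phi> \<in> {..<n} \<rightarrow>\<^sub>E {..<n::nat}. inj_on \<phi> {..<n} \<and> \<phi> 0 = 0} =
      card {\<psi> \<in> {1..<n} \<rightarrow>\<^sub>E {1..<n}. inj_on \<psi> {1..<n}}"
    by (rule bij_betw_same_card)
  also have "\<dots> = prod ((-) (n - 1)) {0..<n - 1}"
    by (subst card_inj_on_subset_funcset) auto
  also have "\<dots> = fact (n - 1)"
    by (simp add: fact_prod_rev)
  finally show ?thesis .
qed

text \<open>Meant for substituting a = t_0 and b = t_1 + ... + t_(n-1) in a polynomial in a and b.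
  The monomial t_0 ... t_(n-1) takes t_0 exactly once, so only e = 1 contributes, and the other
  variables can be distributed over the factors in (n-1)! ways.\<close>

lemma power_times_sum_power_expansion:
  assumes "2 \<le> n" "e \<le> n"
  obtains N :: "(nat \<Rightarrow> nat) \<Rightarrow> real" where
    "\<And>t. t 0 ^ e * (\<Sum>i\<in>{1..<n}. t i) ^ (n - e) = (\<Sum>\<alpha>\<in>exponents n n. N \<alpha> * (\<Prod>i<n. t i ^ \<alpha> i))"
    "N (\<lambda>i. if i < n then 1 else 0) = (if e = 1 then fact (n - 1) else 0)"
proof -
  \<comment> \<open>Coefficient of \<open>t i\<close> in factor \<open>j\<close>: the first
    \<open>e\<close> factors are \<open>t 0\<close>, the others are the sum of the remaining
    variables.\<close>
  define a :: "nat \<Rightarrow> nat \<Rightarrow> real" where "a i j = of_bool (j < e \<longleftrightarrow> i = 0)" for i j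
  define N where "N \<alpha> = (\<Sum>\<phi> | \<phi> \<in> {..<n} \<rightarrow>\<^sub>E {..<n} \<and> (\<lambda>i. card {j\<in>{..<n}. \<phi> j = i}) = \<alpha>.
      \<Prod>j<n. a (\<phi> j) j)" for \<alpha>
  have "t 0 ^ e * (\<Sum>i\<in>{1..<n}. t i) ^ (n - e) = (\<Sum>\<alpha>\<in>exponents n n. N \<alpha> * (\<Prod>i<n. t i ^ \<alpha> i))" for t
  proof -
    have *: "(\<Sum>i<n. t i * a i j) = (if j < e then t 0 else (\<Sum>i\<in>{1..<n}. t i))" for j
    proof -
      have "(\<Sum>i<n. t i * a i j) = t 0 * a 0 j + (\<Sum>i\<in>{1..<n}. t i * a i j)"
        using assms by (simp add: lessThan_atLeast0 sum.atLeast_Suc_lessThan)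
      also have "(\<Sum>i\<in>{1..<n}. t i * a i j) = (\<Sum>i\<in>{1..<n}. if j < e then 0 else t i)"
        by (intro sum.cong) (auto simp: a_def)
      finally show ?thesis by (auto simp: a_def)
    qed
    have "t 0 ^ e * (\<Sum>i\<in>{1..<n}. t i) ^ (n - e) =
        (\<Prod>j\<in>{..<e}. t 0) * (\<Prod>j\<in>{e..<n}. \<Sum>i\<in>{1..<n}. t i)"
      by simp
    also have "\<dots> = (\<Prod>j<n. if j < e then t 0 else (\<Sum>i\<in>{1..<n}. t i))"
    proof -
      have *: "{..<n} = {..<e} \<union> {e..<n}" using assms by auto
      show ?thesis unfolding * by (subst prod.union_disjoint) auto
    qed
    also have "\<dots> = (\<Prod>j<n. \<Sum>i<n. t i * a i j)"
      by (simp only: *)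
    finally show ?thesis
      by (subst (asm) prod_linear_forms_expansion) (auto simp: N_def)
  qed
  moreover have "N (\<lambda>i. if i < n then 1 else 0) = (if e = 1 then fact (n - 1) else 0)"
  proof -
    have "N (\<lambda>i. if i < n then 1 else 0) =
        (\<Sum>\<phi> | \<phi> \<in> {..<n} \<rightarrow>\<^sub>E {..<n} \<and> inj_on \<phi> {..<n}. \<Prod>j<n. a (\<phi> j) j)"
      unfolding N_def by (intro sum.cong Collect_cong conj_cong refl fibre_cards_one_iff_inj_on)
    also have "\<dots> = (\<Sum>\<phi> | \<phi> \<in> {..<n} \<rightarrow>\<^sub>E {..<n} \<and> inj_on \<phi> {..<n}. of_bool (e = 1 \<and> \<phi> 0 = 0))"
    proof (intro sum.cong refl)
      fix \<phi> assume "\<phi> \<in> {\<phi>. \<phi> \<in> {..<n} \<rightarrow>\<^sub>E {..<n} \<and> inj_on \<phi> {..<n}}"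
      then have phi: "\<phi> \<in> {..<n} \<rightarrow>\<^sub>E {..<n}" "inj_on \<phi> {..<n}" by auto
      then have "\<phi> ` {..<n} = {..<n}" by (intro endo_inj_surj) auto
      then have "0 \<in> \<phi> ` {..<n}" using assms by auto
      then obtain j0 where j0: "j0 < n" "\<phi> j0 = 0" by auto
      have uniq: "\<phi> j = 0 \<longleftrightarrow> j = j0" if "j < n" for j
        using inj_onD[OF phi(2), of j j0] j0 that by auto
      have "(\<forall>j<n. (j < e \<longleftrightarrow> \<phi> j = 0)) \<longleftrightarrow> e = 1 \<and> \<phi> 0 = 0"
      proof
        assume *: "\<forall>j<n. (j < e \<longleftrightarrow> \<phi> j = 0)"
        then have "j0 < e" using j0 by auto
        then have "j0 = 0" using *[rule_format, of 0] uniq[of 0] assms by auto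
        moreover have "\<not> 1 < e" using *[rule_format, of 1] uniq[of 1] assms \<open>j0 = 0\<close> by auto
        ultimately show "e = 1 \<and> \<phi> 0 = 0" using \<open>j0 < e\<close> \<open>j0 = 0\<close> j0 by auto
      next
        assume "e = 1 \<and> \<phi> 0 = 0"
        then show "\<forall>j<n. (j < e \<longleftrightarrow> \<phi> j = 0)" using uniq assms by (auto simp: less_Suc_eq_0_disj)
      qed
      moreover have "(\<Prod>j<n. a (\<phi> j) j) = of_bool (\<forall>j<n. (j < e \<longleftrightarrow> \<phi> j = 0))"
      proof (cases "\<forall>j<n. (j < e \<longleftrightarrow> \<phi> j = 0)")
        case True
        then have "a (\<phi> j) j = 1" if "j < n" for j
          using that by (simp add: a_def)
        then show ?thesis using True by simp
      next
        case False
        then obtain j where "j < n" "a (\<phi> j) j = 0" by (auto simp: a_def)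
        then have "(\<Prod>j<n. a (\<phi> j) j) = 0" by (intro prod_zero) auto
        then show ?thesis using False by (simp only: of_bool_def if_False)
      qed
      ultimately show "(\<Prod>j<n. a (\<phi> j) j) = of_bool (e = 1 \<and> \<phi> 0 = 0)" by simp
    qed
    also have "\<dots> = (if e = 1 then real (card {\<phi> \<in> {..<n} \<rightarrow>\<^sub>E {..<n::nat}. inj_on \<phi> {..<n} \<and> \<phi> 0 = 0}) else 0)"
    proof -
      have "finite {\<phi>. \<phi> \<in> {..<n} \<rightarrow>\<^sub>E {..<n} \<and> inj_on \<phi> {..<n}}"
        by (rule finite_subset[OF _ finite_PiE[of "{..<n}" "\<lambda>_. {..<n}"]]) auto
      moreover have "{\<phi>. \<phi> \<in> {..<n} \<rightarrow>\<^sub>E {..<n} \<and> inj_on \<phi> {..<n}} \<inter> {\<phi>. \<phi> 0 = 0} =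
          {\<phi> \<in> {..<n} \<rightarrow>\<^sub>E {..<n}. inj_on \<phi> {..<n} \<and> \<phi> 0 = 0}"
        by blast
      ultimately show ?thesis
        by (cases "e = 1") (simp_all only: sum_of_bool_eq simp_thms if_True if_False of_bool_eq sum.neutral_const)
    qed
    also have "\<dots> = (if e = 1 then fact (n - 1) else 0)"
      using assms by (subst card_inj_fixing_zero) auto
    finally show ?thesis .
  qed
  ultimately show ?thesis by (rule that)
qed

subsection \<open>Minkowski combinations of convex bodies\<close>

lemma mem_minkowski_combination:
  "x \<in> minkowski_combination t Ks \<longleftrightarrow>
     (\<exists>f. (\<forall>i<length Ks. f i \<in> Ks ! i) \<and> x = (\<Sum>i<length Ks. t i *\<^sub>R f i))"
proof
  assume "x \<in> minkowski_combination t Ks"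
  then obtain s where s: "x = sum s {..<length Ks}" "\<forall>i\<in>{..<length Ks}. s i \<in> (\<lambda>x. t i *\<^sub>R x) ` (Ks ! i)"
    unfolding minkowski_combination_def set_sum_alt[OF finite_lessThan] by blast
  then obtain f where f: "\<And>i. i < length Ks \<Longrightarrow> f i \<in> Ks ! i \<and> s i = t i *\<^sub>R f i"
  proof -
    have "\<forall>i\<in>{..<length Ks}. \<exists>y. y \<in> Ks ! i \<and> s i = t i *\<^sub>R y"
      using s(2) by auto
    then obtain f where "\<forall>i\<in>{..<length Ks}. f i \<in> Ks ! i \<and> s i = t i *\<^sub>R f i"
      by (rule bchoice[THEN exE])
    then show ?thesis using that by auto
  qed
  then show "\<exists>f. (\<forall>i<length Ks. f i \<in> Ks ! i) \<and> x = (\<Sum>i<length Ks. t i *\<^sub>R f i)"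
    using s(1) by (intro exI[of _ f]) auto
next
  assume "\<exists>f. (\<forall>i<length Ks. f i \<in> Ks ! i) \<and> x = (\<Sum>i<length Ks. t i *\<^sub>R f i)"
  then show "x \<in> minkowski_combination t Ks"
    unfolding minkowski_combination_def set_sum_alt[OF finite_lessThan] by blast
qed

lemma compact_set_sum:
  fixes B :: "'i \<Rightarrow> 'a::real_normed_vector set"
  assumes "finite I" "\<And>i. i \<in> I \<Longrightarrow> compact (B i)"
  shows "compact (\<Sum>i\<in>I. B i)"
  using assms
proof (induction I)
  case empty
  then show ?case by (simp add: set_zero)
next
  case (insert i I)
  have "(\<Sum>i\<in>insert i I. B i) = {x + y |x y. x \<in> B i \<and> y \<in> sum B I}"
    using insert.hyps by (auto simp: set_plus_def)
  then show ?case
    using insert by (simp add: compact_sums)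
qed

lemma convex_body_minkowski_combination:
  fixes Ks :: "'a::euclidean_space set list"
  assumes "\<forall>K\<in>set Ks. convex_body K"
  shows "convex_body (minkowski_combination t Ks)"
proof -
  have K: "Ks ! i \<noteq> {}" "convex (Ks ! i)" "compact (Ks ! i)" if "i < length Ks" for i
    using assms that by (auto simp: convex_body_def)
  have "convex (minkowski_combination t Ks)"
    unfolding minkowski_combination_def using K by (intro convex_set_sum convex_scaling) auto
  moreover have "compact (minkowski_combination t Ks)"
    unfolding minkowski_combination_def using K by (intro compact_set_sum compact_scaling) auto
  moreover obtain f where "\<And>i. i < length Ks \<Longrightarrow> f i \<in> Ks ! i"
  proof -
    have "(SOME y. y \<in> Ks ! i) \<in> Ks ! i" if "i < length Ks" for i
      using K(1)[OF that] by (simp add: some_in_eq)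
    then show ?thesis by (rule that)
  qed
  then have "(\<Sum>i<length Ks. t i *\<^sub>R f i) \<in> minkowski_combination t Ks"
    unfolding mem_minkowski_combination by blast
  ultimately show ?thesis
    by (auto simp: convex_body_def)
qed

lemma minkowski_combination_mono:
  assumes "length Ks = length Ls" "\<And>i. i < length Ks \<Longrightarrow> Ks ! i \<subseteq> Ls ! i"
  shows "minkowski_combination t Ks \<subseteq> minkowski_combination t Ls"
  using assms unfolding subset_iff mem_minkowski_combination by metis

lemma negligible_convex_body_frontier:
  "convex_body K \<Longrightarrow> negligible (frontier K)"
  by (simp add: convex_body_def negligible_convex_frontier)

lemma convex_body_lmeasurable: "convex_body K \<Longrightarrow> K \<in> lmeasurable"
  by (simp add: convex_body_def lmeasurable_compact)

text \<open>The frontier of a convex body is a null set. Used for the range of the gradient map and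
  for an increasing union of polytopes, which are only known to lie between interior and body;
  \<open>D = {}\<close> gives volume zero to bodies without interior.\<close>

lemma measure_between_interior_and_body:
  assumes "convex_body K" "interior K \<subseteq> D" "D \<subseteq> K"
  shows "D \<in> lmeasurable" "measure lebesgue D = measure lebesgue K"
proof -
  have "K - D \<subseteq> frontier K"
    using assms closure_subset[of K] by (auto simp: frontier_def)
  then have "negligible (sym_diff K D)"
    using negligible_subset[OF negligible_convex_body_frontier[OF assms(1)]] assms(3)
    by (simp add: Diff_eq_empty_iff[THEN iffD2] Un_commute)
  then show "D \<in> lmeasurable" "measure lebesgue D = measure lebesgue K"
    using lmeasurable_negligible_symdiff[OF convex_body_lmeasurable[OF assms(1)]]
      measure_negligible_symdiff[of K D] convex_body_lmeasurable[OF assms(1)]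
    by (auto simp: fmeasurableD)
qed

subsection \<open>Minkowski's theorem for polytopes\<close>

definition exp_sum :: "'a::euclidean_space set \<Rightarrow> 'a \<Rightarrow> real" where
  "exp_sum S x = (\<Sum>y\<in>S. exp (x \<bullet> y))"

text \<open>The expectation of \<open>y\<close> under Gibbs weights proportional to exp (x . y). As
  a convex combination it lies in the hull; as the gradient of the convex function
  \<open>ln (exp_sum S x)\<close> it is monotone.\<close>

definition exp_mean :: "'a::euclidean_space set \<Rightarrow> 'a \<Rightarrow> 'a" where
  "exp_mean S x = (\<Sum>y\<in>S. (exp (x \<bullet> y) / exp_sum S x) *\<^sub>R y)"

lemma exp_sum_pos: "finite S \<Longrightarrow> S \<noteq> {} \<Longrightarrow> 0 < exp_sum S x"
  unfolding exp_sum_def by (intro sum_pos) auto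

lemma exp_weights_sum: "finite S \<Longrightarrow> S \<noteq> {} \<Longrightarrow> (\<Sum>y\<in>S. exp (x \<bullet> y) / exp_sum S x) = 1"
  using exp_sum_pos[of S x] by (simp add: exp_sum_def flip: sum_divide_distrib)

lemma exp_mean_in_hull: "finite S \<Longrightarrow> S \<noteq> {} \<Longrightarrow> exp_mean S x \<in> convex hull S"
  unfolding exp_mean_def
  using exp_sum_pos[of S x] exp_weights_sum[of S x]
  by (intro convex_sum convex_convex_hull) (auto intro: hull_inc less_imp_le)

lemma ln_exp_sum_has_derivative:
  assumes "finite S" "S \<noteq> {}"
  shows "((\<lambda>x. ln (exp_sum S x)) has_derivative (\<lambda>h. h \<bullet> exp_mean S x)) (at x)"
proof -
  have "((\<lambda>x. exp_sum S x) has_derivative (\<lambda>h. \<Sum>y\<in>S. exp (x \<bullet> y) * (h \<bullet> y))) (at x)"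
    unfolding exp_sum_def by (auto intro!: derivative_eq_intros simp: mult.commute)
  then have "((\<lambda>x. ln (exp_sum S x)) has_derivative
      (\<lambda>h. (\<Sum>y\<in>S. exp (x \<bullet> y) * (h \<bullet> y)) * inverse (exp_sum S x))) (at x)"
    using exp_sum_pos[OF assms, of x] by (auto intro!: derivative_eq_intros simp: divide_inverse)
  moreover have "(\<lambda>h. (\<Sum>y\<in>S. exp (x \<bullet> y) * (h \<bullet> y)) * inverse (exp_sum S x)) = (\<lambda>h. h \<bullet> exp_mean S x)"
    by (auto simp: exp_mean_def inner_sum_right sum_distrib_left divide_inverse mult_ac intro!: sum.cong)
  ultimately show ?thesis by simp
qed

lemma exp_mean_differentiable:
  assumes "finite S" "S \<noteq> {}"
  shows "exp_mean S differentiable at x"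
proof -
  have "(\<lambda>x. (1 / exp_sum S x) *\<^sub>R (\<Sum>y\<in>S. exp (x \<bullet> y) *\<^sub>R y)) differentiable at x"
    using exp_sum_pos[OF assms, of x] unfolding differentiable_def exp_sum_def
    by (intro exI) (rule derivative_eq_intros refl | (simp; fail))+
  moreover have "(\<lambda>x. (1 / exp_sum S x) *\<^sub>R (\<Sum>y\<in>S. exp (x \<bullet> y) *\<^sub>R y)) = exp_mean S"
    by (auto simp: exp_mean_def scaleR_sum_right)
  ultimately show ?thesis by simp
qed

lemma ln_exp_sum_ge_support:
  assumes "finite S" "p \<in> convex hull S"
  shows "x \<bullet> p \<le> ln (exp_sum S x)"
proof -
  have S: "S \<noteq> {}" using assms(2) by auto
  have "S \<subseteq> {p. x \<bullet> p \<le> ln (exp_sum S x)}"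
  proof
    fix y assume "y \<in> S"
    then have "exp (x \<bullet> y) \<le> exp_sum S x"
      unfolding exp_sum_def by (intro member_le_sum) (use assms in auto)
    then show "y \<in> {p. x \<bullet> p \<le> ln (exp_sum S x)}"
      using exp_sum_pos[OF assms(1) S, of x] by (simp add: ln_ge_iff)
  qed
  then have "convex hull S \<subseteq> {p. x \<bullet> p \<le> ln (exp_sum S x)}"
    by (intro hull_minimal convex_halfspace_le)
  then show ?thesis using assms(2) by auto
qed

text \<open>With Gibbs weights w and w' at the two points, the product is the symmetrised relative
  entropy, the sum of (w - w') (ln w - ln w'), whose terms are nonnegative because ln increases. If
  it vanishes, the weights agree and x - x' is constant on \<open>S\<close>.\<close>

lemma exp_mean_monotone:
  assumes S: "finite S" "S \<noteq> {}"
  shows "0 \<le> (exp_mean S x - exp_mean S x') \<bullet> (x - x')"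
    and "(exp_mean S x - exp_mean S x') \<bullet> (x - x') = 0 \<Longrightarrow>
           \<forall>y\<in>S. (x - x') \<bullet> y = ln (exp_sum S x) - ln (exp_sum S x')"
proof -
  define w where "w x y = exp (x \<bullet> y) / exp_sum S x" for x y
  define b where "b = ln (exp_sum S x) - ln (exp_sum S x')"
  note pos = exp_sum_pos[OF S]
  have ln_w: "ln (w x y) = x \<bullet> y - ln (exp_sum S x)" for x y
    using pos[of x] by (simp add: w_def ln_div)
  have w_pos: "0 < w x y" for x y using pos[of x] by (simp add: w_def)
  have "(exp_mean S x - exp_mean S x') \<bullet> (x - x') = (\<Sum>y\<in>S. (w x y - w x' y) * ((x - x') \<bullet> y))"
    unfolding exp_mean_def w_def sum_subtractf[symmetric] inner_sum_left
    by (intro sum.cong refl) (simp add: algebra_simps inner_commute)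
  \<comment> \<open>Both families of weights sum to 1, so the constant \<open>b\<close> may be
    subtracted; this turns the second factor into a difference of logarithms.\<close>
  also have "\<dots> = (\<Sum>y\<in>S. (w x y - w x' y) * ((x - x') \<bullet> y - b))"
  proof -
    have "(\<Sum>y\<in>S. (w x y - w x' y) * b) = 0"
      using exp_weights_sum[OF S] by (simp add: w_def sum_subtractf flip: sum_distrib_right)
    then show ?thesis by (simp add: right_diff_distrib sum_subtractf)
  qed
  also have "\<dots> = (\<Sum>y\<in>S. (w x y - w x' y) * (ln (w x y) - ln (w x' y)))"
    by (intro sum.cong refl) (simp add: ln_w b_def inner_diff_left)
  finally have eq: "(exp_mean S x - exp_mean S x') \<bullet> (x - x') =
     (\<Sum>y\<in>S. (w x y - w x' y) * (ln (w x y) - ln (w x' y)))" .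
  have nonneg: "0 \<le> (w x y - w x' y) * (ln (w x y) - ln (w x' y))" for y
    using w_pos[of x y] w_pos[of x' y]
    by (cases "w x y \<le> w x' y") (auto intro: mult_nonneg_nonneg mult_nonpos_nonpos)
  then show "0 \<le> (exp_mean S x - exp_mean S x') \<bullet> (x - x')"
    unfolding eq by (intro sum_nonneg) auto
  assume "(exp_mean S x - exp_mean S x') \<bullet> (x - x') = 0"
  then have "\<forall>y\<in>S. (w x y - w x' y) * (ln (w x y) - ln (w x' y)) = 0"
    unfolding eq using nonneg S by (subst (asm) sum_nonneg_eq_0_iff) auto
  then have "\<forall>y\<in>S. ln (w x y) = ln (w x' y)"
    by auto
  then show "\<forall>y\<in>S. (x - x') \<bullet> y = ln (exp_sum S x) - ln (exp_sum S x')"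
    by (auto simp: ln_w inner_diff_left algebra_simps)
qed

text \<open>If h . g' h were negative, g . h would decrease along the ray from \<open>x\<close> in
  direction \<open>h\<close>, against monotonicity.\<close>

lemma monotone_derivative_nonneg:
  fixes g :: "'a::real_inner \<Rightarrow> 'a"
  assumes "(g has_derivative g') (at x)" and mono: "\<And>x y. 0 \<le> (g x - g y) \<bullet> (x - y)"
  shows "0 \<le> h \<bullet> g' h"
proof (rule ccontr)
  assume neg: "\<not> 0 \<le> h \<bullet> g' h"
  have "((\<lambda>s. g (x + s *\<^sub>R h) \<bullet> h) has_derivative (\<lambda>s. g' (s *\<^sub>R h) \<bullet> h)) (at 0)"
  proof -
    have "((\<lambda>s. x + s *\<^sub>R h) has_derivative (\<lambda>s. s *\<^sub>R h)) (at (0::real))"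
      by (auto intro!: derivative_eq_intros)
    then have "((\<lambda>s. g (x + s *\<^sub>R h)) has_derivative (\<lambda>s. g' (s *\<^sub>R h))) (at (0::real))"
      by (rule has_derivative_compose) (simp add: assms(1))
    then show ?thesis by (rule has_derivative_inner_left)
  qed
  moreover have "(\<lambda>s. g' (s *\<^sub>R h) \<bullet> h) = (\<lambda>s. s * (h \<bullet> g' h))"
    using has_derivative_linear[OF assms(1)] by (auto simp: linear_scale inner_commute)
  ultimately have "((\<lambda>s. g (x + s *\<^sub>R h) \<bullet> h) has_real_derivative (h \<bullet> g' h)) (at 0)"
    by (simp add: has_field_derivative_def mult.commute[of "h \<bullet> g' h"] mult_commute_abs)
  from DERIV_neg_dec_right[OF this]
  obtain d where d: "d > 0" "\<And>s. 0 < s \<Longrightarrow> s < d \<Longrightarrow> g (x + s *\<^sub>R h) \<bullet> h < g x \<bullet> h"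
    using neg by auto
  have "0 \<le> (g (x + (d/2) *\<^sub>R h) - g x) \<bullet> ((d/2) *\<^sub>R h)"
    using mono[of "x + (d/2) *\<^sub>R h" x] by simp
  then have "0 \<le> (g (x + (d/2) *\<^sub>R h) - g x) \<bullet> h"
    using d(1) by (simp add: zero_le_mult_iff)
  then show False using d(1) d(2)[of "d/2"] by (simp add: inner_diff_left)
qed

text \<open>The determinant cannot vanish on the segment from the identity to a form that is
  positive semidefinite, except possibly at its end.\<close>

lemma det_nonneg_if_monotone:
  fixes A :: "real^'n^'n"
  assumes "\<And>x. 0 \<le> x \<bullet> (A *v x)"
  shows "0 \<le> det A"
proof (rule ccontr)
  assume neg: "\<not> 0 \<le> det A"
  define B where "B s = s *\<^sub>R mat 1 + (1 - s) *\<^sub>R A" for s :: real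
  have cont: "continuous_on {0..1} (\<lambda>s. det (B s))"
    unfolding det_def B_def by (intro continuous_intros)
  have "\<exists>s\<ge>0. s \<le> 1 \<and> det (B s) = 0"
    using neg cont by (intro IVT') (auto simp: B_def)
  then obtain s where s: "0 \<le> s" "s \<le> 1" "det (B s) = 0" by auto
  have "s \<noteq> 0" using s(3) neg by (auto simp: B_def)
  then have "0 < s" using s by simp
  obtain x where x: "x \<noteq> 0" "B s *v x = 0"
  proof -
    have "\<not> inj ((*v) (B s))"
      using s(3) det_nz_iff_inj[of "(*v) (B s)"] by simp
    then show ?thesis using that linear_injective_0[of "(*v) (B s)"] by auto
  qed
  have "0 = x \<bullet> (B s *v x)" using x by simp
  also have "\<dots> = s * (x \<bullet> x) + (1 - s) * (x \<bullet> (A *v x))"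
    by (simp add: B_def matrix_vector_mult_add_rdistrib scaleR_matrix_vector_assoc[symmetric] inner_add_right)
  also have "\<dots> > 0"
    using \<open>0 < s\<close> s(2) x(1) assms[of x] by (intro add_pos_nonneg mult_pos_pos mult_nonneg_nonneg) auto
  finally show False by simp
qed

definition exp_mean_sum :: "'a::euclidean_space set list \<Rightarrow> (nat \<Rightarrow> real) \<Rightarrow> 'a \<Rightarrow> 'a" where
  "exp_mean_sum Ss t x = (\<Sum>i<length Ss. t i *\<^sub>R exp_mean (Ss ! i) x)"

lemma convex_body_hull: "finite S \<Longrightarrow> S \<noteq> {} \<Longrightarrow> convex_body (convex hull S)"
  by (simp add: convex_body_def finite_imp_compact_convex_hull)

lemma exp_mean_sum_in_combination:
  assumes "\<forall>S\<in>set Ss. finite S \<and> S \<noteq> {}"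
  shows "exp_mean_sum Ss t x \<in> minkowski_combination t (map (\<lambda>S. convex hull S) Ss)"
  unfolding mem_minkowski_combination exp_mean_sum_def
  using assms by (intro exI[of _ "\<lambda>i. exp_mean (Ss ! i) x"]) (auto intro!: exp_mean_in_hull)

lemma exp_mean_sum_monotone:
  assumes "\<forall>S\<in>set Ss. finite S \<and> S \<noteq> {}" and "\<And>i. i < length Ss \<Longrightarrow> 0 \<le> t i"
  shows "0 \<le> (exp_mean_sum Ss t x - exp_mean_sum Ss t y) \<bullet> (x - y)"
  unfolding exp_mean_sum_def sum_subtractf[symmetric] scaleR_right_diff_distrib[symmetric] inner_sum_left
  using assms by (intro sum_nonneg) (auto intro!: mult_nonneg_nonneg exp_mean_monotone(1))

text \<open>The monotonicity product is a sum of nonnegative terms, so equal images make each of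
  them vanish. Then x - x' is constant on every polytope of positive weight, and the combination
  lies in a hyperplane.\<close>

lemma inj_exp_mean_sum:
  assumes S: "\<forall>S\<in>set Ss. finite S \<and> S \<noteq> {}" and t: "\<And>i. i < length Ss \<Longrightarrow> 0 \<le> t i"
    and int: "interior (minkowski_combination t (map (\<lambda>S. convex hull S) Ss)) \<noteq> {}"
  shows "inj (exp_mean_sum Ss t)"
proof (rule injI, rule ccontr)
  fix x x' assume eq: "exp_mean_sum Ss t x = exp_mean_sum Ss t x'" and ne: "x \<noteq> x'"
  define m where "m i = (exp_mean (Ss ! i) x - exp_mean (Ss ! i) x') \<bullet> (x - x')" for i
  define b where "b i = ln (exp_sum (Ss ! i) x) - ln (exp_sum (Ss ! i) x')" for i
  have m: "0 \<le> m i" if "i < length Ss" for i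
    using S that by (auto simp: m_def intro!: exp_mean_monotone(1))
  have "(\<Sum>i<length Ss. t i * m i) = (exp_mean_sum Ss t x - exp_mean_sum Ss t x') \<bullet> (x - x')"
    unfolding exp_mean_sum_def sum_subtractf[symmetric] scaleR_right_diff_distrib[symmetric] inner_sum_left
    by (simp add: m_def)
  then have "(\<Sum>i<length Ss. t i * m i) = 0"
    using eq by simp
  then have zero: "t i = 0 \<or> m i = 0" if "i < length Ss" for i
    using that m t by (subst (asm) sum_nonneg_eq_0_iff) auto
  have support: "t i * ((x - x') \<bullet> p) = t i * b i" if i: "i < length Ss" and p: "p \<in> convex hull (Ss ! i)" for i p
  proof (cases "t i = 0")
    case False
    then have "m i = 0" using zero[OF i] by simp
    then have "\<forall>y\<in>Ss ! i. (x - x') \<bullet> y = b i"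
      unfolding m_def b_def using S i by (intro exp_mean_monotone(2)) auto
    then have "convex hull (Ss ! i) \<subseteq> {p. (x - x') \<bullet> p = b i}"
      by (intro hull_minimal convex_hyperplane) auto
    then show ?thesis using p by auto
  qed simp
  have "minkowski_combination t (map (\<lambda>S. convex hull S) Ss) \<subseteq>
      {p. (x - x') \<bullet> p = (\<Sum>i<length Ss. t i * b i)}"
    using support by (auto simp: mem_minkowski_combination inner_sum_right intro!: sum.cong)
  then have "interior (minkowski_combination t (map (\<lambda>S. convex hull S) Ss)) \<subseteq>
      interior {p. (x - x') \<bullet> p = (\<Sum>i<length Ss. t i * b i)}"
    by (rule interior_mono)
  also have "\<dots> = {}"
    using ne by (intro interior_hyperplane) simp
  finally show False using int by simp
qed

text \<open>A point \<open>z\<close> is the value of the gradient at the minimum of the potential tilted by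
  \<open>z\<close>, which exists because the potential dominates the support function.\<close>

lemma interior_combination_subset_range:
  assumes S: "\<forall>S\<in>set Ss. finite S \<and> S \<noteq> {}" and t: "\<And>i. i < length Ss \<Longrightarrow> 0 \<le> t i"
  shows "interior (minkowski_combination t (map (\<lambda>S. convex hull S) Ss)) \<subseteq> range (exp_mean_sum Ss t)"
    (is "interior ?P \<subseteq> _")
proof
  fix z assume "z \<in> interior ?P"
  then obtain r where r: "r > 0" "cball z r \<subseteq> ?P"
    by (meson mem_interior_cball)
  define f where "f x = (\<Sum>i<length Ss. t i * ln (exp_sum (Ss ! i) x)) - x \<bullet> z" for x
  have deriv: "(f has_derivative (\<lambda>h. h \<bullet> (exp_mean_sum Ss t x - z))) (at x)" for x
  proof -
    have "(f has_derivative (\<lambda>h. (\<Sum>i<length Ss. t i * (h \<bullet> exp_mean (Ss ! i) x)) - h \<bullet> z)) (at x)"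
      unfolding f_def using S
      by (intro has_derivative_diff has_derivative_sum has_derivative_mult_right
          ln_exp_sum_has_derivative has_derivative_inner_left has_derivative_ident) auto
    moreover have "(\<lambda>h. (\<Sum>i<length Ss. t i * (h \<bullet> exp_mean (Ss ! i) x)) - h \<bullet> z) =
        (\<lambda>h. h \<bullet> (exp_mean_sum Ss t x - z))"
      by (simp add: exp_mean_sum_def inner_diff_right inner_sum_right)
    ultimately show ?thesis by simp
  qed
  have coercive: "r * norm x \<le> f x" for x
  proof -
    \<comment> \<open>The point of the ball farthest in direction \<open>x\<close>. For x = 0
      division by zero makes it \<open>z\<close>, so that no case distinction arises.\<close>
    define p where "p = z + (r / norm x) *\<^sub>R x"
    have "p \<in> cball z r" using r(1) by (auto simp: p_def dist_norm)
    then have "p \<in> ?P" using r by auto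
    then obtain q where q: "\<And>i. i < length Ss \<Longrightarrow> q i \<in> convex hull (Ss ! i)"
        "p = (\<Sum>i<length Ss. t i *\<^sub>R q i)"
      unfolding mem_minkowski_combination by auto
    have "x \<bullet> p = x \<bullet> z + r * norm x"
      by (simp add: p_def inner_add_right dot_square_norm power2_eq_square)
    moreover have "x \<bullet> p \<le> (\<Sum>i<length Ss. t i * ln (exp_sum (Ss ! i) x))"
      unfolding q(2) inner_sum_right inner_scaleR_right using q(1) S t
      by (intro sum_mono mult_left_mono ln_exp_sum_ge_support) auto
    ultimately show ?thesis by (simp add: f_def)
  qed
  have cont: "continuous_on T f" for T
    by (rule has_derivative_continuous_on) (rule has_derivative_at_withinI[OF deriv])
  \<comment> \<open>Outside the ball of radius f 0 / r coercivity gives f x > f 0, so a minimum over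
    this ball is global.\<close>
  have "0 \<le> f 0" using coercive[of 0] by simp
  then obtain x0 where x0: "x0 \<in> cball 0 (f 0 / r)" "\<And>x. x \<in> cball 0 (f 0 / r) \<Longrightarrow> f x0 \<le> f x"
    using continuous_attains_inf[OF compact_cball _ cont, of 0 "f 0 / r"] r(1)
    by (metis cball_eq_empty divide_nonneg_pos not_less)
  have "f x0 \<le> f x" for x
  proof (cases "x \<in> cball 0 (f 0 / r)")
    case False
    then have "f 0 < r * norm x" using r(1) by (simp add: field_simps)
    moreover have "f x0 \<le> f 0" using x0(2)[of 0] \<open>0 \<le> f 0\<close> r(1) by simp
    ultimately show ?thesis using coercive[of x] by simp
  qed (rule x0(2))
  then have "(\<lambda>h. h \<bullet> (exp_mean_sum Ss t x0 - z)) = (\<lambda>h. 0)"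
    by (intro differential_zero_maxmin[OF _ open_UNIV deriv]) auto
  then have "(exp_mean_sum Ss t x0 - z) \<bullet> (exp_mean_sum Ss t x0 - z) = 0"
    by (rule fun_cong)
  then have "exp_mean_sum Ss t x0 = z" by simp
  then show "z \<in> range (exp_mean_sum Ss t)" by blast
qed

definition exp_mean_jacobian :: "(real^'n) set \<Rightarrow> real^'n \<Rightarrow> real^'n^'n" where
  "exp_mean_jacobian S x = matrix (frechet_derivative (exp_mean S) (at x))"

lemma exp_mean_sum_has_derivative:
  fixes Ss :: "(real^'n) set list"
  assumes S: "\<forall>S\<in>set Ss. finite S \<and> S \<noteq> {}"
  shows "(exp_mean_sum Ss t has_derivative
           (*v) (\<Sum>i<length Ss. t i *\<^sub>R exp_mean_jacobian (Ss ! i) x)) (at x)"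
proof -
  have *: "(exp_mean (Ss ! i) has_derivative (*v) (exp_mean_jacobian (Ss ! i) x)) (at x)"
    if "i < length Ss" for i
  proof -
    have "(exp_mean (Ss ! i) has_derivative frechet_derivative (exp_mean (Ss ! i)) (at x)) (at x)"
      using S that by (intro frechet_derivative_works[THEN iffD1] exp_mean_differentiable) auto
    moreover from this have "linear (frechet_derivative (exp_mean (Ss ! i)) (at x))"
      by (rule has_derivative_linear)
    ultimately show ?thesis
      by (simp add: exp_mean_jacobian_def matrix_works fun_eq_iff matrix_vector_mul(1))
  qed
  have "(exp_mean_sum Ss t has_derivative
      (\<lambda>h. \<Sum>i<length Ss. t i *\<^sub>R (exp_mean_jacobian (Ss ! i) x *v h))) (at x)"
    unfolding exp_mean_sum_def[abs_def] using *
    by (intro has_derivative_sum has_derivative_scaleR_right) auto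
  moreover have "(\<lambda>h. \<Sum>i<length Ss. t i *\<^sub>R (exp_mean_jacobian (Ss ! i) x *v h)) =
      (*v) (\<Sum>i<length Ss. t i *\<^sub>R exp_mean_jacobian (Ss ! i) x)"
  proof
    fix h
    show "(\<Sum>i<length Ss. t i *\<^sub>R (exp_mean_jacobian (Ss ! i) x *v h)) =
      (\<Sum>i<length Ss. t i *\<^sub>R exp_mean_jacobian (Ss ! i) x) *v h"
      by (induction Ss rule: rev_induct)
        (simp_all add: nth_append matrix_vector_mult_add_rdistrib scaleR_matrix_vector_assoc)
  qed
  ultimately show ?thesis by simp
qed

lemma combination_volume_as_integral:
  fixes Ss :: "(real^'n::{finite,wellorder}) set list"
  assumes S: "\<forall>S\<in>set Ss. finite S \<and> S \<noteq> {}" and t: "\<And>i. i < length Ss \<Longrightarrow> 0 \<le> t i"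
  shows "((\<lambda>x. det (\<Sum>i<length Ss. t i *\<^sub>R exp_mean_jacobian (Ss ! i) x)) has_integral
           measure lebesgue (minkowski_combination t (map (\<lambda>S. convex hull S) Ss))) UNIV"
proof -
  define P where "P = minkowski_combination t (map (\<lambda>S. convex hull S) Ss)"
  define A where "A x = (\<Sum>i<length Ss. t i *\<^sub>R exp_mean_jacobian (Ss ! i) x)" for x
  let ?G = "exp_mean_sum Ss t"
  have body: "convex_body P"
    unfolding P_def using S by (intro convex_body_minkowski_combination) (auto intro: convex_body_hull)
  have deriv: "(?G has_derivative (*v) (A x)) (at x)" for x
    unfolding A_def by (rule exp_mean_sum_has_derivative[OF S])
  have range: "range ?G \<subseteq> P"
    unfolding P_def using exp_mean_sum_in_combination[OF S] by auto
  show ?thesis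
  proof (cases "interior P = {}")
    case True
    obtain a b where ab: "a \<noteq> 0" "P \<subseteq> {x. a \<bullet> x = b}"
      using empty_interior_subset_hyperplane[OF _ True] body by (auto simp: convex_body_def)
    have "det (A x) = 0" for x
    proof (rule ccontr)
      assume "det (A x) \<noteq> 0"
      then have "inj ((*v) (A x))"
        using det_nz_iff_inj[of "(*v) (A x)"] by simp
      then have "surj ((*v) (A x))"
        by (simp add: linear_injective_imp_surjective)
      then obtain h where h: "A x *v h = a" by (metis surjD)
      \<comment> \<open>The hyperplane makes a . G constant, so a . (A x h) = 0 for all h; the
        assumed invertibility supplied an h with A x h = a.\<close>
      have "((\<lambda>x. a \<bullet> ?G x) has_derivative (\<lambda>h. a \<bullet> (A x *v h))) (at x)"
        by (rule has_derivative_inner_right[OF deriv])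
      moreover have "(\<lambda>x. a \<bullet> ?G x) = (\<lambda>x. b)"
        using range ab(2) by auto
      ultimately have "(\<lambda>h. a \<bullet> (A x *v h)) = (\<lambda>h. 0)"
        using has_derivative_unique[OF _ has_derivative_const] by metis
      then have "a \<bullet> a = 0" using h by metis
      then show False using ab(1) by simp
    qed
    moreover have "measure lebesgue P = 0"
      using measure_between_interior_and_body(2)[OF body, of "{}"] True by simp
    ultimately show ?thesis
      unfolding P_def[symmetric] A_def[symmetric] by simp
  next
    case False
    have "range ?G \<in> lmeasurable \<and> measure lebesgue (range ?G) = measure lebesgue P"
      using measure_between_interior_and_body[OF body _ range]
        interior_combination_subset_range[OF S t] by (simp add: P_def)
    then have "((\<lambda>x. \<bar>det (matrix ((*v) (A x)))\<bar>) has_integral measure lebesgue P) UNIV"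
      using has_measure_differentiable_image[of UNIV ?G "\<lambda>x. (*v) (A x)" "measure lebesgue P"]
        deriv inj_exp_mean_sum[OF S t] False by (simp add: P_def)
    moreover have "0 \<le> det (A x)" for x
      by (intro det_nonneg_if_monotone monotone_derivative_nonneg[OF deriv] exp_mean_sum_monotone[OF S t])
    ultimately show ?thesis
      unfolding P_def[symmetric] A_def[symmetric] by simp
  qed
qed

lemma det_combination_expansion:
  fixes M :: "nat \<Rightarrow> real^'n^'n"
  shows "\<exists>d. \<forall>t. det (\<Sum>i<k. t i *\<^sub>R M i) =
     (\<Sum>\<alpha>\<in>exponents k CARD('n). d \<alpha> * (\<Prod>i<k. t i ^ \<alpha> i))"
proof (intro exI allI)
  define e where "e p \<alpha> = (\<Sum>\<phi> | \<phi> \<in> UNIV \<rightarrow>\<^sub>E {..<k} \<and> (\<lambda>i. card {j\<in>UNIV. \<phi> j = i}) = \<alpha>.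
      \<Prod>j\<in>UNIV. M (\<phi> j) $ j $ p j)" for p :: "'n \<Rightarrow> 'n" and \<alpha>
  fix t :: "nat \<Rightarrow> real"
  have entry: "(\<Sum>i<k. t i *\<^sub>R M i) $ a $ b = (\<Sum>i<k. t i * M i $ a $ b)" for a b
    by (simp add: sum_component)
  have "det (\<Sum>i<k. t i *\<^sub>R M i) = (\<Sum>p | p permutes UNIV. of_int (sign p) *
      (\<Sum>\<alpha>\<in>exponents k CARD('n). e p \<alpha> * (\<Prod>i<k. t i ^ \<alpha> i)))"
    unfolding det_def entry e_def by (subst prod_linear_forms_expansion) simp_all
  also have "\<dots> = (\<Sum>\<alpha>\<in>exponents k CARD('n).
      (\<Sum>p | p permutes UNIV. of_int (sign p) * e p \<alpha>) * (\<Prod>i<k. t i ^ \<alpha> i))"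
    unfolding sum_distrib_left sum_distrib_right by (subst sum.swap) (simp add: mult.assoc)
  finally show "det (\<Sum>i<k. t i *\<^sub>R M i) = (\<Sum>\<alpha>\<in>exponents k CARD('n).
      (\<Sum>p | p permutes UNIV. of_int (sign p) * e p \<alpha>) * (\<Prod>i<k. t i ^ \<alpha> i))" .
qed

lemma minkowski_theorem_polytopes:
  fixes Ss :: "(real^'n::{finite,wellorder}) set list"
  assumes S: "\<forall>S\<in>set Ss. finite S \<and> S \<noteq> {}"
  shows "\<exists>c. volume_coeffs (map (\<lambda>S. convex hull S) Ss) c"
proof -
  define k where "k = length Ss"
  define V where "V t = measure lebesgue (minkowski_combination t (map (\<lambda>S. convex hull S) Ss))" for t
  define E where "E = exponents k CARD('n)"
  have "\<forall>x. \<exists>d. \<forall>t. det (\<Sum>i<k. t i *\<^sub>R exp_mean_jacobian (Ss ! i) x) =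
      (\<Sum>\<alpha>\<in>E. d \<alpha> * (\<Prod>i<k. t i ^ \<alpha> i))"
    unfolding E_def by (intro allI det_combination_expansion)
  then obtain d where "\<forall>x t. det (\<Sum>i<k. t i *\<^sub>R exp_mean_jacobian (Ss ! i) x) =
      (\<Sum>\<alpha>\<in>E. d x \<alpha> * (\<Prod>i<k. t i ^ \<alpha> i))"
    by (rule choice[THEN exE])
  note d = this[rule_format]
  obtain W where W: "\<And>c \<alpha>. \<alpha> \<in> E \<Longrightarrow>
       c \<alpha> = (\<Sum>m\<in>PiE {..<k} (\<lambda>_. {..CARD('n)}). W \<alpha> m *
         (\<Sum>\<beta>\<in>E. c \<beta> * (\<Prod>i<k. real (m i) ^ \<beta> i)))"
    unfolding E_def by (rule coefficient_functional[of k "CARD('n)"]) blast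
  have V: "((\<lambda>x. \<Sum>\<alpha>\<in>E. d x \<alpha> * (\<Prod>i<k. t i ^ \<alpha> i)) has_integral V t) UNIV"
    if "\<And>i. i < k \<Longrightarrow> 0 \<le> t i" for t
  proof -
    have "((\<lambda>x. det (\<Sum>i<k. t i *\<^sub>R exp_mean_jacobian (Ss ! i) x)) has_integral V t) UNIV"
      unfolding V_def k_def using that
      by (intro combination_volume_as_integral[OF S]) (simp add: k_def)
    then show ?thesis by (simp only: d)
  qed
  \<comment> \<open>\<open>d\<close> comes from a pointwise choice, so nothing is known about its
    regularity in x. By \<open>W\<close> each coefficient is a finite combination of determinants at
    grid values of \<open>t\<close>, and those are integrable.\<close>
  define c where "c \<alpha> = (\<Sum>m\<in>PiE {..<k} (\<lambda>_. {..CARD('n)}). W \<alpha> m * V (\<lambda>i. real (m i)))" for \<alpha>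
  have c: "((\<lambda>x. d x \<alpha>) has_integral c \<alpha>) UNIV" if "\<alpha> \<in> E" for \<alpha>
  proof -
    have "((\<lambda>x. \<Sum>m\<in>PiE {..<k} (\<lambda>_. {..CARD('n)}). W \<alpha> m *
         (\<Sum>\<beta>\<in>E. d x \<beta> * (\<Prod>i<k. real (m i) ^ \<beta> i))) has_integral c \<alpha>) UNIV"
      unfolding c_def
    proof (rule has_integral_sum)
      show "finite (PiE {..<k} (\<lambda>_. {..CARD('n)}))" by (simp add: finite_PiE)
      show "((\<lambda>x. W \<alpha> m * (\<Sum>\<beta>\<in>E. d x \<beta> * (\<Prod>i<k. real (m i) ^ \<beta> i))) has_integral
          W \<alpha> m * V (\<lambda>i. real (m i))) UNIV" for m
        by (intro has_integral_mult_right V) simp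
    qed
    then show ?thesis by (rule has_integral_eq[rotated]) (rule W[OF that, symmetric])
  qed
  have "V t = (\<Sum>\<alpha>\<in>E. c \<alpha> * (\<Prod>i<k. t i ^ \<alpha> i))" if "\<And>i. i < k \<Longrightarrow> 0 \<le> t i" for t
  proof -
    have "((\<lambda>x. \<Sum>\<alpha>\<in>E. d x \<alpha> * (\<Prod>i<k. t i ^ \<alpha> i)) has_integral
        (\<Sum>\<alpha>\<in>E. c \<alpha> * (\<Prod>i<k. t i ^ \<alpha> i))) UNIV"
      by (intro has_integral_sum has_integral_mult_left c) (simp_all add: E_def)
    with V[OF that] show ?thesis
      by (rule has_integral_unique)
  qed
  then have "volume_coeffs (map (\<lambda>S. convex hull S) Ss) c"
    by (simp add: volume_coeffs_def V_def k_def E_def)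
  then show ?thesis by blast
qed

subsection \<open>Minkowski's theorem for convex bodies\<close>

text \<open>The change of variables theorem of the library needs a well-ordered index type;
  \<open>'a wo\<close> is a copy of \<open>'a\<close> carrying some well-order.\<close>

typedef 'a wo = "UNIV :: 'a set" by simp

lemma bij_Rep_wo: "bij Rep_wo"
  by (metis Abs_wo_inverse Rep_wo_inverse UNIV_I bijI')

lemma CARD_wo [simp]: "CARD('a wo) = CARD('a)"
  using bij_Rep_wo by (rule bij_betw_same_card)

instance wo :: (finite) finite
proof
  show "finite (UNIV :: 'a wo set)"
    by (rule finite_imageD[of Rep_wo]) (use bij_Rep_wo in \<open>auto simp: bij_def\<close>)
qed

definition wo_index :: "'a::finite wo \<Rightarrow> nat" where
  "wo_index = (SOME f. inj f)"

lemma inj_wo_index: "inj wo_index"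
proof -
  have "\<exists>f :: 'a wo \<Rightarrow> nat. inj f"
    using finite_imp_inj_to_nat_seg[OF finite[of "UNIV :: 'a wo set"]] by (elim exE conjE) (rule exI)
  then show ?thesis
    unfolding wo_index_def by (rule someI_ex)
qed

instantiation wo :: (finite) wellorder
begin

definition less_eq_wo :: "'a wo \<Rightarrow> 'a wo \<Rightarrow> bool" where
  "less_eq_wo x y \<longleftrightarrow> wo_index x \<le> wo_index y"

definition less_wo :: "'a wo \<Rightarrow> 'a wo \<Rightarrow> bool" where
  "less_wo x y \<longleftrightarrow> wo_index x < wo_index y"

instance
proof
  fix x y :: "'a wo" assume "x \<le> y" "y \<le> x"
  then show "x = y" by (simp add: less_eq_wo_def injD[OF inj_wo_index])
next
  fix P :: "'a wo \<Rightarrow> bool" and a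
  assume step: "\<And>x. (\<And>y. y < x \<Longrightarrow> P y) \<Longrightarrow> P x"
  show "P a"
  proof (induction a rule: measure_induct_rule[of wo_index])
    case (less x)
    show ?case by (rule step, rule less) (simp add: less_wo_def)
  qed
qed (auto simp: less_eq_wo_def less_wo_def)

end

definition reindex :: "real^'n \<Rightarrow> real^'n wo" where
  "reindex x = (\<chi> i. x $ Rep_wo i)"

lemma reindex_nth [simp]: "reindex x $ i = x $ Rep_wo i"
  by (simp add: reindex_def)

lemma linear_reindex: "linear reindex"
  by (rule linearI) (simp_all add: vec_eq_iff)

lemma inj_reindex: "inj reindex"
  by (rule injI) (metis Abs_wo_inverse UNIV_I reindex_nth vec_eq_iff)

lemma continuous_on_reindex: "continuous_on S reindex"
  unfolding reindex_def by (intro continuous_intros)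

text \<open>Lebesgue measure is determined by the volumes of boxes, and a relabelling of coordinates
  pulls a box back to a box with the same side lengths.\<close>

lemma lborel_distr_reindex:
  "distr lborel borel (reindex :: real^'n \<Rightarrow> real^'n wo) = lborel"
proof (rule lborel_eqI[symmetric])
  fix l u :: "real^'n wo" assume le: "\<And>b. b \<in> Basis \<Longrightarrow> l \<bullet> b \<le> u \<bullet> b"
  have [measurable]: "(reindex :: real^'n \<Rightarrow> real^'n wo) \<in> borel_measurable borel"
    by (intro borel_measurable_continuous_onI continuous_on_reindex)
  define l' u' :: "real^'n" where "l' = (\<chi> i. l $ Abs_wo i)" and "u' = (\<chi> i. u $ Abs_wo i)"
  have lu: "l $ i \<le> u $ i" for i
    using le[of "axis i 1"] by (simp add: inner_axis axis_in_Basis_iff)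
  then have lu': "l' $ i \<le> u' $ i" for i
    by (simp add: l'_def u'_def)
  have "reindex -` box l u = box l' u'"
  proof -
    have "(\<forall>i. l $ i < x $ Rep_wo i \<and> x $ Rep_wo i < u $ i) \<longleftrightarrow>
        (\<forall>j. l $ Abs_wo j < x $ j \<and> x $ j < u $ Abs_wo j)" for x :: "real^'n"
      by (metis Abs_wo_inverse Rep_wo_inverse UNIV_I)
    then show ?thesis by (auto simp: mem_box_cart l'_def u'_def)
  qed
  then have "emeasure (distr lborel borel reindex) (box l u) = emeasure lborel (box l' u')"
    by (simp add: emeasure_distr)
  also have "\<dots> = (\<Prod>b\<in>Basis. (u' - l') \<bullet> b)"
    using lu' by (intro emeasure_lborel_box) (auto simp: Basis_vec_def inner_axis)
  also have "(\<Prod>b\<in>Basis. (u' - l') \<bullet> b) = (\<Prod>i\<in>UNIV. u' $ i - l' $ i)"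
    using content_cbox_cart[of l' u'] content_cbox[of l' u'] lu'
    by (simp add: Basis_vec_def inner_axis inner_diff_left interval_ne_empty_cart)
  also have "\<dots> = (\<Prod>i\<in>UNIV. u $ i - l $ i)"
    unfolding l'_def u'_def
    by (rule prod.reindex_bij_witness[of _ Rep_wo Abs_wo])
      (simp_all add: Abs_wo_inverse Rep_wo_inverse)
  also have "\<dots> = (\<Prod>b\<in>Basis. (u - l) \<bullet> b)"
    using content_cbox_cart[of l u] content_cbox[of l u] lu
    by (simp add: Basis_vec_def inner_axis inner_diff_left interval_ne_empty_cart)
  finally show "emeasure (distr lborel borel reindex) (box l u) = (\<Prod>b\<in>Basis. (u - l) \<bullet> b)" .
qed simp

lemma measure_reindex:
  fixes S :: "(real^'n) set"
  assumes "compact S"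
  shows "measure lebesgue (reindex ` S) = measure lebesgue S"
proof -
  have [measurable]: "(reindex :: real^'n \<Rightarrow> real^'n wo) \<in> borel_measurable borel"
    by (intro borel_measurable_continuous_onI continuous_on_reindex)
  have "compact (reindex ` S)"
    using assms continuous_on_reindex by (intro compact_continuous_image)
  then have [measurable]: "reindex ` S \<in> sets borel"
    by (intro borel_compact)
  have "measure lebesgue (reindex ` S) = measure (distr lborel borel reindex) (reindex ` S)"
    by (simp add: lborel_distr_reindex measure_completion)
  also have "\<dots> = measure lborel S"
    by (simp add: measure_distr inj_vimage_image_eq[OF inj_reindex])
  also have "\<dots> = measure lebesgue S"
    using assms by (simp add: measure_completion borel_compact)
  finally show ?thesis .
qed

lemma linear_image_minkowski_combination:
  assumes "linear f"
  shows "f ` minkowski_combination t Ks = minkowski_combination t (map ((`) f) Ks)"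
proof (intro equalityI subsetI)
  fix y assume "y \<in> f ` minkowski_combination t Ks"
  then obtain x where x: "x \<in> minkowski_combination t Ks" "y = f x" by blast
  from x(1) obtain g where g: "\<And>i. i < length Ks \<Longrightarrow> g i \<in> Ks ! i" "y = f (\<Sum>i<length Ks. t i *\<^sub>R g i)"
    unfolding mem_minkowski_combination x(2) by blast
  then show "y \<in> minkowski_combination t (map ((`) f) Ks)"
    unfolding mem_minkowski_combination
    by (intro exI[of _ "\<lambda>i. f (g i)"]) (simp add: linear_sum[OF assms] linear_scale[OF assms])
next
  fix y assume "y \<in> minkowski_combination t (map ((`) f) Ks)"
  then obtain g where "\<forall>i<length (map ((`) f) Ks). g i \<in> map ((`) f) Ks ! i"
      "y = (\<Sum>i<length (map ((`) f) Ks). t i *\<^sub>R g i)"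
    unfolding mem_minkowski_combination by blast
  then have g: "\<forall>i\<in>{..<length Ks}. \<exists>x. x \<in> Ks ! i \<and> g i = f x"
      "y = (\<Sum>i<length Ks. t i *\<^sub>R g i)"
    by auto
  from bchoice[OF g(1)] obtain x where x: "\<And>i. i < length Ks \<Longrightarrow> x i \<in> Ks ! i \<and> g i = f (x i)"
    by auto
  then have "y = f (\<Sum>i<length Ks. t i *\<^sub>R x i)"
    using g(2) by (simp add: linear_sum[OF assms] linear_scale[OF assms])
  moreover have "(\<Sum>i<length Ks. t i *\<^sub>R x i) \<in> minkowski_combination t Ks"
    using x by (auto simp: mem_minkowski_combination)
  ultimately show "y \<in> f ` minkowski_combination t Ks" by blast
qed

lemma minkowski_theorem_polytopes_any_index:
  fixes Ss :: "(real^'n) set list"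
  assumes S: "\<forall>S\<in>set Ss. finite S \<and> S \<noteq> {}"
  shows "\<exists>c. volume_coeffs (map (\<lambda>S. convex hull S) Ss) c"
proof -
  define Rs where "Rs = map (\<lambda>S. reindex ` S) Ss"
  have "\<forall>S\<in>set Rs. finite S \<and> S \<noteq> {}"
    using S by (auto simp: Rs_def)
  then obtain c where c: "volume_coeffs (map (\<lambda>S. convex hull S) Rs) c"
    using minkowski_theorem_polytopes by blast
  have "map (\<lambda>S. convex hull S) Rs = map ((`) reindex) (map (\<lambda>S. convex hull S) Ss)"
    by (simp add: Rs_def convex_hull_linear_image[OF linear_reindex])
  then have "minkowski_combination t (map (\<lambda>S. convex hull S) Rs) =
      reindex ` minkowski_combination t (map (\<lambda>S. convex hull S) Ss)" for t
    by (simp add: linear_image_minkowski_combination[OF linear_reindex])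
  moreover have "compact (minkowski_combination t (map (\<lambda>S. convex hull S) Ss))" for t
    using convex_body_minkowski_combination[of "map (\<lambda>S. convex hull S) Ss" t] S
    by (auto simp: convex_body_def finite_imp_compact_convex_hull)
  ultimately have "measure lebesgue (minkowski_combination t (map (\<lambda>S. convex hull S) Rs)) =
      measure lebesgue (minkowski_combination t (map (\<lambda>S. convex hull S) Ss))" for t
    by (simp add: measure_reindex)
  moreover have "length Rs = length Ss" by (simp add: Rs_def)
  ultimately have "volume_coeffs (map (\<lambda>S. convex hull S) Ss) c"
    using c by (simp add: volume_coeffs_def)
  then show ?thesis by blast
qed

text \<open>Initial segments of an enumeration of a countable dense subset. They increase, so
  volumes can be handled by continuity from below instead of Hausdorff distance.\<close>

lemma convex_body_finite_approximation:
  assumes "convex_body K"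
  obtains S :: "nat \<Rightarrow> 'a::euclidean_space set" where
    "\<And>m. finite (S m)" "\<And>m. S m \<noteq> {}" "incseq S" "\<And>m. S m \<subseteq> K" "K \<subseteq> closure (\<Union>m. S m)"
proof -
  obtain T where T: "countable T" "T \<subseteq> K" "K \<subseteq> closure T"
    using separable[of K] by blast
  have "T \<noteq> {}" using T assms by (auto simp: convex_body_def)
  then have range: "range (from_nat_into T) = T"
    using T(1) by (rule range_from_nat_into)
  show thesis
  proof (rule that[of "\<lambda>m. from_nat_into T ` {..m}"])
    have "(\<Union>m. from_nat_into T ` {..m}) = range (from_nat_into T)"
      by auto
    then show "K \<subseteq> closure (\<Union>m. from_nat_into T ` {..m})"
      using T range by simp
  qed (use range T in \<open>auto simp: incseq_def\<close>)
qed

text \<open>The increasing union of the polytopal combinations is convex and dense in the full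
  combination. A convex set contains the interior of its closure, so the union misses only boundary
  points, and continuity of measure from below applies.\<close>

lemma combination_approximation_volume:
  fixes Ks :: "(real^'n) set list"
  assumes K: "\<forall>K\<in>set Ks. convex_body K"
    and S: "\<And>K m. K \<in> set Ks \<Longrightarrow> finite (F K m) \<and> F K m \<noteq> {} \<and> F K m \<subseteq> K"
    and inc: "\<And>K. K \<in> set Ks \<Longrightarrow> incseq (F K)"
    and dense: "\<And>K. K \<in> set Ks \<Longrightarrow> K \<subseteq> closure (\<Union>m. F K m)"
  shows "(\<lambda>m. measure lebesgue (minkowski_combination t (map (\<lambda>K. convex hull (F K m)) Ks)))
           \<longlonglongrightarrow> measure lebesgue (minkowski_combination t Ks)"
proof -
  define Q where "Q m = minkowski_combination t (map (\<lambda>K. convex hull (F K m)) Ks)" for m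
  define D where "D = (\<Union>m. Q m)"
  let ?P = "minkowski_combination t Ks"
  have body: "convex_body (Q m)" for m
    unfolding Q_def using S
    by (intro convex_body_minkowski_combination) (auto simp: convex_body_def finite_imp_compact_convex_hull)
  have body_P: "convex_body ?P"
    using K by (rule convex_body_minkowski_combination)
  have "incseq Q"
    unfolding incseq_def Q_def
  proof (intro allI impI minkowski_combination_mono)
    fix m n i :: nat assume "m \<le> n" "i < length (map (\<lambda>K. convex hull (F K m)) Ks)"
    then have "F (Ks ! i) m \<subseteq> F (Ks ! i) n" using inc[of "Ks ! i"] by (simp add: incseqD)
    then show "map (\<lambda>K. convex hull (F K m)) Ks ! i \<subseteq> map (\<lambda>K. convex hull (F K n)) Ks ! i"
      using \<open>i < _\<close> by (simp add: hull_mono)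
  qed simp
  have QP: "Q m \<subseteq> ?P" for m
    unfolding Q_def
  proof (intro minkowski_combination_mono)
    fix i assume "i < length (map (\<lambda>K. convex hull (F K m)) Ks)"
    then have "Ks ! i \<in> set Ks" by simp
    then have "convex hull (F (Ks ! i) m) \<subseteq> Ks ! i"
      using S K by (intro hull_minimal) (auto simp: convex_body_def)
    then show "map (\<lambda>K. convex hull (F K m)) Ks ! i \<subseteq> Ks ! i" using \<open>i < _\<close> by simp
  qed simp
  have "convex D"
  proof (rule convexI)
    fix x y and u v :: real
    assume xy: "x \<in> D" "y \<in> D" and uv: "0 \<le> u" "0 \<le> v" "u + v = 1"
    then obtain m m' where "x \<in> Q m" "y \<in> Q m'" by (auto simp: D_def)
    then have "x \<in> Q (max m m')" "y \<in> Q (max m m')"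
      using incseqD[OF \<open>incseq Q\<close>, of m "max m m'"] incseqD[OF \<open>incseq Q\<close>, of m' "max m m'"] by auto
    then have "u *\<^sub>R x + v *\<^sub>R y \<in> Q (max m m')"
      using body uv by (auto simp: convex_body_def intro: convexD)
    then show "u *\<^sub>R x + v *\<^sub>R y \<in> D" by (auto simp: D_def)
  qed
  have "?P \<subseteq> closure D"
  proof
    fix x assume "x \<in> ?P"
    then obtain f where f: "\<And>i. i < length Ks \<Longrightarrow> f i \<in> Ks ! i" "x = (\<Sum>i<length Ks. t i *\<^sub>R f i)"
      by (auto simp: mem_minkowski_combination)
    have "\<forall>i\<in>{..<length Ks}. \<exists>g. (\<forall>n. g n \<in> (\<Union>m. F (Ks ! i) m)) \<and> g \<longlonglongrightarrow> f i"
    proof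
      fix i assume "i \<in> {..<length Ks}"
      then have "f i \<in> closure (\<Union>m. F (Ks ! i) m)"
        using f(1)[of i] dense[of "Ks ! i"] by auto
      then show "\<exists>g. (\<forall>n. g n \<in> (\<Union>m. F (Ks ! i) m)) \<and> g \<longlonglongrightarrow> f i"
        unfolding closure_sequential .
    qed
    from bchoice[OF this] obtain g where
      g: "\<And>i n. i < length Ks \<Longrightarrow> g i n \<in> (\<Union>m. F (Ks ! i) m)" "\<And>i. i < length Ks \<Longrightarrow> g i \<longlonglongrightarrow> f i"
      by auto
    have "(\<lambda>n. \<Sum>i<length Ks. t i *\<^sub>R g i n) \<longlonglongrightarrow> x"
      unfolding f(2) using g(2) by (intro tendsto_sum tendsto_scaleR tendsto_const) auto
    moreover have "(\<Sum>i<length Ks. t i *\<^sub>R g i n) \<in> D" for n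
    proof -
      have "\<forall>i\<in>{..<length Ks}. \<exists>m. g i n \<in> F (Ks ! i) m"
        using g(1) by auto
      from bchoice[OF this] obtain m where m: "\<And>i. i < length Ks \<Longrightarrow> g i n \<in> F (Ks ! i) (m i)"
        by auto
      \<comment> \<open>A stage late enough for all the finitely many points at once; 0 is inserted
        for the empty list.\<close>
      define M where "M = Max (insert 0 (m ` {..<length Ks}))"
      have "g i n \<in> convex hull (F (Ks ! i) M)" if "i < length Ks" for i
      proof -
        have "m i \<le> M" using that by (auto simp: M_def)
        then have "F (Ks ! i) (m i) \<subseteq> F (Ks ! i) M"
          using inc[of "Ks ! i"] that by (auto simp: incseq_def)
        then show ?thesis using m[OF that] by (auto intro: hull_inc)
      qed
      then have "(\<Sum>i<length Ks. t i *\<^sub>R g i n) \<in> Q M"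
        unfolding Q_def mem_minkowski_combination by (intro exI[of _ "\<lambda>i. g i n"]) simp
      then show ?thesis by (auto simp: D_def)
    qed
    ultimately show "x \<in> closure D"
      unfolding closure_sequential by (intro exI[of _ "\<lambda>n. \<Sum>i<length Ks. t i *\<^sub>R g i n"]) simp
  qed
  then have "interior ?P \<subseteq> interior (closure D)" by (rule interior_mono)
  also have "\<dots> = interior D" using \<open>convex D\<close> by (rule convex_interior_closure)
  finally have int: "interior ?P \<subseteq> D" using interior_subset by blast
  have "D \<subseteq> ?P" using QP by (auto simp: D_def)
  note D = measure_between_interior_and_body[OF body_P int this]
  have "(\<lambda>m. measure lebesgue (Q m)) \<longlonglongrightarrow> measure lebesgue (\<Union>m. Q m)"
  proof (rule Lim_measure_incseq)
    show "range Q \<subseteq> sets lebesgue"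
      using body convex_body_lmeasurable by (blast intro: fmeasurableD)
    show "emeasure lebesgue (\<Union>m. Q m) \<noteq> \<infinity>"
      using fmeasurableD2[OF D(1)] by (simp add: D_def)
  qed fact
  then show ?thesis
    using D(2) by (simp add: D_def[symmetric] Q_def[symmetric])
qed

theorem minkowski_theorem:
  fixes Ks :: "(real^'n) set list"
  assumes K: "\<forall>K\<in>set Ks. convex_body K"
  shows "\<exists>c. volume_coeffs Ks c"
proof -
  have "\<forall>K\<in>set Ks. \<exists>S. (\<forall>m. finite (S m) \<and> S m \<noteq> {} \<and> S m \<subseteq> K) \<and> incseq S \<and> K \<subseteq> closure (\<Union>m. S m)"
  proof
    fix K assume "K \<in> set Ks"
    then have "convex_body K" using K by blast
    from convex_body_finite_approximation[OF this]
    show "\<exists>S. (\<forall>m. finite (S m) \<and> S m \<noteq> {} \<and> S m \<subseteq> K) \<and> incseq S \<and> K \<subseteq> closure (\<Union>m. S m)"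
      by metis
  qed
  from bchoice[OF this] obtain F where
    F: "\<And>K m. K \<in> set Ks \<Longrightarrow> finite (F K m) \<and> F K m \<noteq> {} \<and> F K m \<subseteq> K"
    "\<And>K. K \<in> set Ks \<Longrightarrow> incseq (F K)" "\<And>K. K \<in> set Ks \<Longrightarrow> K \<subseteq> closure (\<Union>m. F K m)"
    by blast
  define k where "k = length Ks"
  define E where "E = exponents k CARD('n)"
  define V where "V t = measure lebesgue (minkowski_combination t Ks)" for t
  define Vm where "Vm m t = measure lebesgue (minkowski_combination t (map (\<lambda>K. convex hull (F K m)) Ks))" for m t
  have lim: "(\<lambda>m. Vm m t) \<longlonglongrightarrow> V t" for t
    unfolding Vm_def V_def by (rule combination_approximation_volume[OF K F])
  have "\<forall>m. \<exists>c. volume_coeffs (map (\<lambda>K. convex hull (F K m)) Ks) c"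
  proof
    fix m
    show "\<exists>c. volume_coeffs (map (\<lambda>K. convex hull (F K m)) Ks) c"
      using minkowski_theorem_polytopes_any_index[of "map (\<lambda>K. F K m) Ks"] F(1) by (simp add: comp_def)
  qed
  from choice[OF this] obtain cm where
    cm: "\<And>m. volume_coeffs (map (\<lambda>K. convex hull (F K m)) Ks) (cm m)" by blast
  have Vm: "Vm m t = (\<Sum>\<alpha>\<in>E. cm m \<alpha> * (\<Prod>i<k. t i ^ \<alpha> i))" if "\<And>i. i < k \<Longrightarrow> 0 \<le> t i" for m t
    using cm[of m] that by (simp add: volume_coeffs_def Vm_def E_def k_def)
  obtain W where W: "\<And>c \<alpha>. \<alpha> \<in> E \<Longrightarrow>
       c \<alpha> = (\<Sum>p\<in>PiE {..<k} (\<lambda>_. {..CARD('n)}). W \<alpha> p *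
         (\<Sum>\<beta>\<in>E. c \<beta> * (\<Prod>i<k. real (p i) ^ \<beta> i)))"
    unfolding E_def by (rule coefficient_functional[of k "CARD('n)"]) blast
  define c where "c \<alpha> = (\<Sum>p\<in>PiE {..<k} (\<lambda>_. {..CARD('n)}). W \<alpha> p * V (\<lambda>i. real (p i)))" for \<alpha>
  have cm_eq: "cm m \<alpha> = (\<Sum>p\<in>PiE {..<k} (\<lambda>_. {..CARD('n)}). W \<alpha> p * Vm m (\<lambda>i. real (p i)))"
    if "\<alpha> \<in> E" for m \<alpha>
    by (subst W[OF that, of "cm m"]) (simp add: Vm)
  have c_lim: "(\<lambda>m. cm m \<alpha>) \<longlonglongrightarrow> c \<alpha>" if "\<alpha> \<in> E" for \<alpha>
    unfolding cm_eq[OF that] c_def by (intro tendsto_sum tendsto_mult_left lim)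
  have "V t = (\<Sum>\<alpha>\<in>E. c \<alpha> * (\<Prod>i<k. t i ^ \<alpha> i))" if "\<And>i. i < k \<Longrightarrow> 0 \<le> t i" for t
  proof (rule LIMSEQ_unique[OF lim])
    show "(\<lambda>m. Vm m t) \<longlonglongrightarrow> (\<Sum>\<alpha>\<in>E. c \<alpha> * (\<Prod>i<k. t i ^ \<alpha> i))"
      using that by (simp add: Vm) (intro tendsto_sum tendsto_mult_right c_lim)
  qed
  then have "volume_coeffs Ks c"
    by (simp add: volume_coeffs_def V_def k_def E_def)
  then show ?thesis by blast
qed

subsection \<open>Mixed volumes with a segment\<close>

abbreviation ones :: "nat \<Rightarrow> nat \<Rightarrow> nat" where
  "ones n \<equiv> (\<lambda>i. if i < n then 1 else 0)"

lemma ones_in_exponents: "ones n \<in> exponents n n"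
  by (simp add: exponents_def)

text \<open>\<open>coefficients_unique\<close> settles the description operator: a coefficient
  family obtained in any way evaluates the mixed volume.\<close>

lemma mixed_volume_eq:
  fixes Ks :: "(real^'n) set list"
  assumes c: "volume_coeffs Ks c" and len: "length Ks = CARD('n)"
  shows "mixed_volume Ks = c (ones CARD('n)) / fact CARD('n)"
proof -
  have unique: "c' (ones CARD('n)) = c (ones CARD('n))" if "volume_coeffs Ks c'" for c'
  proof (rule coefficients_unique[OF _ ones_in_exponents])
    fix t :: "nat \<Rightarrow> real" assume "\<And>i. i < CARD('n) \<Longrightarrow> 0 \<le> t i"
    then show "(\<Sum>\<alpha>\<in>exponents CARD('n) CARD('n). c' \<alpha> * (\<Prod>i<CARD('n). t i ^ \<alpha> i)) =
        (\<Sum>\<alpha>\<in>exponents CARD('n) CARD('n). c \<alpha> * (\<Prod>i<CARD('n). t i ^ \<alpha> i))"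
      using c that len by (auto simp: volume_coeffs_def)
  qed
  show ?thesis
    unfolding mixed_volume_def len
  proof (rule the_equality)
    show "\<exists>c'. volume_coeffs Ks c' \<and> c (ones CARD('n)) / fact CARD('n) = c' (ones CARD('n)) / fact CARD('n)"
      using c by blast
    show "v = c (ones CARD('n)) / fact CARD('n)"
      if "\<exists>c'. volume_coeffs Ks c' \<and> v = c' (ones CARD('n)) / fact CARD('n)" for v
      using that unique by (elim exE conjE) simp
  qed
qed

text \<open>Putting \<open>t 0 = 0\<close> deletes exactly the monomials that contain
  \<open>t 0\<close>, so the difference consists of these. The monomial read off by
  \<open>mixed_volume\<close> is among them.\<close>

lemma mixed_volume_cong_difference:
  fixes Ks Ls :: "(real^'n) set list"
  assumes K: "\<forall>K\<in>set Ks. convex_body K" "length Ks = CARD('n)"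
    and L: "\<forall>L\<in>set Ls. convex_body L" "length Ls = CARD('n)"
    and diff: "\<And>t. (\<And>i. i < CARD('n) \<Longrightarrow> 0 \<le> t i) \<Longrightarrow>
       measure lebesgue (minkowski_combination t Ks) -
         measure lebesgue (minkowski_combination (t(0 := 0)) Ks) =
       measure lebesgue (minkowski_combination t Ls) -
         measure lebesgue (minkowski_combination (t(0 := 0)) Ls)"
  shows "mixed_volume Ks = mixed_volume Ls"
proof -
  define E where "E = exponents CARD('n) CARD('n)"
  have n: "0 < CARD('n)" by simp
  obtain c where c: "volume_coeffs Ks c" using minkowski_theorem[OF K(1)] by blast
  obtain c' where c': "volume_coeffs Ls c'" using minkowski_theorem[OF L(1)] by blast
  have split: "(\<Sum>\<alpha>\<in>E. a \<alpha> * (\<Prod>i<CARD('n). t i ^ \<alpha> i)) -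
      (\<Sum>\<alpha>\<in>E. a \<alpha> * (\<Prod>i<CARD('n). (t(0 := 0)) i ^ \<alpha> i)) =
      (\<Sum>\<alpha>\<in>E. (if \<alpha> 0 = 0 then 0 else a \<alpha>) * (\<Prod>i<CARD('n). t i ^ \<alpha> i))"
    for a and t :: "nat \<Rightarrow> real"
  proof -
    have "(\<Prod>i<CARD('n). (t(0 := 0)) i ^ \<alpha> i) =
        (if \<alpha> 0 = 0 then (\<Prod>i<CARD('n). t i ^ \<alpha> i) else 0)" for \<alpha>
    proof (cases "\<alpha> 0 = 0")
      case True
      then show ?thesis by (auto intro!: prod.cong)
    next
      case False
      have "(\<Prod>i<CARD('n). (t(0 := 0)) i ^ \<alpha> i) = 0"
        using False n by (intro prod_zero) (auto intro!: bexI[of _ 0] simp: power_0_left)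
      then show ?thesis using False by simp
    qed
    then show ?thesis
      by (auto simp: sum_subtractf[symmetric] intro!: sum.cong)
  qed
  have "(if ones CARD('n) 0 = 0 then 0 else c (ones CARD('n))) =
      (if ones CARD('n) 0 = 0 then 0 else c' (ones CARD('n)))"
  proof (rule coefficients_unique[where c = "\<lambda>\<alpha>. if \<alpha> 0 = 0 then 0 else c \<alpha>" and
        c' = "\<lambda>\<alpha>. if \<alpha> 0 = 0 then 0 else c' \<alpha>", OF _ ones_in_exponents])
    fix t :: "nat \<Rightarrow> real" assume t: "\<And>i. i < CARD('n) \<Longrightarrow> 0 \<le> t i"
    then have t': "\<And>i. i < CARD('n) \<Longrightarrow> 0 \<le> (t(0 := 0)) i" by simp
    show "(\<Sum>\<alpha>\<in>exponents CARD('n) CARD('n). (if \<alpha> 0 = 0 then 0 else c \<alpha>) * (\<Prod>i<CARD('n). t i ^ \<alpha> i)) =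
        (\<Sum>\<alpha>\<in>exponents CARD('n) CARD('n). (if \<alpha> 0 = 0 then 0 else c' \<alpha>) * (\<Prod>i<CARD('n). t i ^ \<alpha> i))"
      unfolding E_def[symmetric] split[symmetric]
      using diff[OF t] c c' K(2) L(2) t t' by (simp add: volume_coeffs_def E_def)
  qed
  then have "c (ones CARD('n)) = c' (ones CARD('n))" using n by simp
  then show ?thesis
    by (simp add: mixed_volume_eq[OF c K(2)] mixed_volume_eq[OF c' L(2)])
qed

section \<open>Sweeping a body along a direction\<close>

text \<open>The Minkowski sum of \<open>A\<close> and the segment from 0 to l u.\<close>

definition sweep :: "'a::real_vector set \<Rightarrow> 'a \<Rightarrow> real \<Rightarrow> 'a set" where
  "sweep A u l = {a + s *\<^sub>R u |a s. a \<in> A \<and> 0 \<le> s \<and> s \<le> l}"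

lemma compact_sweep:
  fixes A :: "'a::euclidean_space set"
  assumes "compact A"
  shows "compact (sweep A u l)"
proof -
  have "sweep A u l = (\<lambda>p. fst p + snd p *\<^sub>R u) ` (A \<times> {0..l})"
    unfolding sweep_def by (force intro: image_eqI[where x = "(_, _)"])
  also have "compact \<dots>"
    using assms by (intro compact_continuous_image continuous_intros compact_Times compact_Icc)
  finally show ?thesis .
qed

lemma convex_line_between:
  assumes "convex A" "x + p *\<^sub>R u \<in> A" "x + q *\<^sub>R u \<in> A" "p \<le> (r::real)" "r \<le> q"
  shows "x + r *\<^sub>R u \<in> A"
proof (cases "p = q")
  case False
  define v where "v = (r - p) / (q - p)"
  have v: "0 \<le> v" "v \<le> 1" using False assms(4,5) by (auto simp: v_def divide_simps)
  have r: "r = (1 - v) * p + v * q"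
  proof -
    have "v * (q - p) = r - p" using False by (simp add: v_def)
    then show ?thesis by (simp add: algebra_simps)
  qed
  have "(1 - v) *\<^sub>R (x + p *\<^sub>R u) + v *\<^sub>R (x + q *\<^sub>R u) \<in> A"
    using assms(1-3) v by (intro convexD) auto
  moreover have "(1 - v) *\<^sub>R (x + p *\<^sub>R u) + v *\<^sub>R (x + q *\<^sub>R u) = x + r *\<^sub>R u"
    by (simp add: r algebra_simps)
  ultimately show ?thesis by simp
qed (use assms in auto)

text \<open>Both differences consist of the part of \<open>B\<close> below \<open>A\<close> and a translate of the part of
  \<open>B\<close> above \<open>A\<close>, as seen in the direction \<open>u\<close>.\<close>

lemma measure_sweep_difference:
  fixes A B :: "'a::euclidean_space set"
  assumes A: "convex_body A" and B: "convex_body B" and AB: "A \<subseteq> B" and l: "0 \<le> l"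
    and proj: "\<And>b. b \<in> B \<Longrightarrow> \<exists>s. b + s *\<^sub>R u \<in> A"
  shows "measure lebesgue (sweep A u l) - measure lebesgue A =
         measure lebesgue (sweep B u l) - measure lebesgue B"
proof -
  \<comment> \<open>Every line parallel to \<open>u\<close> through a point of \<open>B\<close>
    meets \<open>A\<close>, so a point of \<open>B\<close> outside \<open>A\<close> has
    \<open>A\<close> on exactly one side: behind it for \<open>Up\<close>, ahead of it for
    \<open>Low\<close>.\<close>
  define Up where "Up = {x\<in>B. \<forall>s\<ge>0. x + s *\<^sub>R u \<notin> A}"
  define Low where "Low = {x\<in>B. \<forall>s\<ge>0. x - s *\<^sub>R u \<notin> A}"
  have convA: "convex A" and convB: "convex B" using A B by (auto simp: convex_body_def)
  have between: "y \<in> A" if "y - p *\<^sub>R u \<in> A" "y + q *\<^sub>R u \<in> A" "0 \<le> p" "0 \<le> q" for y p q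
    using convex_line_between[OF convA, of y "- p" u q 0] that by simp
  have diff: "B - A = Up \<union> Low"
  proof (intro equalityI subsetI)
    fix x assume x: "x \<in> B - A"
    then obtain s where s: "x + s *\<^sub>R u \<in> A" using proj by blast
    show "x \<in> Up \<union> Low"
    proof (cases "s \<ge> 0")
      case True
      then have "x \<in> Low" using between[of x _ s] x s by (auto simp: Low_def)
      then show ?thesis ..
    next
      case False
      then have "x \<in> Up" using between[of x "- s"] x s by (auto simp: Up_def)
      then show ?thesis ..
    qed
  next
    fix x assume "x \<in> Up \<union> Low"
    then show "x \<in> B - A" by (auto simp: Up_def Low_def dest: spec[of _ 0])
  qed
  have disj: "Up \<inter> Low = {}"
  proof (rule ccontr)
    assume "Up \<inter> Low \<noteq> {}"
    then obtain x where x: "x \<in> Up" "x \<in> Low" by blast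
    then obtain s where s: "x + s *\<^sub>R u \<in> A" using proj by (auto simp: Up_def)
    show False
    proof (cases "s \<ge> 0")
      case True
      then show ?thesis using x(1) s by (auto simp: Up_def)
    next
      case False
      then have "0 \<le> - s" "x - (- s) *\<^sub>R u \<in> A" using s by auto
      then show ?thesis using x(2) unfolding Low_def by blast
    qed
  qed
  have sweep_diff: "sweep B u l - sweep A u l = (+) (l *\<^sub>R u) ` Up \<union> Low"
  proof (intro equalityI subsetI)
    fix x assume x: "x \<in> sweep B u l - sweep A u l"
    then obtain b s where b: "x = b + s *\<^sub>R u" "b \<in> B" "0 \<le> s" "s \<le> l" by (auto simp: sweep_def)
    obtain r where r: "b + r *\<^sub>R u \<in> A" using proj b(2) by blast
    have rB: "b + r *\<^sub>R u \<in> B" using r AB by blast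
    have x_r: "x + (r - s) *\<^sub>R u \<in> A" using r by (simp add: b(1) algebra_simps)
    have notA: "x - p *\<^sub>R u \<notin> A" if "0 \<le> p" "p \<le> l" for p
    proof
      assume "x - p *\<^sub>R u \<in> A"
      then have "x \<in> sweep A u l"
        unfolding sweep_def using that by (intro CollectI exI[of _ "x - p *\<^sub>R u"] exI[of _ p]) simp
      then show False using x by simp
    qed
    \<comment> \<open>The line through \<open>x\<close> meets \<open>A\<close>, but not between x -
      l u and x, so \<open>A\<close> is ahead of \<open>x\<close> or more than \<open>l\<close>
      behind it. In the first case \<open>x\<close> lies between \<open>b\<close> and a point of
      \<open>A\<close>, in the second x - l u does; hence that point is in \<open>B\<close>.\<close>
    consider "r - s > 0" | "r - s < - l"
      using notA[of "s - r"] x_r by (fastforce simp: algebra_simps)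
    then show "x \<in> (+) (l *\<^sub>R u) ` Up \<union> Low"
    proof cases
      case 1
      have "x \<in> B"
        unfolding b(1) using convex_line_between[OF convB, of b 0 u r s] b rB 1 by simp
      moreover have "x - p *\<^sub>R u \<notin> A" if "0 \<le> p" for p
        using between[of x p "r - s"] notA[of 0] x_r 1 that l by auto
      ultimately have "x \<in> Low" by (simp add: Low_def)
      then show ?thesis ..
    next
      case 2
      define y where "y = x - l *\<^sub>R u"
      have y: "y = b + (s - l) *\<^sub>R u" by (simp add: y_def b(1) algebra_simps)
      have "y \<in> B"
        unfolding y using convex_line_between[OF convB, of b r u 0 "s - l"] b rB 2 by simp
      moreover have "y + p *\<^sub>R u \<notin> A" if "0 \<le> p" for p
      proof
        assume *: "y + p *\<^sub>R u \<in> A"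
        have "y - (s - l - r) *\<^sub>R u \<in> A" using r by (simp add: y algebra_simps)
        then have "y \<in> A" using between[of y "s - l - r" p] * that 2 by simp
        then show False using notA[of l] l by (simp add: y_def)
      qed
      ultimately have "y \<in> Up" by (simp add: Up_def)
      then show ?thesis by (auto simp: y_def image_iff intro!: bexI[of _ y])
    qed
  next
    fix x assume "x \<in> (+) (l *\<^sub>R u) ` Up \<union> Low"
    then show "x \<in> sweep B u l - sweep A u l"
    proof
      assume "x \<in> (+) (l *\<^sub>R u) ` Up"
      then obtain y where y: "x = l *\<^sub>R u + y" "y \<in> Up" by blast
      have "x \<in> sweep B u l"
        using y l by (auto simp: sweep_def Up_def intro!: exI[of _ y] exI[of _ l])
      moreover have "x \<notin> sweep A u l"
      proof
        assume "x \<in> sweep A u l"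
        then obtain a s where a: "x = a + s *\<^sub>R u" "a \<in> A" "0 \<le> s" "s \<le> l" by (auto simp: sweep_def)
        then have "y + (l - s) *\<^sub>R u = a" using y(1) by (simp add: algebra_simps)
        then have "y + (l - s) *\<^sub>R u \<in> A" using a(2) by simp
        then show False using y(2) a(4) by (auto simp: Up_def dest!: spec[of _ "l - s"])
      qed
      ultimately show ?thesis by simp
    next
      assume x: "x \<in> Low"
      have "x \<in> sweep B u l"
        using x l by (auto simp: sweep_def Low_def intro!: exI[of _ x] exI[of _ "0::real"])
      moreover have "x \<notin> sweep A u l"
      proof
        assume "x \<in> sweep A u l"
        then obtain a s where a: "x = a + s *\<^sub>R u" "a \<in> A" "0 \<le> s" by (auto simp: sweep_def)
        then have "x - s *\<^sub>R u \<in> A" by simp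
        then show False using x a(3) by (auto simp: Low_def)
      qed
      ultimately show ?thesis by simp
    qed
  qed
  have disj': "(+) (l *\<^sub>R u) ` Up \<inter> Low = {}"
  proof (rule ccontr)
    assume "(+) (l *\<^sub>R u) ` Up \<inter> Low \<noteq> {}"
    then obtain y where y: "y \<in> Up" "l *\<^sub>R u + y \<in> Low" by blast
    then obtain r where r: "l *\<^sub>R u + y + r *\<^sub>R u \<in> A" using proj by (auto simp: Low_def)
    have "0 < r"
    proof (rule ccontr)
      assume "\<not> 0 < r"
      then show False using y(2) r unfolding Low_def
        by (auto dest!: spec[of _ "- r"])
    qed
    then have "0 \<le> l + r" "y + (l + r) *\<^sub>R u \<in> A" using r l by (simp_all add: algebra_simps)
    then show False using y(1) unfolding Up_def by blast
  qed
  have meas: "A \<in> lmeasurable" "B \<in> lmeasurable"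
    using A B by (auto intro: convex_body_lmeasurable)
  have cA: "compact A" and cB: "compact B" using A B by (auto simp: convex_body_def)
  have msweep: "sweep A u m \<in> lmeasurable" "sweep B u m \<in> lmeasurable" for m
    using cA cB compact_sweep lmeasurable_compact by blast+
  \<comment> \<open>The points with \<open>A\<close> behind them or at them form a countable union
    of compact sweeps. This makes \<open>Low\<close> measurable, and \<open>Up\<close> is then a
    difference of measurable sets.\<close>
  have "Low = B - (\<Union>N. sweep A u (real N))"
  proof -
    have "(\<exists>s\<ge>0. x - s *\<^sub>R u \<in> A) \<longleftrightarrow> x \<in> (\<Union>N. sweep A u (real N))" for x
    proof
      assume "\<exists>s\<ge>0. x - s *\<^sub>R u \<in> A"
      then obtain s where s: "0 \<le> s" "x - s *\<^sub>R u \<in> A" by blast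
      obtain N where "s \<le> real N" using real_arch_simple by blast
      then have "x \<in> sweep A u (real N)"
        unfolding sweep_def using s by (intro CollectI exI[of _ "x - s *\<^sub>R u"] exI[of _ s]) simp
      then show "x \<in> (\<Union>N. sweep A u (real N))" by blast
    next
      assume "x \<in> (\<Union>N. sweep A u (real N))"
      then obtain a s where "x = a + s *\<^sub>R u" "a \<in> A" "0 \<le> s" by (auto simp: sweep_def)
      then show "\<exists>s\<ge>0. x - s *\<^sub>R u \<in> A" by (intro exI[of _ s]) simp
    qed
    then show ?thesis by (auto simp: Low_def)
  qed
  then have Low: "Low \<in> lmeasurable"
    using meas msweep by (auto intro!: fmeasurable.Diff fmeasurableD sets.countable_UN fmeasurable_Diff)
  have "Up = (B - A) - Low" using diff disj by blast
  then have Up: "Up \<in> lmeasurable"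
    using meas Low by (auto intro!: fmeasurable.Diff)
  have "measure lebesgue (sweep B u l) - measure lebesgue (sweep A u l) =
      measure lebesgue (sweep B u l - sweep A u l)"
  proof (subst measurable_measure_Diff)
    show "sweep A u l \<subseteq> sweep B u l" using AB by (auto simp: sweep_def)
  qed (use msweep in \<open>auto simp: fmeasurableD\<close>)
  also have "\<dots> = measure lebesgue ((+) (l *\<^sub>R u) ` Up) + measure lebesgue Low"
    unfolding sweep_diff using measure_Un3[OF measurable_translation[OF Up] Low] disj' by simp
  also have "\<dots> = measure lebesgue Up + measure lebesgue Low"
    by (simp add: measure_translation)
  also have "\<dots> = measure lebesgue (Up \<union> Low)"
    using measure_Un3[OF Up Low] disj by simp
  also have "\<dots> = measure lebesgue B - measure lebesgue A"
    unfolding diff[symmetric] using meas AB by (intro measurable_measure_Diff) (auto simp: fmeasurableD)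
  finally show ?thesis by simp
qed

lemma sum_length_Cons:
  "(\<Sum>i<length (x # xs). h i) = h 0 + (\<Sum>i<length xs. h (Suc i))"
  by (simp add: sum.lessThan_Suc_shift del: sum.lessThan_Suc)

lemma minkowski_combination_segment:
  assumes "0 \<le> t 0"
  shows "minkowski_combination t (closed_segment 0 u # Ks) =
    sweep (minkowski_combination (t(0 := 0)) (closed_segment 0 u # Ks)) u (t 0)"
proof (intro equalityI subsetI)
  fix x assume "x \<in> minkowski_combination t (closed_segment 0 u # Ks)"
  then obtain f where f: "\<forall>i<length (closed_segment 0 u # Ks). f i \<in> (closed_segment 0 u # Ks) ! i"
      "x = (\<Sum>i<length (closed_segment 0 u # Ks). t i *\<^sub>R f i)"
    unfolding mem_minkowski_combination by blast
  from f(1)[rule_format, of 0] obtain v where v: "f 0 = v *\<^sub>R u" "0 \<le> v" "v \<le> 1"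
    by (auto simp: closed_segment_def)
  define y where "y = (\<Sum>i<length (closed_segment 0 u # Ks). (t(0 := 0)) i *\<^sub>R f i)"
  have "y \<in> minkowski_combination (t(0 := 0)) (closed_segment 0 u # Ks)"
    unfolding mem_minkowski_combination y_def using f(1) by blast
  moreover have "x = y + (t 0 * v) *\<^sub>R u"
    unfolding f(2) y_def unfolding sum_length_Cons by (simp add: v(1))
  moreover have "0 \<le> t 0 * v" "t 0 * v \<le> t 0"
    using v assms by (auto simp: mult_left_le)
  ultimately show "x \<in> sweep (minkowski_combination (t(0 := 0)) (closed_segment 0 u # Ks)) u (t 0)"
    by (auto simp: sweep_def)
next
  fix x assume "x \<in> sweep (minkowski_combination (t(0 := 0)) (closed_segment 0 u # Ks)) u (t 0)"
  then obtain y s where y: "x = y + s *\<^sub>R u" "0 \<le> s" "s \<le> t 0"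
      "y \<in> minkowski_combination (t(0 := 0)) (closed_segment 0 u # Ks)" by (auto simp: sweep_def)
  from y(4) obtain f where f: "\<forall>i<length (closed_segment 0 u # Ks). f i \<in> (closed_segment 0 u # Ks) ! i"
      "y = (\<Sum>i<length (closed_segment 0 u # Ks). (t(0 := 0)) i *\<^sub>R f i)"
    unfolding mem_minkowski_combination by blast
  \<comment> \<open>If \<open>t 0 = 0\<close>, then s = 0 and the quotient 0 / 0 is 0, so the facts
    hold in this case too.\<close>
  have s: "t 0 * (s / t 0) = s" "0 \<le> s / t 0" "s / t 0 \<le> 1"
    using y(2,3) by (auto simp: divide_le_eq_1)
  define g where "g = f(0 := (s / t 0) *\<^sub>R u)"
  have "\<forall>i<length (closed_segment 0 u # Ks). g i \<in> (closed_segment 0 u # Ks) ! i"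
    using f(1) s by (auto simp: g_def closed_segment_def)
  moreover have "x = (\<Sum>i<length (closed_segment 0 u # Ks). t i *\<^sub>R g i)"
    unfolding y(1) f(2) unfolding sum_length_Cons using s by (simp add: g_def)
  ultimately show "x \<in> minkowski_combination t (closed_segment 0 u # Ks)"
    unfolding mem_minkowski_combination by blast
qed

lemma convex_body_segment: "convex_body (closed_segment a b)"
  by (simp add: convex_body_def)

text \<open>\<open>K\<close> and \<open>L\<close> have the same projection along \<open>u\<close>.
  Adding further bodies preserves this, so both combinations gain the same volume when swept by the
  segment.\<close>

lemma mixed_volume_segment_cong:
  fixes K L :: "(real^'n) set"
  assumes K: "convex_body K" and L: "convex_body L" and Ks: "\<forall>K\<in>set Ks. convex_body K"
    and len: "length Ks + 2 = CARD('n)" and KL: "K \<subseteq> L"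
    and proj: "\<And>y. y \<in> L \<Longrightarrow> \<exists>s. y + s *\<^sub>R u \<in> K"
  shows "mixed_volume (closed_segment 0 u # K # Ks) = mixed_volume (closed_segment 0 u # L # Ks)"
proof (rule mixed_volume_cong_difference)
  fix t :: "nat \<Rightarrow> real" assume t: "\<And>i. i < CARD('n) \<Longrightarrow> 0 \<le> t i"
  define A where "A = minkowski_combination (t(0 := 0)) (closed_segment 0 u # K # Ks)"
  define B where "B = minkowski_combination (t(0 := 0)) (closed_segment 0 u # L # Ks)"
  have t0: "0 \<le> t 0" using t by simp
  have "measure lebesgue (sweep A u (t 0)) - measure lebesgue A =
      measure lebesgue (sweep B u (t 0)) - measure lebesgue B"
  proof (rule measure_sweep_difference)
    show "convex_body A" unfolding A_def
      using K Ks by (intro convex_body_minkowski_combination) (auto simp: convex_body_segment)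
    show "convex_body B" unfolding B_def
      using L Ks by (intro convex_body_minkowski_combination) (auto simp: convex_body_segment)
    show "A \<subseteq> B" unfolding A_def B_def
    proof (rule minkowski_combination_mono)
      show "(closed_segment 0 u # K # Ks) ! i \<subseteq> (closed_segment 0 u # L # Ks) ! i" for i
        using KL by (auto simp: nth_Cons split: nat.splits)
    qed simp
    show "\<exists>s. b + s *\<^sub>R u \<in> A" if "b \<in> B" for b
    proof -
      from that obtain f where f: "\<forall>i<length (closed_segment 0 u # L # Ks). f i \<in> (closed_segment 0 u # L # Ks) ! i"
        "b = (\<Sum>i<length (closed_segment 0 u # L # Ks). (t(0 := 0)) i *\<^sub>R f i)"
        unfolding B_def mem_minkowski_combination by blast
      from f(1)[rule_format, of 1] have "f 1 \<in> L" by simp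
      then obtain s where s: "f 1 + s *\<^sub>R u \<in> K" using proj by blast
      \<comment> \<open>Sliding the second summand by s u moves the whole sum by t_1 s u, which is
        again along \<open>u\<close>.\<close>
      define g where "g = f(1 := f 1 + s *\<^sub>R u)"
      have "\<forall>i<length (closed_segment 0 u # K # Ks). g i \<in> (closed_segment 0 u # K # Ks) ! i"
      proof (intro allI impI)
        fix i assume i: "i < length (closed_segment 0 u # K # Ks)"
        consider "i = 0" | "i = 1" | j where "i = Suc (Suc j)" by (metis One_nat_def not0_implies_Suc)
        then show "g i \<in> (closed_segment 0 u # K # Ks) ! i"
          using f(1)[rule_format, of i] i s by cases (auto simp: g_def)
      qed
      moreover have "b + (t 1 * s) *\<^sub>R u = (\<Sum>i<length (closed_segment 0 u # K # Ks). (t(0 := 0)) i *\<^sub>R g i)"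
        unfolding f(2) sum_length_Cons by (simp add: g_def scaleR_add_right)
      ultimately have "b + (t 1 * s) *\<^sub>R u \<in> A"
        unfolding A_def mem_minkowski_combination by blast
      then show ?thesis ..
    qed
  qed (rule t0)
  then show "measure lebesgue (minkowski_combination t (closed_segment 0 u # K # Ks)) -
        measure lebesgue (minkowski_combination (t(0 := 0)) (closed_segment 0 u # K # Ks)) =
      measure lebesgue (minkowski_combination t (closed_segment 0 u # L # Ks)) -
        measure lebesgue (minkowski_combination (t(0 := 0)) (closed_segment 0 u # L # Ks))"
    unfolding A_def B_def using minkowski_combination_segment[of t u, OF t0] by simp
qed (use K L Ks len in \<open>auto simp: convex_body_segment\<close>)

subsection \<open>Mixed volumes as derivatives of volumes\<close>

definition combination2 :: "'a::real_vector set \<Rightarrow> 'a set \<Rightarrow> real \<Rightarrow> real \<Rightarrow> 'a set" where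
  "combination2 K D a b = {a *\<^sub>R k + b *\<^sub>R d |k d. k \<in> K \<and> d \<in> D}"

text \<open>A weighted sum of points of \<open>D\<close> is the total weight times their weighted
  mean, which convexity keeps in \<open>D\<close>. If the total is zero, so are all weights, and any
  point of \<open>D\<close> serves.\<close>

lemma minkowski_combination_replicate:
  assumes D: "convex D" "D \<noteq> {}" and t: "\<And>i. i < m \<Longrightarrow> 0 \<le> t (Suc i)"
  shows "minkowski_combination t (K # replicate m D) = combination2 K D (t 0) (\<Sum>i<m. t (Suc i))"
proof (intro equalityI subsetI)
  fix x assume "x \<in> minkowski_combination t (K # replicate m D)"
  then obtain f where f: "\<forall>i<length (K # replicate m D). f i \<in> (K # replicate m D) ! i"
      "x = (\<Sum>i<length (K # replicate m D). t i *\<^sub>R f i)"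
    unfolding mem_minkowski_combination by blast
  have f0: "f 0 \<in> K" using f(1)[rule_format, of 0] by simp
  have fD: "f (Suc i) \<in> D" if "i < m" for i using f(1)[rule_format, of "Suc i"] that by simp
  define s where "s = (\<Sum>i<m. t (Suc i))"
  have "\<exists>d\<in>D. (\<Sum>i<m. t (Suc i) *\<^sub>R f (Suc i)) = s *\<^sub>R d"
  proof (cases "s = 0")
    case True
    then have "\<forall>i\<in>{..<m}. t (Suc i) = 0"
      unfolding s_def using t by (subst (asm) sum_nonneg_eq_0_iff) auto
    then show ?thesis using D(2) True by auto
  next
    case False
    moreover have "0 \<le> s" unfolding s_def using t by (intro sum_nonneg) auto
    ultimately have s: "0 < s" by simp
    define d where "d = (\<Sum>i<m. (t (Suc i) / s) *\<^sub>R f (Suc i))"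
    have "d \<in> D" unfolding d_def
    proof (rule convex_sum)
      show "(\<Sum>i<m. t (Suc i) / s) = 1" using s by (simp add: s_def flip: sum_divide_distrib)
    qed (use D t fD s in auto)
    moreover have "(\<Sum>i<m. t (Suc i) *\<^sub>R f (Suc i)) = s *\<^sub>R d"
      using s by (simp add: d_def scaleR_sum_right)
    ultimately show ?thesis by blast
  qed
  then obtain d where d: "d \<in> D" "(\<Sum>i<m. t (Suc i) *\<^sub>R f (Suc i)) = s *\<^sub>R d" by blast
  have "x = t 0 *\<^sub>R f 0 + s *\<^sub>R d"
    unfolding f(2) sum_length_Cons using d(2) by simp
  then show "x \<in> combination2 K D (t 0) (\<Sum>i<m. t (Suc i))"
    using f0 d(1) by (auto simp: combination2_def s_def)
next
  fix x assume "x \<in> combination2 K D (t 0) (\<Sum>i<m. t (Suc i))"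
  then obtain k d where x: "x = t 0 *\<^sub>R k + (\<Sum>i<m. t (Suc i)) *\<^sub>R d" "k \<in> K" "d \<in> D"
    by (auto simp: combination2_def)
  define f where "f i = (if i = 0 then k else d)" for i :: nat
  have "\<forall>i<length (K # replicate m D). f i \<in> (K # replicate m D) ! i"
    using x by (auto simp: f_def nth_Cons split: nat.splits)
  moreover have "x = (\<Sum>i<length (K # replicate m D). t i *\<^sub>R f i)"
    unfolding sum_length_Cons by (simp add: x(1) f_def scaleR_sum_left)
  ultimately show "x \<in> minkowski_combination t (K # replicate m D)"
    unfolding mem_minkowski_combination by blast
qed

lemma volume_combination2_polynomial:
  fixes K D :: "(real^'n) set"
  assumes "convex_body K" "convex_body D"
  shows "\<exists>e. \<forall>a\<ge>0. \<forall>b\<ge>0. measure lebesgue (combination2 K D a b) =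
     (\<Sum>j\<le>CARD('n). e j * a ^ j * b ^ (CARD('n) - j))"
proof -
  have "\<forall>L\<in>set [K, D]. convex_body L" using assms by simp
  then obtain c where c: "volume_coeffs [K, D] c"
    by (rule minkowski_theorem[THEN exE])
  define g :: "nat \<Rightarrow> nat \<Rightarrow> nat" where "g j i = (if i = 0 then j else if i = 1 then CARD('n) - j else 0)" for j i
  have "measure lebesgue (combination2 K D a b) =
     (\<Sum>j\<le>CARD('n). c (g j) * a ^ j * b ^ (CARD('n) - j))" if ab: "0 \<le> a" "0 \<le> b" for a b
  proof -
    define t where "t i = (if i = 0 then a else b)" for i :: nat
    have "combination2 K D a b = minkowski_combination t (K # replicate 1 D)"
      using assms(2) ab by (subst minkowski_combination_replicate) (auto simp: convex_body_def t_def)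
    then have "measure lebesgue (combination2 K D a b) = measure lebesgue (minkowski_combination t [K, D])"
      by simp
    also have "\<dots> = (\<Sum>\<alpha>\<in>exponents (length [K, D]) CARD('n). c \<alpha> * (\<Prod>i<length [K, D]. t i ^ \<alpha> i))"
      by (rule c[unfolded volume_coeffs_def, rule_format]) (use ab in \<open>simp add: t_def\<close>)
    also have "length [K, D] = 2" by simp
    also have "(\<Sum>\<alpha>\<in>exponents 2 CARD('n). c \<alpha> * (\<Prod>i<2. t i ^ \<alpha> i)) =
        (\<Sum>\<alpha>\<in>exponents 2 CARD('n). c \<alpha> * (a ^ \<alpha> 0 * b ^ \<alpha> 1))"
      by (intro sum.cong refl) (simp add: t_def lessThan_nat_numeral lessThan_Suc)
    also have "\<dots> = (\<Sum>j\<le>CARD('n). c (g j) * (a ^ j * b ^ (CARD('n) - j)))"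
    proof (rule sum.reindex_bij_witness[of _ g "\<lambda>\<alpha>. \<alpha> 0"])
      fix \<alpha> assume "\<alpha> \<in> exponents 2 CARD('n)"
      then have a: "\<alpha> 0 + \<alpha> 1 = CARD('n)" "\<And>i. i \<ge> 2 \<Longrightarrow> \<alpha> i = 0"
        by (auto simp: exponents_def numeral_2_eq_2)
      show "g (\<alpha> 0) = \<alpha>"
      proof
        fix i :: nat
        consider "i = 0" | "i = 1" | "i \<ge> 2" by linarith
        then show "g (\<alpha> 0) i = \<alpha> i"
        proof cases
          case 2
          have "\<alpha> 1 = CARD('n) - \<alpha> 0" using a(1) by linarith
          then show ?thesis using 2 by (simp add: g_def)
        qed (simp_all add: g_def a(2))
      qed
      moreover have "CARD('n) - \<alpha> 0 = \<alpha> 1" using a(1) by linarith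
      ultimately show "c (g (\<alpha> 0)) * (a ^ \<alpha> 0 * b ^ (CARD('n) - \<alpha> 0)) = c \<alpha> * (a ^ \<alpha> 0 * b ^ \<alpha> 1)"
        by (simp only:)
      show "\<alpha> 0 \<in> {..CARD('n)}" using a(1) by simp
    next
      fix j assume "j \<in> {..CARD('n)}"
      then show "g j \<in> exponents 2 CARD('n)" by (auto simp: g_def exponents_def numeral_2_eq_2)
      show "g j 0 = j" by (simp add: g_def)
    qed
    finally show ?thesis by (simp add: mult.assoc)
  qed
  then show ?thesis by (intro exI[of _ "\<lambda>j. c (g j)"]) simp
qed

text \<open>Replacing a by t_0 and b by t_1 + ... + t_(n-1) turns \<open>e\<close> into a
  coefficient family for the whole list. Only \<open>e 1\<close> reaches the monomial t_0 ...
  t_(n-1), with factor (n-1)!, and division by n! leaves 1 / n.\<close>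

lemma mixed_volume_eq_coefficient:
  fixes K D :: "(real^'n) set"
  assumes D: "convex_body D" and n: "2 \<le> CARD('n)"
    and e: "\<And>a b. 0 \<le> a \<Longrightarrow> 0 \<le> b \<Longrightarrow> measure lebesgue (combination2 K D a b) =
     (\<Sum>j\<le>CARD('n). e j * a ^ j * b ^ (CARD('n) - j))"
  shows "mixed_volume (K # replicate (CARD('n) - 1) D) = e 1 / CARD('n)"
proof -
  let ?n = "CARD('n)"
  have "\<forall>j\<in>{..?n}. \<exists>N :: (nat \<Rightarrow> nat) \<Rightarrow> real.
      (\<forall>t. t 0 ^ j * (\<Sum>i\<in>{1..<?n}. t i) ^ (?n - j) = (\<Sum>\<alpha>\<in>exponents ?n ?n. N \<alpha> * (\<Prod>i<?n. t i ^ \<alpha> i))) \<and>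
      N (ones ?n) = (if j = 1 then fact (?n - 1) else 0)"
  proof
    fix j assume "j \<in> {..?n}"
    then have "j \<le> ?n" by simp
    from power_times_sum_power_expansion[OF n this]
    show "\<exists>N :: (nat \<Rightarrow> nat) \<Rightarrow> real.
      (\<forall>t. t 0 ^ j * (\<Sum>i\<in>{1..<?n}. t i) ^ (?n - j) = (\<Sum>\<alpha>\<in>exponents ?n ?n. N \<alpha> * (\<Prod>i<?n. t i ^ \<alpha> i))) \<and>
      N (ones ?n) = (if j = 1 then fact (?n - 1) else 0)"
      by blast
  qed
  from bchoice[OF this] obtain N :: "nat \<Rightarrow> (nat \<Rightarrow> nat) \<Rightarrow> real" where
    N: "\<And>j t. j \<le> ?n \<Longrightarrow> t 0 ^ j * (\<Sum>i\<in>{1..<?n}. t i) ^ (?n - j) =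
        (\<Sum>\<alpha>\<in>exponents ?n ?n. N j \<alpha> * (\<Prod>i<?n. t i ^ \<alpha> i))"
    and N1: "\<And>j. j \<le> ?n \<Longrightarrow> N j (ones ?n) = (if j = 1 then fact (?n - 1) else 0)"
    by fastforce
  define c where "c \<alpha> = (\<Sum>j\<le>?n. e j * N j \<alpha>)" for \<alpha>
  have len: "length (K # replicate (?n - 1) D) = ?n" using n by simp
  have "volume_coeffs (K # replicate (?n - 1) D) c"
    unfolding volume_coeffs_def len
  proof (intro allI impI)
    fix t :: "nat \<Rightarrow> real" assume t: "\<forall>i<?n. 0 \<le> t i"
    have shift: "(\<Sum>i<?n - 1. t (Suc i)) = (\<Sum>i\<in>{1..<?n}. t i)"
      using sum.shift_bounds_Suc_ivl[of t 0 "?n - 1"] n by (simp add: lessThan_atLeast0)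
    have "minkowski_combination t (K # replicate (?n - 1) D) =
        combination2 K D (t 0) (\<Sum>i<?n - 1. t (Suc i))"
      using t D by (intro minkowski_combination_replicate) (auto simp: convex_body_def)
    then have "measure lebesgue (minkowski_combination t (K # replicate (?n - 1) D)) =
        (\<Sum>j\<le>?n. e j * t 0 ^ j * (\<Sum>i\<in>{1..<?n}. t i) ^ (?n - j))"
      using t n unfolding shift by (simp only:) (intro e sum_nonneg, auto)
    also have "\<dots> = (\<Sum>j\<le>?n. e j * (\<Sum>\<alpha>\<in>exponents ?n ?n. N j \<alpha> * (\<Prod>i<?n. t i ^ \<alpha> i)))"
    proof (intro sum.cong refl)
      fix j assume "j \<in> {..?n}"
      then show "e j * t 0 ^ j * (\<Sum>i\<in>{1..<?n}. t i) ^ (?n - j) =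
          e j * (\<Sum>\<alpha>\<in>exponents ?n ?n. N j \<alpha> * (\<Prod>i<?n. t i ^ \<alpha> i))"
        using N[of j t] by (simp add: mult.assoc)
    qed
    also have "\<dots> = (\<Sum>\<alpha>\<in>exponents ?n ?n. c \<alpha> * (\<Prod>i<?n. t i ^ \<alpha> i))"
      unfolding c_def sum_distrib_left sum_distrib_right by (subst sum.swap) (simp add: mult.assoc)
    finally show "measure lebesgue (minkowski_combination t (K # replicate (?n - 1) D)) =
        (\<Sum>\<alpha>\<in>exponents ?n ?n. c \<alpha> * (\<Prod>i<?n. t i ^ \<alpha> i))" .
  qed
  then have "mixed_volume (K # replicate (?n - 1) D) = c (ones ?n) / fact ?n"
    by (rule mixed_volume_eq[OF _ len])
  also have "c (ones ?n) = (\<Sum>j\<le>?n. if j = 1 then e j * fact (?n - 1) else 0)"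
    unfolding c_def by (intro sum.cong refl) (simp add: N1)
  also have "\<dots> = e 1 * fact (?n - 1)"
    using n by simp
  also have "e 1 * fact (?n - 1) / fact ?n = e 1 / ?n"
    by (subst fact_reduce[of ?n]) auto
  finally show ?thesis .
qed

lemma tendsto_divide_real_at_0:
  assumes "0 < (\<kappa> :: real)"
  shows "filterlim (\<lambda>N. \<kappa> / real N) (at 0) sequentially"
proof -
  have "(\<lambda>N. \<kappa> / real N) \<longlonglongrightarrow> 0"
    by (rule lim_const_over_n)
  moreover have "eventually (\<lambda>N. \<kappa> / real N \<noteq> 0) sequentially"
    using eventually_gt_at_top[of 0] by eventually_elim (use assms in auto)
  ultimately show ?thesis by (rule filterlim_atI)
qed

text \<open>A difference quotient of a polynomial at 0 with derivative e 1 - n \<theta> e 0. Sweeps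
  use \<theta> = 0, convex combinations \<theta> = 1; the sequence \<kappa> / N suits the later
  arguments, which divide a sweep or a boundary layer into N parts.\<close>

lemma mixed_volume_derivative:
  fixes K D :: "(real^'n) set"
  assumes K: "convex_body K" and D: "convex_body D" and n: "2 \<le> CARD('n)"
    and \<kappa>: "0 < \<kappa>"
  shows "(\<lambda>N. (measure lebesgue (combination2 K D (\<kappa> / real N) (1 - \<theta> * (\<kappa> / real N))) -
      measure lebesgue D) / (\<kappa> / real N))
    \<longlonglongrightarrow> CARD('n) * (mixed_volume (K # replicate (CARD('n) - 1) D) - \<theta> * measure lebesgue D)"
proof -
  let ?n = "CARD('n)"
  obtain e where e: "\<And>a b. 0 \<le> a \<Longrightarrow> 0 \<le> b \<Longrightarrow> measure lebesgue (combination2 K D a b) =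
     (\<Sum>j\<le>?n. e j * a ^ j * b ^ (?n - j))"
    using volume_combination2_polynomial[OF K D] by blast
  have MV: "mixed_volume (K # replicate (?n - 1) D) = e 1 / ?n"
    by (rule mixed_volume_eq_coefficient[OF D n e])
  have "combination2 K D 0 1 = D"
    using K by (auto simp: combination2_def convex_body_def)
  moreover have only_0: "(\<Sum>j\<le>?n. e j * 0 ^ j * 1 ^ (?n - j)) = e 0"
  proof -
    have "(\<Sum>j\<le>?n. e j * 0 ^ j * 1 ^ (?n - j)) = (\<Sum>j\<le>?n. if j = 0 then e 0 else 0)"
      by (intro sum.cong) (auto simp: power_0_left)
    then show ?thesis by simp
  qed
  ultimately have e0: "measure lebesgue D = e 0" using e[of 0 1] by simp
  define q where "q s = (\<Sum>j\<le>?n. e j * s ^ j * (1 - \<theta> * s) ^ (?n - j))" for s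
  have "((\<lambda>s. e j * s ^ j * (1 - \<theta> * s) ^ (?n - j)) has_real_derivative
      (if j = 0 then - (?n * \<theta> * e 0) else if j = 1 then e 1 else 0)) (at 0)" for j
    by (auto intro!: derivative_eq_intros simp: power_0_left)
  then have "(q has_real_derivative
      (\<Sum>j\<le>?n. if j = 0 then - (?n * \<theta> * e 0) else if j = 1 then e 1 else 0)) (at 0)"
    unfolding q_def[abs_def] by (intro DERIV_sum)
  also have "(\<Sum>j\<le>?n. if j = 0 then - (?n * \<theta> * e 0) else if j = 1 then e 1 else 0) =
      (\<Sum>j\<le>?n. (if j = 0 then - (?n * \<theta> * e 0) else 0) + (if j = 1 then e 1 else 0))"
    by (intro sum.cong) auto
  also have "\<dots> = e 1 - ?n * \<theta> * e 0"
    using n by (simp add: sum.distrib)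
  finally have "((\<lambda>h. (q (0 + h) - q 0) / h) \<longlongrightarrow> e 1 - ?n * \<theta> * e 0) (at 0)"
    unfolding DERIV_def .
  then have lim: "(\<lambda>N. (q (0 + \<kappa> / real N) - q 0) / (\<kappa> / real N)) \<longlonglongrightarrow> e 1 - ?n * \<theta> * e 0"
    by (rule filterlim_compose) (rule tendsto_divide_real_at_0[OF \<kappa>])
  have q0: "q 0 = measure lebesgue D"
    using only_0 by (simp add: q_def e0)
  \<comment> \<open>The polynomial formula holds for nonnegative weights, which is guaranteed for
    large \<open>N\<close>.\<close>
  have ev: "eventually (\<lambda>N. \<theta> * (\<kappa> / real N) \<le> 1) sequentially"
  proof -
    have "(\<lambda>N. \<theta> * (\<kappa> / real N)) \<longlonglongrightarrow> \<theta> * 0"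
      by (intro tendsto_mult_left lim_const_over_n)
    then have "eventually (\<lambda>N. \<theta> * (\<kappa> / real N) < 1) sequentially"
      by (rule order_tendstoD) simp
    then show ?thesis by eventually_elim simp
  qed
  have eq: "measure lebesgue (combination2 K D (\<kappa> / real N) (1 - \<theta> * (\<kappa> / real N))) = q (\<kappa> / real N)"
    if "\<theta> * (\<kappa> / real N) \<le> 1" for N
    using that \<kappa> by (simp add: e q_def)
  from ev have "eventually (\<lambda>N. (q (0 + \<kappa> / real N) - q 0) / (\<kappa> / real N) =
      (measure lebesgue (combination2 K D (\<kappa> / real N) (1 - \<theta> * (\<kappa> / real N))) -
      measure lebesgue D) / (\<kappa> / real N)) sequentially"
    by eventually_elim (simp only: eq q0 add_0_left)
  with lim have "(\<lambda>N. (measure lebesgue (combination2 K D (\<kappa> / real N) (1 - \<theta> * (\<kappa> / real N))) -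
      measure lebesgue D) / (\<kappa> / real N)) \<longlonglongrightarrow> e 1 - ?n * \<theta> * e 0"
    by (rule Lim_transform_eventually)
  moreover have "e 1 - ?n * \<theta> * e 0 = ?n * (mixed_volume (K # replicate (?n - 1) D) - \<theta> * measure lebesgue D)"
    using MV by (simp add: e0 right_diff_distrib)
  ultimately show ?thesis by simp
qed

lemma combination2_self:
  assumes "convex D" "0 \<le> t" "t \<le> 1"
  shows "combination2 D D t (1 - t) = D"
proof (intro equalityI subsetI)
  fix x assume "x \<in> combination2 D D t (1 - t)"
  then show "x \<in> D" using assms by (auto simp: combination2_def intro: convexD)
next
  fix x assume "x \<in> D"
  moreover have "x = t *\<^sub>R x + (1 - t) *\<^sub>R x" by (simp flip: scaleR_add_left)
  ultimately show "x \<in> combination2 D D t (1 - t)" unfolding combination2_def by blast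
qed

text \<open>For \<theta> = 1 the combinations of \<open>D\<close> with itself are all
  \<open>D\<close>, so the derivative n (V(D, ..., D) - vol D) is 0.\<close>

lemma mixed_volume_replicate:
  fixes D :: "(real^'n) set"
  assumes D: "convex_body D" and n: "2 \<le> CARD('n)"
  shows "mixed_volume (D # replicate (CARD('n) - 1) D) = measure lebesgue D"
proof -
  have "combination2 D D (1 / real N) (1 - 1 * (1 / real N)) = D" if "N > 0" for N
    using D that combination2_self[of D "1 / real N"] by (simp add: convex_body_def)
  then have "eventually (\<lambda>N. (measure lebesgue (combination2 D D (1 / real N) (1 - 1 * (1 / real N))) -
      measure lebesgue D) / (1 / real N) = 0) sequentially"
    by (intro eventually_sequentiallyI[of 1]) simp
  then have "(\<lambda>N. (measure lebesgue (combination2 D D (1 / real N) (1 - 1 * (1 / real N))) -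
      measure lebesgue D) / (1 / real N)) \<longlonglongrightarrow> 0"
    by (rule tendsto_eventually)
  then have "CARD('n) * (mixed_volume (D # replicate (CARD('n) - 1) D) - 1 * measure lebesgue D) = 0"
    using mixed_volume_derivative[OF D D n zero_less_one, of 1] LIMSEQ_unique by blast
  then show ?thesis by simp
qed

lemma combination2_segment:
  assumes "0 \<le> s"
  shows "combination2 (closed_segment 0 u) D s 1 = sweep D u s"
proof (intro equalityI subsetI)
  fix x assume "x \<in> combination2 (closed_segment 0 u) D s 1"
  then obtain p d where p: "x = s *\<^sub>R p + 1 *\<^sub>R d" "p \<in> closed_segment 0 u" "d \<in> D"
    unfolding combination2_def by blast
  from p(2) obtain v where v: "0 \<le> v" "v \<le> 1" "p = v *\<^sub>R u" unfolding in_segment by auto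
  have "x = d + (s * v) *\<^sub>R u" using p(1) v(3) by simp
  moreover have "0 \<le> s * v" "s * v \<le> s" using v assms by (auto simp: mult_left_le)
  ultimately show "x \<in> sweep D u s" using p(3) unfolding sweep_def by blast
next
  fix x assume "x \<in> sweep D u s"
  then obtain d r where x: "x = d + r *\<^sub>R u" "d \<in> D" "0 \<le> r" "r \<le> s" by (auto simp: sweep_def)
  have "s * (r / s) = r" "0 \<le> r / s" "r / s \<le> 1" using x(3,4) by (auto simp: divide_le_eq_1)
  then have "x = s *\<^sub>R ((r / s) *\<^sub>R u) + 1 *\<^sub>R d" "(r / s) *\<^sub>R u \<in> closed_segment 0 u"
    unfolding x(1) in_segment by (simp, intro exI[of _ "r / s"]) simp
  then show "x \<in> combination2 (closed_segment 0 u) D s 1"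
    using x(2) unfolding combination2_def by blast
qed

lemma convex_body_sweep:
  fixes D :: "'a::euclidean_space set"
  assumes "convex_body D" "0 \<le> l"
  shows "convex_body (sweep D u l)"
proof -
  have "sweep D u l = (\<lambda>p. fst p + snd p *\<^sub>R u) ` (D \<times> {0..l})"
    unfolding sweep_def by (force intro: image_eqI[where x = "(_, _)"])
  moreover have "linear (\<lambda>p. fst p + snd p *\<^sub>R u)"
    by (rule linearI) (simp_all add: scaleR_add_left scaleR_add_right)
  then have "convex ((\<lambda>p. fst p + snd p *\<^sub>R u) ` (D \<times> {0..l}))"
    using assms by (intro convex_linear_image convex_Times) (auto simp: convex_body_def)
  ultimately have "convex (sweep D u l)" by simp
  moreover have "sweep D u l \<noteq> {}"
  proof -
    obtain d where "d \<in> D" using assms(1) by (auto simp: convex_body_def)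
    then have "d + 0 *\<^sub>R u \<in> sweep D u l" using assms(2) unfolding sweep_def by blast
    then show ?thesis by blast
  qed
  ultimately show ?thesis
    using assms by (simp add: convex_body_def compact_sweep)
qed

lemma sweep_sweep:
  assumes "0 \<le> s" "0 \<le> t"
  shows "sweep (sweep D u s) u t = sweep D u (s + t)"
proof (intro equalityI subsetI)
  fix x assume "x \<in> sweep (sweep D u s) u t"
  then obtain y q where y: "x = y + q *\<^sub>R u" "y \<in> sweep D u s" "0 \<le> q" "q \<le> t"
    unfolding sweep_def[of "sweep D u s"] by blast
  from y(2) obtain d p where d: "y = d + p *\<^sub>R u" "d \<in> D" "0 \<le> p" "p \<le> s"
    unfolding sweep_def by blast
  have "x = d + (p + q) *\<^sub>R u" using y(1) d(1) by (simp add: scaleR_add_left)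
  with y d show "x \<in> sweep D u (s + t)"
    unfolding sweep_def by (intro CollectI exI[of _ d] exI[of _ "p + q"]) auto
next
  fix x assume "x \<in> sweep D u (s + t)"
  then obtain d p where d: "x = d + p *\<^sub>R u" "d \<in> D" "0 \<le> p" "p \<le> s + t" by (auto simp: sweep_def)
  have "d + min p s *\<^sub>R u \<in> sweep D u s"
    using d assms unfolding sweep_def by (intro CollectI exI[of _ d] exI[of _ "min p s"]) auto
  moreover have "x = (d + min p s *\<^sub>R u) + (p - min p s) *\<^sub>R u"
    using d(1) by (simp add: algebra_simps)
  moreover have "0 \<le> p - min p s" "p - min p s \<le> t" using d(4) assms by auto
  ultimately show "x \<in> sweep (sweep D u s) u t"
    unfolding sweep_def[of "sweep D u s"] by blast
qed

text \<open>\<open>D\<close> and its sweep have the same projection along \<open>u\<close>, so a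
  further sweep by \<open>t\<close> adds the same volume to both.\<close>

lemma measure_sweep_additive:
  fixes D :: "'a::euclidean_space set"
  assumes D: "convex_body D" and s: "0 \<le> s" "0 \<le> t"
  shows "measure lebesgue (sweep D u (s + t)) - measure lebesgue D =
    (measure lebesgue (sweep D u s) - measure lebesgue D) +
    (measure lebesgue (sweep D u t) - measure lebesgue D)"
proof -
  have "measure lebesgue (sweep D u t) - measure lebesgue D =
      measure lebesgue (sweep (sweep D u s) u t) - measure lebesgue (sweep D u s)"
  proof (rule measure_sweep_difference[OF D convex_body_sweep[OF D s(1)] _ s(2)])
    show "D \<subseteq> sweep D u s"
    proof
      fix x assume "x \<in> D"
      then show "x \<in> sweep D u s"
        unfolding sweep_def using s by (intro CollectI exI[of _ x] exI[of _ "0::real"]) auto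
    qed
    fix b assume "b \<in> sweep D u s"
    then obtain d r where "b = d + r *\<^sub>R u" "d \<in> D" by (auto simp: sweep_def)
    then show "\<exists>r. b + r *\<^sub>R u \<in> D" by (intro exI[of _ "- r"]) simp
  qed
  then show ?thesis by (simp add: sweep_sweep[OF s])
qed

text \<open>The gain in volume is additive in the length of the sweep, so all difference quotients
  along L / N equal the gain at L divided by L. For large L the sweep contains two disjoint
  translates of \<open>D\<close>, so this gain is at least vol D.\<close>

lemma mixed_volume_segment_pos:
  fixes D :: "(real^'n) set"
  assumes D: "convex_body D" and n: "2 \<le> CARD('n)" and u: "u \<noteq> 0" and pos: "0 < measure lebesgue D"
  shows "0 < mixed_volume (closed_segment 0 u # replicate (CARD('n) - 1) D)"
proof -
  define h where "h s = measure lebesgue (sweep D u s) - measure lebesgue D" for s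
  have h_mult: "h (real N * s) = real N * h s" if "0 \<le> s" for N s
  proof (induction N)
    case 0
    have "sweep D u 0 = D"
    proof (intro equalityI subsetI)
      show "x \<in> sweep D u 0" if "x \<in> D" for x
        unfolding sweep_def using that by (intro CollectI exI[of _ x] exI[of _ "0::real"]) simp
    qed (auto simp: sweep_def)
    then show ?case by (simp add: h_def)
  next
    case (Suc N)
    have "h (real N * s + s) = h (real N * s) + h s"
      unfolding h_def using that by (intro measure_sweep_additive[OF D]) auto
    then show ?case using Suc by (simp add: algebra_simps)
  qed
  obtain M where M: "\<And>x. x \<in> D \<Longrightarrow> norm x \<le> M" "0 < M"
    using D compact_imp_bounded bounded_pos unfolding convex_body_def by metis
  \<comment> \<open>Norms on \<open>D\<close> are at most M, so a translation by more than 2 M makes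
    \<open>D\<close> disjoint from its translate.\<close>
  define L where "L = 3 * M / norm u"
  have L: "0 < L" "L * norm u = 3 * M" using M(2) u by (auto simp: L_def)
  have "D \<inter> (+) (L *\<^sub>R u) ` D = {}"
  proof (rule ccontr)
    assume "D \<inter> (+) (L *\<^sub>R u) ` D \<noteq> {}"
    then obtain y where y: "y \<in> D" "L *\<^sub>R u + y \<in> D" by blast
    have "norm (L *\<^sub>R u) \<le> norm (L *\<^sub>R u + y) + norm y"
      using norm_triangle_ineq4[of "L *\<^sub>R u + y" y] by simp
    then show False using M(1)[OF y(1)] M(1)[OF y(2)] L M(2) by simp
  qed
  moreover have mD: "D \<in> lmeasurable" by (rule convex_body_lmeasurable[OF D])
  ultimately have "2 * measure lebesgue D = measure lebesgue (D \<union> (+) (L *\<^sub>R u) ` D)"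
    using measure_Un3[OF mD measurable_translation[OF mD, of "L *\<^sub>R u"]] by (simp add: measure_translation)
  also have "\<dots> \<le> measure lebesgue (sweep D u L)"
  proof (rule measure_mono_fmeasurable)
    show "D \<union> (+) (L *\<^sub>R u) ` D \<subseteq> sweep D u L"
    proof
      fix x assume "x \<in> D \<union> (+) (L *\<^sub>R u) ` D"
      then consider "x \<in> D" | y where "x = y + L *\<^sub>R u" "y \<in> D" by (auto simp: add.commute)
      then show "x \<in> sweep D u L"
      proof cases
        case 1
        then show ?thesis unfolding sweep_def using L by (intro CollectI exI[of _ x] exI[of _ "0::real"]) auto
      next
        case (2 y)
        then show ?thesis unfolding sweep_def using L by (intro CollectI exI[of _ y] exI[of _ L]) auto
      qed
    qed
    show "D \<union> (+) (L *\<^sub>R u) ` D \<in> sets lebesgue"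
      using mD measurable_translation[OF mD] by (intro fmeasurableD fmeasurable.Un)
    show "sweep D u L \<in> lmeasurable"
      using L convex_body_sweep[OF D] by (intro convex_body_lmeasurable) auto
  qed
  finally have hL: "measure lebesgue D \<le> h L" by (simp add: h_def)
  have "(\<lambda>N. (measure lebesgue (combination2 (closed_segment 0 u) D (L / real N) (1 - 0 * (L / real N))) -
      measure lebesgue D) / (L / real N))
    \<longlonglongrightarrow> CARD('n) * (mixed_volume (closed_segment 0 u # replicate (CARD('n) - 1) D) - 0 * measure lebesgue D)"
    by (rule mixed_volume_derivative[OF convex_body_segment D n L(1)])
  then have "measure lebesgue D / L \<le>
    CARD('n) * (mixed_volume (closed_segment 0 u # replicate (CARD('n) - 1) D) - 0 * measure lebesgue D)"
  proof (rule LIMSEQ_le_const)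
    have "measure lebesgue D / L \<le>
      (measure lebesgue (combination2 (closed_segment 0 u) D (L / real N) (1 - 0 * (L / real N))) -
      measure lebesgue D) / (L / real N)" if "N \<ge> 1" for N
    proof -
      have "h (L / real N) = h L / real N"
        using h_mult[of "L / real N" N] that L(1) by (simp add: field_simps)
      then have "h (L / real N) / (L / real N) = h L / L"
        using that L(1) by simp
      moreover have "combination2 (closed_segment 0 u) D (L / real N) (1 - 0 * (L / real N)) = sweep D u (L / real N)"
        using L(1) by (simp add: combination2_segment)
      ultimately show ?thesis
        using hL L(1) by (simp add: h_def divide_right_mono)
    qed
    then show "\<exists>M. \<forall>N\<ge>M. measure lebesgue D / L \<le>
      (measure lebesgue (combination2 (closed_segment 0 u) D (L / real N) (1 - 0 * (L / real N))) -
      measure lebesgue D) / (L / real N)" by blast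
  qed
  moreover have "0 < measure lebesgue D / L" using pos L(1) by simp
  ultimately have "0 < CARD('n) * mixed_volume (closed_segment 0 u # replicate (CARD('n) - 1) D)"
    by simp
  then show ?thesis by (simp add: zero_less_mult_iff)
qed

subsection \<open>Strict points\<close>

text \<open>Otherwise the segment from \<open>x\<close> to \<open>b\<close> lies in \<open>D\<close>
  and in a supporting hyperplane, hence in the frontier. Segments ending at \<open>x\<close> are
  excluded by strictness as well.\<close>

lemma strict_point_unique_support:
  fixes D :: "'a::euclidean_space set"
  assumes D: "convex_body D" and x: "strict_point D x"
    and a: "a \<noteq> 0" "\<And>y. y \<in> D \<Longrightarrow> a \<bullet> y \<le> a \<bullet> x" and b: "b \<in> D" "a \<bullet> b = a \<bullet> x"
  shows "b = x"
proof (rule ccontr)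
  assume "b \<noteq> x"
  have clD: "closed D" using D by (simp add: convex_body_def compact_imp_closed)
  then have xD: "x \<in> D"
    using x frontier_subset_closed by (auto simp: strict_point_def)
  have "closed_segment x b \<subseteq> frontier D"
  proof
    fix p assume p: "p \<in> closed_segment x b"
    have pD: "p \<in> D"
      using p D xD b(1) closed_segment_subset[of x D b] by (auto simp: convex_body_def)
    from p obtain v where "p = (1 - v) *\<^sub>R x + v *\<^sub>R b" by (auto simp: closed_segment_def)
    then have "a \<bullet> p = (1 - v) * (a \<bullet> x) + v * (a \<bullet> b)" by (simp add: inner_add_right)
    then have ap: "a \<bullet> p = a \<bullet> x" by (simp add: b(2) algebra_simps)
    have "p \<notin> interior D"
    proof
      assume "p \<in> interior D"
      then obtain e where e: "e > 0" "cball p e \<subseteq> D" by (auto simp: mem_interior_cball)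
      have "p + (e / norm a) *\<^sub>R a \<in> cball p e"
        using e(1) a(1) by (simp add: dist_norm)
      then have "a \<bullet> (p + (e / norm a) *\<^sub>R a) \<le> a \<bullet> x" using e(2) a(2) by blast
      moreover have "0 < (e / norm a) * (a \<bullet> a)" using e(1) a(1) by simp
      ultimately show False by (simp add: inner_add_right ap)
    qed
    then show "p \<in> frontier D"
      using pD clD by (simp add: frontier_def)
  qed
  then show False
    using x \<open>b \<noteq> x\<close> unfolding strict_point_def by (metis ends_in_segment(1))
qed

text \<open>Some supporting hyperplane passes through \<open>x\<close>. The ends of a segment in
  \<open>D\<close> around \<open>x\<close> would lie on it and hence coincide with \<open>x\<close>.
  Later this keeps \<open>x\<close> out of the hull \<open>K\<close>.\<close>

lemma strict_point_extreme:
  fixes D :: "'a::euclidean_space set"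
  assumes D: "convex_body D" and int: "interior D \<noteq> {}" and x: "strict_point D x"
  shows "x extreme_point_of D"
proof -
  have xD: "x \<in> D" "x \<notin> interior D"
    using x D frontier_subset_closed[of D]
    by (auto simp: strict_point_def frontier_def convex_body_def compact_imp_closed)
  then have "x \<notin> rel_interior D" using int by (simp add: rel_interior_nonempty_interior)
  moreover have "convex D" using D by (simp add: convex_body_def)
  ultimately obtain a where a: "a \<noteq> 0" "\<And>y. y \<in> D \<Longrightarrow> a \<bullet> x \<le> a \<bullet> y"
    using supporting_hyperplane_rel_boundary[of D x] xD(1) by metis
  \<comment> \<open>\<open>a\<close> is minimal at \<open>x\<close>, whereas the uniqueness lemma
    speaks of a maximum; hence the sign.\<close>
  note unique = strict_point_unique_support[OF D x, of "- a"]
  have "x \<notin> open_segment p q" if pq: "p \<in> D" "q \<in> D" for p q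
  proof
    assume "x \<in> open_segment p q"
    then obtain v where v: "p \<noteq> q" "0 < v" "v < 1" "x = (1 - v) *\<^sub>R p + v *\<^sub>R q"
      by (auto simp: in_segment)
    have "a \<bullet> x = (1 - v) * (a \<bullet> p) + v * (a \<bullet> q)"
      by (simp add: v(4) inner_add_right)
    then have "(1 - v) * (a \<bullet> p - a \<bullet> x) + v * (a \<bullet> q - a \<bullet> x) = 0"
      by (simp add: algebra_simps)
    moreover have "0 \<le> (1 - v) * (a \<bullet> p - a \<bullet> x)" "0 \<le> v * (a \<bullet> q - a \<bullet> x)"
      using v(2,3) a(2)[OF pq(1)] a(2)[OF pq(2)] by auto
    ultimately have "(1 - v) * (a \<bullet> p - a \<bullet> x) = 0" "v * (a \<bullet> q - a \<bullet> x) = 0" by linarith+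
    then have "a \<bullet> p = a \<bullet> x" "a \<bullet> q = a \<bullet> x" using v(2,3) by auto
    then have "p = x" "q = x"
      using unique[of p] unique[of q] a pq by simp_all
    then show False using v(1) by simp
  qed
  then show ?thesis using xD(1) by (simp add: extreme_point_of_def)
qed

text \<open>Every direction in which \<open>x\<close> is almost extremal in \<open>D\<close> loses at least \<open>\<delta>\<close> on passing
  from \<open>D\<close> to \<open>K\<close>; otherwise a limit of counterexamples would support \<open>D\<close> both at \<open>x\<close> and
  at a point of \<open>K\<close>.\<close>

lemma strict_point_support_gap:
  fixes D K :: "'a::euclidean_space set"
  assumes D: "convex_body D" and x: "strict_point D x"
    and K: "compact K" "K \<subseteq> D" "x \<notin> K"
  obtains \<delta> where "0 < \<delta>" "\<And>v b. norm v = 1 \<Longrightarrow> b \<in> K \<Longrightarrow>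
     \<exists>a\<in>D. v \<bullet> b + \<delta> \<le> v \<bullet> a \<or> v \<bullet> x + \<delta> \<le> v \<bullet> a"
proof -
  have "\<exists>\<delta>>0. \<forall>v b. norm v = 1 \<longrightarrow> b \<in> K \<longrightarrow>
     (\<exists>a\<in>D. v \<bullet> b + \<delta> \<le> v \<bullet> a \<or> v \<bullet> x + \<delta> \<le> v \<bullet> a)"
  proof (rule ccontr)
    assume neg: "\<not> ?thesis"
    have "\<forall>m. \<exists>p. p \<in> sphere 0 1 \<times> K \<and>
       (\<forall>a\<in>D. fst p \<bullet> a < fst p \<bullet> snd p + 1 / Suc m \<and> fst p \<bullet> a < fst p \<bullet> x + 1 / Suc m)"
    proof
      fix m
      have "0 < 1 / real (Suc m)" by simp
      then obtain v b where "norm v = 1" "b \<in> K"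
        "\<not> (\<exists>a\<in>D. v \<bullet> b + 1 / Suc m \<le> v \<bullet> a \<or> v \<bullet> x + 1 / Suc m \<le> v \<bullet> a)"
        using neg by blast
      then show "\<exists>p. p \<in> sphere 0 1 \<times> K \<and>
       (\<forall>a\<in>D. fst p \<bullet> a < fst p \<bullet> snd p + 1 / Suc m \<and> fst p \<bullet> a < fst p \<bullet> x + 1 / Suc m)"
        by (intro exI[of _ "(v, b)"]) (auto simp: not_le)
    qed
    from choice[OF this] obtain p where
      p: "\<And>m. p m \<in> sphere 0 1 \<times> K"
      "\<And>m a. a \<in> D \<Longrightarrow> fst (p m) \<bullet> a < fst (p m) \<bullet> snd (p m) + 1 / Suc m"
      "\<And>m a. a \<in> D \<Longrightarrow> fst (p m) \<bullet> a < fst (p m) \<bullet> x + 1 / Suc m"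
      by blast
    have "compact (sphere (0::'a) 1 \<times> K)" using K(1) by (intro compact_Times compact_sphere)
    then obtain l r where l: "l \<in> sphere 0 1 \<times> K" "strict_mono (r :: nat \<Rightarrow> nat)" "(p \<circ> r) \<longlonglongrightarrow> l"
      using p(1) unfolding compact_def by metis
    have v: "(\<lambda>m. fst (p (r m))) \<longlonglongrightarrow> fst l" and b: "(\<lambda>m. snd (p (r m))) \<longlonglongrightarrow> snd l"
      using l(3) by (auto simp: comp_def intro: tendsto_fst tendsto_snd)
    have zero: "(\<lambda>m. 1 / real (Suc (r m))) \<longlonglongrightarrow> 0"
      using LIMSEQ_subseq_LIMSEQ[OF LIMSEQ_Suc[OF lim_1_over_n] l(2)] by (simp add: comp_def)
    have le1: "fst l \<bullet> a \<le> fst l \<bullet> snd l" if "a \<in> D" for a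
    proof -
      have "(\<lambda>m. fst (p (r m)) \<bullet> a) \<longlonglongrightarrow> fst l \<bullet> a"
        by (intro tendsto_intros v)
      moreover have "(\<lambda>m. fst (p (r m)) \<bullet> snd (p (r m)) + 1 / real (Suc (r m))) \<longlonglongrightarrow> fst l \<bullet> snd l + 0"
        by (intro tendsto_add tendsto_inner v b zero)
      ultimately have "fst l \<bullet> a \<le> fst l \<bullet> snd l + 0"
        by (rule LIMSEQ_le) (intro exI[of _ 0] allI impI less_imp_le p(2)[OF that])
      then show ?thesis by simp
    qed
    have le2: "fst l \<bullet> a \<le> fst l \<bullet> x" if "a \<in> D" for a
    proof -
      have "(\<lambda>m. fst (p (r m)) \<bullet> a) \<longlonglongrightarrow> fst l \<bullet> a"
        by (intro tendsto_intros v)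
      moreover have "(\<lambda>m. fst (p (r m)) \<bullet> x + 1 / real (Suc (r m))) \<longlonglongrightarrow> fst l \<bullet> x + 0"
        by (intro tendsto_add tendsto_inner v tendsto_const zero)
      ultimately have "fst l \<bullet> a \<le> fst l \<bullet> x + 0"
        by (rule LIMSEQ_le) (intro exI[of _ 0] allI impI less_imp_le p(3)[OF that])
      then show ?thesis by simp
    qed
    have "x \<in> D"
      using x D frontier_subset_closed[of D] by (auto simp: strict_point_def convex_body_def compact_imp_closed)
    moreover have "snd l \<in> K" "norm (fst l) = 1" using l(1) by auto
    ultimately have "snd l = x"
      using le1[of x] le2 K(2) by (intro strict_point_unique_support[OF D x, of "fst l"]) (auto intro!: antisym)
    then show False using \<open>snd l \<in> K\<close> K(3) by simp
  qed
  then show thesis using that by blast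
qed

section \<open>Boundary layers around a strict point\<close>

text \<open>Otherwise a unit vector v separates \<open>D\<close> from p - w, so v stays below v . p
  + norm w on \<open>D\<close>. As \<open>p\<close> is close to \<open>x\<close>, the second
  alternative of the gap is impossible, so the part of \<open>p\<close> from \<open>K\<close> lies
  \<delta> below a level reached in \<open>D\<close>. With weight \<open>t\<close> this costs
  \<open>p\<close> at least t \<delta> \<ge> norm w, against the separation.\<close>

lemma combination2_avoids_boundary_layer:
  fixes D K :: "'a::euclidean_space set"
  assumes D: "convex D" "closed D"
    and gap: "\<And>v b. norm v = 1 \<Longrightarrow> b \<in> K \<Longrightarrow>
      \<exists>a\<in>D. v \<bullet> b + \<delta> \<le> v \<bullet> a \<or> v \<bullet> x + \<delta> \<le> v \<bullet> a"
    and t: "0 \<le> t" "t \<le> 1" and p: "p \<in> combination2 K D t (1 - t)"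
    and x: "dist p x < \<eta>" and w: "norm w \<le> t * \<delta>" "\<eta> + norm w \<le> \<delta>"
  shows "p - w \<in> D"
proof (rule ccontr)
  assume "p - w \<notin> D"
  from separating_hyperplane_closed_point[OF D this]
  obtain v' c where v': "v' \<bullet> (p - w) < c" "\<And>a. a \<in> D \<Longrightarrow> c < v' \<bullet> a" by blast
  obtain k d where kd: "p = t *\<^sub>R k + (1 - t) *\<^sub>R d" "k \<in> K" "d \<in> D"
    using p by (auto simp: combination2_def)
  have "v' \<noteq> 0" using v'(1) v'(2)[OF kd(3)] by auto
  define v where "v = (- 1 / norm v') *\<^sub>R v'"
  have v1: "norm v = 1" using \<open>v' \<noteq> 0\<close> by (simp add: v_def)
  have sep: "v \<bullet> a < v \<bullet> (p - w)" if "a \<in> D" for a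
  proof -
    have "v' \<bullet> (p - w) < v' \<bullet> a" using v'(1) v'(2)[OF that] by simp
    then show ?thesis using \<open>v' \<noteq> 0\<close> by (simp add: v_def divide_strict_right_mono)
  qed
  have cs: "\<bar>v \<bullet> y\<bar> \<le> norm y" for y using Cauchy_Schwarz_ineq2[of v y] v1 by simp
  have sep': "v \<bullet> a < v \<bullet> p + norm w" if "a \<in> D" for a
    using sep[OF that] cs[of w] by (simp add: inner_diff_right)
  obtain a where a: "a \<in> D" "v \<bullet> k + \<delta> \<le> v \<bullet> a \<or> v \<bullet> x + \<delta> \<le> v \<bullet> a"
    using gap[OF v1 kd(2)] by blast
  have "v \<bullet> p - v \<bullet> x \<le> norm (p - x)" using cs[of "p - x"] by (simp add: inner_diff_right)
  then have "v \<bullet> p \<le> v \<bullet> x + \<eta>" using x by (simp add: dist_norm)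
  then have "v \<bullet> k + \<delta> \<le> v \<bullet> a" using a(2) sep'[OF a(1)] w(2) by linarith
  \<comment> \<open>The larger of two levels attained in \<open>D\<close> stands in for its support
    function.\<close>
  define m where "m = max (v \<bullet> a) (v \<bullet> d)"
  have m: "m < v \<bullet> p + norm w" using sep'[OF a(1)] sep'[OF kd(3)] by (simp add: m_def)
  have "v \<bullet> p = t * (v \<bullet> k) + (1 - t) * (v \<bullet> d)" by (simp add: kd(1) inner_add_right)
  also have "\<dots> \<le> t * (m - \<delta>) + (1 - t) * m"
    using \<open>v \<bullet> k + \<delta> \<le> v \<bullet> a\<close> t by (intro add_mono mult_left_mono) (auto simp: m_def)
  also have "\<dots> = m - t * \<delta>" by (simp add: algebra_simps)
  finally show False using m w(1) by linarith
qed

text \<open>A substitute for surface area near \<open>x\<close>: the part of \<open>D\<close> near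
  \<open>x\<close> that lies outside the translate of \<open>D\<close> by \<open>w\<close>.\<close>

definition boundary_layer :: "'a::real_normed_vector set \<Rightarrow> 'a \<Rightarrow> real \<Rightarrow> 'a \<Rightarrow> 'a set" where
  "boundary_layer D x \<eta> w = {p\<in>D. dist p x < \<eta> \<and> p - w \<notin> D}"

lemma lmeasurable_boundary_layer:
  fixes D :: "'a::euclidean_space set"
  assumes "convex_body D"
  shows "boundary_layer D x \<eta> w \<in> lmeasurable"
proof -
  have "boundary_layer D x \<eta> w = (D \<inter> ball x \<eta>) - (+) w ` D"
    by (force simp: boundary_layer_def dist_commute image_iff)
  moreover have "D \<in> lmeasurable" using assms by (rule convex_body_lmeasurable)
  ultimately show ?thesis
    by (auto intro!: fmeasurable.Diff fmeasurable.Int measurable_translation lmeasurable_ball)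
qed

text \<open>The layer of width \<open>w\<close> is covered by \<open>N\<close> translates of the layer of width \<open>w / N\<close>, so
  thin layers have at least proportional volume.\<close>

lemma measure_boundary_layer_subdivide:
  fixes D :: "'a::euclidean_space set"
  assumes D: "convex_body D" and N: "0 < N" and w: "norm w \<le> \<eta>"
  shows "measure lebesgue (boundary_layer D x \<eta> w) \<le>
     N * measure lebesgue (boundary_layer D x (2 * \<eta>) ((1 / real N) *\<^sub>R w))"
proof -
  define w' where "w' = (1 / real N) *\<^sub>R w"
  define E where "E = boundary_layer D x (2 * \<eta>) w'"
  have mE: "E \<in> lmeasurable" unfolding E_def by (rule lmeasurable_boundary_layer[OF D])
  have "boundary_layer D x \<eta> w \<subseteq> (\<Union>j<N. (+) (real j *\<^sub>R w') ` E)"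
  proof
    fix q assume q: "q \<in> boundary_layer D x \<eta> w"
    have "\<exists>j. q - real j *\<^sub>R w' \<notin> D"
      using q N by (intro exI[of _ N]) (auto simp: boundary_layer_def w'_def)
    \<comment> \<open>Step back from \<open>q\<close> by w / N until \<open>D\<close> is left; the
      last point inside lies in the thin layer. It is at most norm w \<le> \<eta> away from
      \<open>q\<close>, which is why the radius doubles.\<close>
    define j where "j = (LEAST j. q - real j *\<^sub>R w' \<notin> D)"
    have j: "q - real j *\<^sub>R w' \<notin> D"
      unfolding j_def by (rule LeastI_ex) fact
    have "j \<noteq> 0"
    proof
      assume "j = 0"
      then show False using j q by (simp add: boundary_layer_def)
    qed
    then obtain i where i: "j = Suc i" by (cases j) auto
    have "q - real i *\<^sub>R w' \<in> D"
      using not_less_Least[of i "\<lambda>j. q - real j *\<^sub>R w' \<notin> D"] i by (auto simp: j_def)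
    have "j \<le> N"
      unfolding j_def by (rule Least_le) (use q N in \<open>auto simp: boundary_layer_def w'_def\<close>)
    then have "i < N" using i by simp
    have "norm (real i *\<^sub>R w') \<le> \<eta>"
    proof -
      have "norm (real i *\<^sub>R w') = (real i / real N) * norm w" by (simp add: w'_def)
      also have "\<dots> \<le> 1 * norm w"
        using \<open>i < N\<close> by (intro mult_right_mono) auto
      finally show ?thesis using w by simp
    qed
    moreover have "dist (q - real i *\<^sub>R w') x \<le> dist q x + norm (real i *\<^sub>R w')"
      using norm_triangle_ineq4[of "q - x" "real i *\<^sub>R w'"] by (simp add: dist_norm algebra_simps)
    ultimately have "dist (q - real i *\<^sub>R w') x < 2 * \<eta>"
      using q by (auto simp: boundary_layer_def)
    moreover have "q - real i *\<^sub>R w' - w' \<notin> D" using j by (simp add: i algebra_simps)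
    ultimately have "q - real i *\<^sub>R w' \<in> E"
      using \<open>q - real i *\<^sub>R w' \<in> D\<close> by (simp add: E_def boundary_layer_def)
    then have "q \<in> (+) (real i *\<^sub>R w') ` E"
      by (intro image_eqI[where x = "q - real i *\<^sub>R w'"]) simp_all
    then show "q \<in> (\<Union>j<N. (+) (real j *\<^sub>R w') ` E)" using \<open>i < N\<close> by blast
  qed
  then have "measure lebesgue (boundary_layer D x \<eta> w) \<le> measure lebesgue (\<Union>j<N. (+) (real j *\<^sub>R w') ` E)"
    using lmeasurable_boundary_layer[OF D] measurable_translation[OF mE]
    by (intro measure_mono_fmeasurable) (auto intro!: fmeasurable.finite_UN fmeasurableD)
  also have "\<dots> \<le> (\<Sum>j<N. measure lebesgue ((+) (real j *\<^sub>R w') ` E))"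
    using measurable_translation[OF mE] by (intro measure_UNION_le) (auto intro: fmeasurableD)
  also have "\<dots> = N * measure lebesgue E" by (simp add: measure_translation)
  finally show ?thesis by (simp add: E_def w'_def)
qed

text \<open>x - l u is outside \<open>D\<close>, since otherwise \<open>x\<close> would be strictly
  between the interior point x + u and a point of \<open>D\<close>. As \<open>D\<close> is closed,
  this persists on a neighbourhood of \<open>x\<close>, which meets the interior of
  \<open>D\<close>.\<close>

lemma measure_boundary_layer_pos:
  fixes D :: "'a::euclidean_space set"
  assumes D: "convex_body D" and x: "x \<in> D" "x \<notin> interior D" and u: "x + u \<in> interior D"
    and l: "0 < l" and \<eta>: "0 < \<eta>"
  shows "0 < measure lebesgue (boundary_layer D x \<eta> (l *\<^sub>R u))"
proof -
  have conv: "convex D" and clD: "closed D" using D by (auto simp: convex_body_def compact_imp_closed)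
  have out: "x - l *\<^sub>R u \<notin> D"
  proof
    assume in_D: "x - l *\<^sub>R u \<in> D"
    have "u \<noteq> 0" using u x(2) by auto
    have ne: "x + u \<noteq> x - l *\<^sub>R u"
    proof
      assume "x + u = x - l *\<^sub>R u"
      then have "(1 + l) *\<^sub>R u = 0" by (simp add: algebra_simps)
      then show False using \<open>u \<noteq> 0\<close> l by simp
    qed
    \<comment> \<open>The weight 1 / (1 + l) balances the displacements u and - l u.\<close>
    have "x \<in> open_segment (x + u) (x - l *\<^sub>R u)"
      unfolding in_segment
    proof (intro conjI ne exI[of _ "1 / (1 + l)"])
      have "(1 - 1 / (1 + l)) *\<^sub>R (x + u) + (1 / (1 + l)) *\<^sub>R (x - l *\<^sub>R u) =
          x + ((1 - 1 / (1 + l)) - (1 / (1 + l)) * l) *\<^sub>R u"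
        by (simp add: algebra_simps)
      also have "(1 - 1 / (1 + l)) - (1 / (1 + l)) * l = 0" using l by (simp add: field_simps)
      finally show "x = (1 - 1 / (1 + l)) *\<^sub>R (x + u) + (1 / (1 + l)) *\<^sub>R (x - l *\<^sub>R u)" by simp
    qed (use l in auto)
    then have "x \<in> interior D"
      using in_interior_closure_convex_segment[OF conv u, of "x - l *\<^sub>R u"] in_D closure_subset by blast
    then show False using x(2) by simp
  qed
  define U where "U = ball x \<eta> \<inter> (\<lambda>p. p - l *\<^sub>R u) -` (- D)"
  have "open U"
    unfolding U_def using clD by (intro open_Int open_ball open_vimage continuous_intros) auto
  moreover have "x \<in> U" using out \<eta> by (simp add: U_def)
  moreover have "x \<in> closure (interior D)"
    using convex_closure_interior[OF conv] u x(1) closure_subset by blast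
  ultimately have "U \<inter> interior D \<noteq> {}"
    using open_Int_closure_eq_empty[of U "interior D"] by blast
  then have "\<not> negligible (U \<inter> interior D)"
    using \<open>open U\<close> by (intro open_not_negligible open_Int open_interior)
  moreover have "U \<inter> interior D \<subseteq> boundary_layer D x \<eta> (l *\<^sub>R u)"
    using interior_subset by (auto simp: U_def boundary_layer_def dist_commute)
  ultimately have "\<not> negligible (boundary_layer D x \<eta> (l *\<^sub>R u))"
    using negligible_subset by blast
  then have "measure lebesgue (boundary_layer D x \<eta> (l *\<^sub>R u)) \<noteq> 0"
    using negligible_iff_measure lmeasurable_boundary_layer[OF D] by blast
  then show ?thesis by (simp add: less_le)
qed

text \<open>The difference quotients of vol(t K + (1 - t) D) at t = \<kappa> / N stay below - m /
  \<kappa>, because a thin layer of volume at least m / N is lost; their limit is n (V(K, D[n-1]) -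
  vol D).\<close>

lemma mixed_volume_less_if_strict_point_removed:
  fixes D K :: "(real^'n) set"
  assumes D: "convex_body D" and K: "convex_body K" "K \<subseteq> D" "x \<notin> K" and n: "2 \<le> CARD('n)"
    and x: "strict_point D x" and u: "x + u \<in> interior D"
  shows "mixed_volume (K # replicate (CARD('n) - 1) D) < measure lebesgue D"
proof -
  have cD: "convex D" "closed D" using D by (auto simp: convex_body_def compact_imp_closed)
  have xD: "x \<in> D" "x \<notin> interior D"
    using x frontier_subset_closed[OF cD(2)] by (auto simp: strict_point_def frontier_def)
  then have u0: "u \<noteq> 0" using u by auto
  have cK: "compact K" using K(1) by (simp add: convex_body_def)
  obtain \<delta> where \<delta>: "0 < \<delta>" "\<And>v b. norm v = 1 \<Longrightarrow> b \<in> K \<Longrightarrow>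
     \<exists>a\<in>D. v \<bullet> b + \<delta> \<le> v \<bullet> a \<or> v \<bullet> x + \<delta> \<le> v \<bullet> a"
    using strict_point_support_gap[OF D x cK K(2,3)] by blast
  \<comment> \<open>The width norm w is \<delta> / 4. The radius \<delta> / 4 doubles under
    subdivision, and a thinned width of at most \<delta> / 4 keeps the sum within \<delta>. \<kappa>
    is such that t = \<kappa> / N gives t \<delta> = norm w / N, the thinned width.\<close>
  define l where "l = \<delta> / (4 * norm u)"
  define w where "w = l *\<^sub>R u"
  define \<kappa> where "\<kappa> = norm w / \<delta>"
  have l: "0 < l" using \<delta>(1) u0 by (simp add: l_def)
  have norm_w: "norm w = \<delta> / 4" using l u0 \<delta>(1) by (simp add: w_def l_def)
  have \<kappa>: "\<kappa> = 1 / 4" using norm_w \<delta>(1) by (simp add: \<kappa>_def)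
  define m where "m = measure lebesgue (boundary_layer D x (\<delta> / 4) w)"
  have m: "0 < m"
    unfolding m_def w_def using \<delta>(1) by (intro measure_boundary_layer_pos[OF D xD u l]) simp
  have bound: "(measure lebesgue (combination2 K D (\<kappa> / real N) (1 - 1 * (\<kappa> / real N))) -
      measure lebesgue D) / (\<kappa> / real N) \<le> - (m / \<kappa>)" if N: "N \<ge> 1" for N
  proof -
    define t where "t = \<kappa> / real N"
    define E where "E = boundary_layer D x (2 * (\<delta> / 4)) ((1 / real N) *\<^sub>R w)"
    have t: "0 < t" "t \<le> 1" using N by (auto simp: t_def \<kappa> field_simps)
    have w_small: "norm ((1 / real N) *\<^sub>R w) = t * \<delta>"
      using N \<delta>(1) by (simp add: t_def \<kappa> norm_w)
    have "t * \<delta> \<le> \<delta> / 4"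
      using N \<delta>(1) by (simp add: t_def \<kappa> field_simps)
    then have "2 * (\<delta> / 4) + t * \<delta> \<le> 2 * (\<delta> / 4) + \<delta> / 4" by (rule add_left_mono)
    also have "\<dots> \<le> \<delta>" using \<delta>(1) by simp
    finally have width: "2 * (\<delta> / 4) + norm ((1 / real N) *\<^sub>R w) \<le> \<delta>"
      by (simp only: w_small)
    have mE: "E \<in> lmeasurable" unfolding E_def by (rule lmeasurable_boundary_layer[OF D])
    have "m \<le> N * measure lebesgue E"
      unfolding m_def E_def by (rule measure_boundary_layer_subdivide[OF D]) (use N norm_w in auto)
    then have mE_ge: "m / N \<le> measure lebesgue E"
      using N by (simp add: field_simps)
    have sub: "combination2 K D t (1 - t) \<subseteq> D - E"
    proof
      fix p assume p: "p \<in> combination2 K D t (1 - t)"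
      then obtain k d where "p = t *\<^sub>R k + (1 - t) *\<^sub>R d" "k \<in> D" "d \<in> D"
        using K(2) by (auto simp: combination2_def)
      then have "p \<in> D" using cD(1) t by (auto intro: convexD)
      moreover have "p \<notin> E"
      proof
        assume "p \<in> E"
        then have "dist p x < 2 * (\<delta> / 4)" "p - (1 / real N) *\<^sub>R w \<notin> D"
          by (auto simp: E_def boundary_layer_def)
        moreover from this(1) have "p - (1 / real N) *\<^sub>R w \<in> D"
          using t(1) w_small
          by (intro combination2_avoids_boundary_layer[OF cD \<delta>(2) _ t(2) p _ _ width]) simp_all
        ultimately show False by simp
      qed
      ultimately show "p \<in> D - E" by simp
    qed
    have ED: "E \<subseteq> D" by (auto simp: E_def boundary_layer_def)
    have mD: "D \<in> lmeasurable" by (rule convex_body_lmeasurable[OF D])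
    have "measure lebesgue (combination2 K D t (1 - t)) \<le> measure lebesgue (D - E)"
    proof (rule measure_mono_fmeasurable[OF sub])
      have "combination2 K D t (1 - t) = {a + b |a b. a \<in> (*\<^sub>R) t ` K \<and> b \<in> (*\<^sub>R) (1 - t) ` D}"
        by (auto simp: combination2_def)
      then have "compact (combination2 K D t (1 - t))"
        using cK D by (simp add: compact_sums compact_scaling convex_body_def)
      then show "combination2 K D t (1 - t) \<in> sets lebesgue"
        by (intro fmeasurableD lmeasurable_compact)
      show "D - E \<in> lmeasurable" using mD mE by (intro fmeasurable.Diff) (auto intro: fmeasurableD)
    qed
    also have "\<dots> = measure lebesgue D - measure lebesgue E"
      using mD mE ED by (intro measurable_measure_Diff) (auto intro: fmeasurableD)
    finally have "measure lebesgue (combination2 K D t (1 - t)) - measure lebesgue D \<le> - (m / N)"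
      using mE_ge by linarith
    then have "(measure lebesgue (combination2 K D t (1 - t)) - measure lebesgue D) / t \<le> - (m / N) / t"
      using t(1) by (intro divide_right_mono) auto
    also have "- (m / N) / t = - (m / \<kappa>)" using N by (simp add: t_def \<kappa>)
    finally show ?thesis by (simp add: t_def)
  qed
  have "CARD('n) * (mixed_volume (K # replicate (CARD('n) - 1) D) - 1 * measure lebesgue D) \<le> - (m / \<kappa>)"
  proof (rule LIMSEQ_le_const2[OF mixed_volume_derivative[OF K(1) D n, of \<kappa> 1]])
    show "0 < \<kappa>" by (simp add: \<kappa>)
  qed (intro exI[of _ 1] allI impI bound)
  also have "\<dots> < 0" using m \<kappa> by simp
  finally show ?thesis by (simp add: mult_less_0_iff)
qed

section \<open>The contradiction\<close>

lemma interior_nonempty_if_full_dim: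
  fixes D :: "'a::euclidean_space set"
  assumes "convex D" "D \<noteq> {}" "aff_dim D = int DIM('a)"
  shows "interior D \<noteq> {}"
  using assms by (metis interior_rel_interior rel_interior_eq_empty)

theorem theorem1p2:
  fixes \<Delta> :: "(real ^ 'n::finite) set" and r :: nat
  assumes "2 \<le> r" and "r \<le> CARD('n)"
    and "convex_body \<Delta>" and "aff_dim \<Delta> = int CARD('n)"
    and "\<And>Ks :: (real ^ 'n) set list.
           length Ks = r \<Longrightarrow> (\<forall>K\<in>set Ks. convex_body K) \<Longrightarrow>
           mixed_volume (Ks @ replicate (CARD('n) - r) \<Delta>) * measure lebesgue \<Delta> ^ (r - 1)
             \<le> (\<Prod>i<r. mixed_volume (Ks ! i # replicate (CARD('n) - 1) \<Delta>))"
  shows "\<not> (\<exists>x. strict_point \<Delta> x)"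
proof
  assume "\<exists>x. strict_point \<Delta> x"
  then obtain x where x: "strict_point \<Delta> x" ..
  note D = \<open>convex_body \<Delta>\<close>
  have n: "2 \<le> CARD('n)" using assms(1,2) by simp
  have cD: "convex \<Delta>" "compact \<Delta>" "closed \<Delta>" "\<Delta> \<noteq> {}"
    using D by (auto simp: convex_body_def compact_imp_closed)
  have int: "interior \<Delta> \<noteq> {}"
    using interior_nonempty_if_full_dim[OF cD(1,4)] assms(4) by simp
  have xD: "x \<in> \<Delta>" "x \<notin> interior \<Delta>"
    using x frontier_subset_closed[OF cD(3)] by (auto simp: strict_point_def frontier_def)
  obtain z where z: "z \<in> interior \<Delta>" using int by blast
  then obtain \<rho> where \<rho>: "0 < \<rho>" "ball z \<rho> \<subseteq> \<Delta>" by (auto simp: mem_interior)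
  have "\<rho> \<le> dist z x"
    using interior_maximal[OF \<rho>(2) open_ball] xD(2) by (meson mem_ball not_less subsetD)
  define u where "u = z - x"
  have u: "x + u \<in> interior \<Delta>" using z by (simp add: u_def)
  then have u0: "u \<noteq> 0" using xD(2) by auto
  \<comment> \<open>If y is within \<rho> / 2 of x, then y + u is within \<rho> / 2 of z, hence in
    \<Delta>, and more than \<rho> / 2 away from x, hence outside the removed ball. So every removed
    point is pushed along u into \<open>K\<close>.\<close>
  define K where "K = convex hull (\<Delta> - ball x (\<rho> / 2))"
  have "z \<in> \<Delta> - ball x (\<rho> / 2)"
    using \<open>\<rho> \<le> dist z x\<close> \<rho>(1) z interior_subset by (auto simp: dist_commute)
  then have "K \<noteq> {}" by (auto simp: K_def)
  moreover have "compact K"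
    unfolding K_def using cD(2) by (intro compact_convex_hull compact_diff) auto
  ultimately have K: "convex_body K" by (simp add: convex_body_def K_def)
  have KD: "K \<subseteq> \<Delta>" unfolding K_def using cD(1) by (intro hull_minimal) auto
  have xK: "x \<notin> K"
  proof
    assume "x \<in> K"
    \<comment> \<open>\<open>x\<close> stays extreme in the smaller set, and extreme points of a
      hull lie in the generating set, from which \<open>x\<close> was removed.\<close>
    then have "x extreme_point_of K"
      using strict_point_extreme[OF D int x] KD by (auto simp: extreme_point_of_def)
    then have "x \<in> \<Delta> - ball x (\<rho> / 2)"
      unfolding K_def by (rule extreme_point_of_convex_hull)
    then show False using \<rho>(1) by simp
  qed
  have proj: "\<exists>s. y + s *\<^sub>R u \<in> K" if y: "y \<in> \<Delta>" for y
  proof (cases "y \<in> ball x (\<rho> / 2)")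
    case True
    then have yx: "dist y x < \<rho> / 2" by (simp add: dist_commute)
    have "dist z (y + u) = dist y x"
      by (simp add: u_def dist_norm norm_minus_commute algebra_simps)
    then have "y + u \<in> \<Delta>" using yx \<rho> by (intro subsetD[OF \<rho>(2)]) auto
    moreover have "\<rho> \<le> dist z (y + u) + dist (y + u) x"
      using \<open>\<rho> \<le> dist z x\<close> dist_triangle[of z x "y + u"] by simp
    then have "y + u \<notin> ball x (\<rho> / 2)"
      using \<open>dist z (y + u) = dist y x\<close> yx by (simp add: dist_commute)
    ultimately have "y + 1 *\<^sub>R u \<in> K" by (simp add: K_def hull_inc)
    then show ?thesis ..
  next
    case False
    then have "y + 0 *\<^sub>R u \<in> K" using y by (simp add: K_def hull_inc)
    then show ?thesis ..
  qed
  define V where "V = measure lebesgue \<Delta>"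
  define I where "I = closed_segment 0 u"
  define M where "M = mixed_volume (I # replicate (CARD('n) - 1) \<Delta>)"
  have "\<not> negligible \<Delta>"
    using int open_not_negligible[OF open_interior] negligible_subset[OF _ interior_subset] by blast
  then have V: "0 < V"
    using negligible_iff_measure0[OF convex_body_lmeasurable[OF D]] by (simp add: V_def less_le)
  have M: "0 < M"
    unfolding M_def I_def using mixed_volume_segment_pos[OF D n u0] V by (simp add: V_def)
  have MK: "mixed_volume (K # replicate (CARD('n) - 1) \<Delta>) < V"
    unfolding V_def by (rule mixed_volume_less_if_strict_point_removed[OF D K KD xK n x u])
  \<comment> \<open>For this list the hypothesis becomes M V^(r-1) \<le> M V(K, \<Delta>[n-1])
    V^(r-2), and the positive factors cancel.\<close>
  define Ks where "Ks = I # K # replicate (r - 2) \<Delta>"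
  have len: "length Ks = r" using assms(1) by (simp add: Ks_def)
  have "mixed_volume (Ks @ replicate (CARD('n) - r) \<Delta>) * V ^ (r - 1)
      \<le> (\<Prod>i<r. mixed_volume (Ks ! i # replicate (CARD('n) - 1) \<Delta>))"
    unfolding V_def
  proof (rule assms(5)[OF len])
    show "\<forall>K\<in>set Ks. convex_body K"
      using K D by (auto simp: Ks_def I_def convex_body_segment)
  qed
  moreover have "mixed_volume (Ks @ replicate (CARD('n) - r) \<Delta>) = M"
  proof -
    have "Ks @ replicate (CARD('n) - r) \<Delta> = I # K # replicate (CARD('n) - 2) \<Delta>"
      using assms(1,2) by (simp add: Ks_def flip: replicate_add)
    then have "mixed_volume (Ks @ replicate (CARD('n) - r) \<Delta>) =
        mixed_volume (I # \<Delta> # replicate (CARD('n) - 2) \<Delta>)"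
      unfolding I_def using n D proj
      by (simp add: mixed_volume_segment_cong[OF K D _ _ KD])
    also have "\<Delta> # replicate (CARD('n) - 2) \<Delta> = replicate (CARD('n) - 1) \<Delta>"
      using n by (simp flip: replicate_Suc add: Suc_diff_le)
    finally show ?thesis by (simp add: M_def)
  qed
  moreover have "(\<Prod>i<r. mixed_volume (Ks ! i # replicate (CARD('n) - 1) \<Delta>)) =
      M * mixed_volume (K # replicate (CARD('n) - 1) \<Delta>) * V ^ (r - 2)"
  proof -
    obtain r' where r': "r = Suc (Suc r')" using assms(1) by (metis Suc_le_D numeral_2_eq_2 Suc_le_mono)
    have "(\<Prod>i<r. mixed_volume (Ks ! i # replicate (CARD('n) - 1) \<Delta>)) =
        M * (mixed_volume (K # replicate (CARD('n) - 1) \<Delta>) *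
        (\<Prod>i<r'. mixed_volume (replicate (r - 2) \<Delta> ! i # replicate (CARD('n) - 1) \<Delta>)))"
      unfolding r' prod.lessThan_Suc_shift by (simp add: Ks_def M_def r')
    also have "(\<Prod>i<r'. mixed_volume (replicate (r - 2) \<Delta> ! i # replicate (CARD('n) - 1) \<Delta>)) = V ^ (r - 2)"
    proof -
      have "replicate (r - 2) \<Delta> ! i = \<Delta>" if "i < r'" for i using that by (simp add: r')
      then have "(\<Prod>i<r'. mixed_volume (replicate (r - 2) \<Delta> ! i # replicate (CARD('n) - 1) \<Delta>)) = (\<Prod>i<r'. V)"
        unfolding V_def mixed_volume_replicate[OF D n, symmetric] by (intro prod.cong) auto
      then show ?thesis by (simp add: r')
    qed
    finally show ?thesis by (simp add: mult.assoc)
  qed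
  moreover have "V ^ (r - 1) = V * V ^ (r - 2)"
    using assms(1) by (metis One_nat_def Suc_1 Suc_diff_Suc Suc_le_lessD power_Suc)
  ultimately have "M * V ^ (r - 2) * V \<le> M * V ^ (r - 2) * mixed_volume (K # replicate (CARD('n) - 1) \<Delta>)"
    by (simp add: mult_ac)
  then have "V \<le> mixed_volume (K # replicate (CARD('n) - 1) \<Delta>)"
    using M V by (simp add: mult_le_cancel_left_pos)
  then show False using MK by simp
qed

end
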